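(* Let $R$ be a set. For every $R$-deco polygon $\pi$, the coproduct of $\mathrm B(\pi)$ in the Hopf algebra $\mathrm B(\mathcal P_\bullet(R))$ is $$\Delta\big(\mathrm B(\pi)\big)=\sum_{D\ \mathrm{admissible}}\mathrm{sgn}(D)\ \mathrm B(R^D)\otimes \prod_i{}^{\!\text{sh}}\ \mathrm B\big(P_i^D\big),$$ where $D$ runs through all admissible dissections of $\pi$ and $\prod^{\text{sh}}$ denotes the shuffle product; the sum includes the two particular terms $\mathrm B(\pi)\otimes1$ (corresponding to $R^D=\pi$) and $1\otimes\mathrm B(\pi)$ (corresponding to $R^D=\emptyset$). Thus the subalgebra generated by the elements $\mathrm B(\pi)$, $\pi$ an $R$-deco polygon, is a Hopf subalgebra of $\mathrm B(\mathcal P_\bullet(R))$.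
   Context: **Polygons.** An $R$-deco polygon is an oriented convex polygon with $N\ge2$ sides decorated by elements of $R$, with a distinguished root side. The orientation gives a linear order of sides with root side last; write $[a_1,\dots,a_{n+1}]$ ($a_{n+1}$ on the root). Weight $\chi=n$ = number of non-root sides. $v_0$ is the vertex between root and first side (first vertex), $v_k$ the vertex between the $k$-th and $(k+1)$-st side. $\mathcal P=\mathcal P_\bullet(R)$ is the exterior $\mathbb Q$-algebra (with unit) on the vector space with basis the $R$-deco polygons. An arrow goes from a vertex $v_k$ to the interior of a side $a_l$ (arrows with same vertex and side are identified); it is trivial if $v_k$ is an endpoint of the side, forward if $l>k$, backward otherwise. For a non-trivial forward arrow $\alpha:v_k\to a_l$ put $\pi_\alpha^{rt}=[a_1,\dots,a_k,a_l,\dots,a_{n+1}]$, $\pi_\alpha^{co}=[a_{k+1},\dots,a_{l-1},a_l]$, $\mathrm{sgn}(\alpha)=1$; for a non-trivial backward arrow ($l<k$) put $\pi_\alpha^{rt}=[a_1,\dots,a_l,a_{k+1},\dots,a_{n+1}]$, $\pi_\alpha^{co}=[a_k,\dots,a_{l+1},a_l]$, $\mathrm{sgn}(\alpha)=(-1)^{k-l}$. Then $\partial\pi=\sum_\alpha\mathrm{sgn}(\alpha)\pi_\alpha^{rt}\wedge\pi_\alpha^{co}$ over non-trivial arrows, extended as a derivation with sign given by exterior degree. **Dissections.** Two arrows do not intersect if (for suitable endpoints on the sides) they have no point in common except possibly the starting point. An $n$-fold dissection $D$ of $\pi$ is the set of $n$ regions cut out by $n-1$ distinct, pairwise non-intersecting,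 non-trivial arrows. The root region is the one containing the first vertex and part of the root side. The dual tree $\tau(D)$ has the regions as vertices, the arrows as edges, and the root region as root; it defines a partial order on the regions (a region precedes those further from the root along the tree). Each region gives an $R$-deco polygon by contracting all arrows in its boundary: for the root region, root side and orientation are those of $\pi$; for any other region, let $\alpha$ be the unique boundary arrow closest to the root; the root side is the one where $\alpha$ ends, and the orientation is that of $\pi$ if $\alpha$ is forward, the opposite one if $\alpha$ is backward. Denote this polygon $\pi^{co}_{D,\alpha}$. $\mathrm{sgn}(D)=\prod_{\alpha\text{ backward arrow of }D}(-1)^{\chi(\pi^{co}_{D,\alpha})}$. $D$ is admissible if every simple path in $\tau(D)$ from the root to a leaf vertex contains at most one of the edges dual to the arrows of $D$ (i.e. every non-root region is adjacent to the root region); $R^D$ denotes then the polygon of the root region and $P_i^D$ the polygons of the remaining regions. The dissection without arrows has $R^D=\pi$ and contributes $\mathrm B(\pi)\otimes 1$; in addition the case $R^D=\emptyset$ with the single remaining polygon $\pi$, sign $+1$ and $\mathrm B(\emptyset)=1$, is counted as admissible. **The element $\mathrm B(\pi)$.** $\mathrm B(\pi)=\sum_{n\ge1}\sum_D\mathrm{sgn}(D)\sum_\lambda[\pi_D^{\lambda(1)}|\cdots|\pi_D^{\lambda(n)}]$, over all $n$-fold dissections $D$ of $\pi$ and all linear orders $\lambda$ of the associated polygons $\pi_D^i$ compatible with the partial order of $\tau(D)$. **Bar construction.** $\mathrm B(\mathcal P)$ is the tensor coalgebra on the augmentation ideal of $\mathcal P$, with words written $[x_1|\cdots|x_N]$,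 with deconcatenation coproduct $\Delta[x_1|\cdots|x_N]=\sum_{j=0}^N[x_1|\cdots|x_j]\otimes[x_{j+1}|\cdots|x_N]$ and (graded) shuffle product, letters $x_i$ having shifted degree (exterior degree minus one), so that no signs occur for words whose letters are polygons. It carries the usual bar differential built from $\partial$ and $\wedge$. *)

theory Defs
  imports Complex_Main "HOL-Library.Poly_Mapping" "HOL-Library.Product_Lexorder"
begin

section \<open>Rational vector spaces with a basis\<close>

definition pm_scale :: "rat \<Rightarrow> ('w \<Rightarrow>\<^sub>0 rat) \<Rightarrow> ('w \<Rightarrow>\<^sub>0 rat)" where
  "pm_scale c x = Poly_Mapping.map ((*) c) x"

lemma lookup_pm_scale [simp]:
  "Poly_Mapping.lookup (pm_scale c x) w = c * Poly_Mapping.lookup x w"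
  unfolding pm_scale_def by (simp add: Poly_Mapping.map.rep_eq when_def)

global_interpretation pm: vector_space "pm_scale :: rat \<Rightarrow> ('w \<Rightarrow>\<^sub>0 rat) \<Rightarrow> _"
  by unfold_locales
    (auto intro!: poly_mapping_eqI simp: Poly_Mapping.lookup_add algebra_simps)

definition lin_ext :: "('w \<Rightarrow> ('u \<Rightarrow>\<^sub>0 rat)) \<Rightarrow> ('w \<Rightarrow>\<^sub>0 rat) \<Rightarrow> ('u \<Rightarrow>\<^sub>0 rat)" where
  "lin_ext f x = (\<Sum>w\<in>Poly_Mapping.keys x. pm_scale (Poly_Mapping.lookup x w) (f w))"

abbreviation basis :: "'w \<Rightarrow> ('w \<Rightarrow>\<^sub>0 rat)" where
  "basis w \<equiv> Poly_Mapping.single w 1"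


section \<open>The Hopf algebra of the bar construction\<close>

text \<open>
  Let P be the exterior algebra over the rationals on the vector space with basis 'a.
  Choosing, for every nonempty finite set of elements of 'a, one of the two wedge
  monomials (equal up to sign) with these factors gives a homogeneous basis of the
  augmentation ideal of P. Hence the finite words in such monomials form a basis of the
  tensor coalgebra. The coproduct, the shuffle product and the antipode depend only on the
  graded vector space underlying the augmentation ideal, and not on the choices of sign;
  the multiplication and the differential of P enter only the bar differential.
\<close>

typedef 'a wedge = "{S :: 'a set. finite S \<and> S \<noteq> {}}"
  morphisms factors Wedge
  by (rule exI[of _ "{undefined}"]) simp

text \<open>Exterior degree minus one.\<close>

definition shifted_degree :: "'a wedge \<Rightarrow> nat" where
  "shifted_degree x = card (factors x) - 1"

type_synonym 'a word = "'a wedge list"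
type_synonym 'a bar = "'a word \<Rightarrow>\<^sub>0 rat"

text \<open>
  The tensor square of the bar construction has the pairs of words as a basis.
\<close>

type_synonym 'a bar2 = "('a word \<times> 'a word) \<Rightarrow>\<^sub>0 rat"

definition tensor :: "'a bar \<Rightarrow> 'a bar \<Rightarrow> 'a bar2"  (infixr "\<otimes>" 70) where
  "x \<otimes> y = lin_ext (\<lambda>u. lin_ext (\<lambda>v. basis (u, v)) y) x"

definition bar_one :: "'a bar" where
  "bar_one = basis []"

definition coproduct :: "'a bar \<Rightarrow> 'a bar2" where
  "coproduct = lin_ext (\<lambda>w. \<Sum>j\<le>length w. basis (take j w, drop j w))"

definition word_degree :: "'a word \<Rightarrow> nat" where
  "word_degree w = sum_list (map shifted_degree w)"

fun shuffle_words :: "'a word \<Rightarrow> 'a word \<Rightarrow> 'a bar" where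
  "shuffle_words [] v = basis v"
| "shuffle_words (x # u) [] = basis (x # u)"
| "shuffle_words (x # u) (y # v) =
     lin_ext (\<lambda>w. basis (x # w)) (shuffle_words u (y # v))
     + pm_scale ((- 1) ^ (shifted_degree y * word_degree (x # u)))
         (lin_ext (\<lambda>w. basis (y # w)) (shuffle_words (x # u) v))"

definition shuffle :: "'a bar \<Rightarrow> 'a bar \<Rightarrow> 'a bar" where
  "shuffle x y = lin_ext (\<lambda>u. lin_ext (\<lambda>v. shuffle_words u v) y) x"

definition shuffle_list :: "'a bar list \<Rightarrow> 'a bar" where
  "shuffle_list xs = foldr shuffle xs bar_one"

text \<open>The sign, besides \<open>(- 1) ^ length w\<close>, is the Koszul sign of reversing \<open>w\<close>.\<close>

definition antipode :: "'a bar \<Rightarrow> 'a bar" where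
  "antipode = lin_ext (\<lambda>w.
     pm_scale ((- 1) ^ length w *
         (\<Prod>(i, j)\<in>{(i, j). i < j \<and> j < length w}.
            (- 1) ^ (shifted_degree (w ! i) * shifted_degree (w ! j))))
       (basis (rev w)))"

inductive_set generated_subalgebra :: "'a bar set \<Rightarrow> 'a bar set" for G where
  gen: "x \<in> G \<Longrightarrow> x \<in> generated_subalgebra G"
| one: "bar_one \<in> generated_subalgebra G"
| add: "x \<in> generated_subalgebra G \<Longrightarrow> y \<in> generated_subalgebra G
    \<Longrightarrow> x + y \<in> generated_subalgebra G"
| scale: "x \<in> generated_subalgebra G \<Longrightarrow> pm_scale c x \<in> generated_subalgebra G"
| mult: "x \<in> generated_subalgebra G \<Longrightarrow> y \<in> generated_subalgebra G
    \<Longrightarrow> shuffle x y \<in> generated_subalgebra G"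

definition hopf_subalgebra :: "'a bar set \<Rightarrow> bool" where
  "hopf_subalgebra H \<longleftrightarrow>
     pm.subspace H \<and>
     bar_one \<in> H \<and>
     (\<forall>x\<in>H. \<forall>y\<in>H. shuffle x y \<in> H) \<and>
     (\<forall>x\<in>H. coproduct x \<in> pm.span {y \<otimes> z | y z. y \<in> H \<and> z \<in> H}) \<and>
     (\<forall>x\<in>H. antipode x \<in> H)"


section \<open>Polygons and arrows\<close>

text \<open>
  The polygon \<open>[a\<^sub>1, \<dots>, a\<^sub>n\<^sub>+\<^sub>1]\<close> is the list of its decorations, root side last.
  Sides are numbered from \<open>1\<close> to \<open>n + 1\<close>, and vertices from \<open>0\<close> to \<open>n\<close>.
\<close>

typedef 'r polygon = "{xs :: 'r list. length xs \<ge> 2}"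
  morphisms decorations Polygon
  by (rule exI[of _ "[undefined, undefined]"]) simp

definition weight :: "'r polygon \<Rightarrow> nat" where
  "weight p = length (decorations p) - 1"

definition decoration :: "'r polygon \<Rightarrow> nat \<Rightarrow> 'r" where
  "decoration p i = decorations p ! (i - 1)"

text \<open>The pair \<open>(k, l)\<close> is the arrow from the \<open>k\<close>-th vertex to the \<open>l\<close>-th side.\<close>

type_synonym arrow = "nat \<times> nat"

definition side_endpoints :: "'r polygon \<Rightarrow> nat \<Rightarrow> nat set" where
  "side_endpoints p l = {l - 1, l mod (weight p + 1)}"

definition nontrivial_arrows :: "'r polygon \<Rightarrow> arrow set" where
  "nontrivial_arrows p =
     {(k, l). k \<le> weight p \<and> 1 \<le> l \<and> l \<le> weight p + 1 \<and> k \<notin> side_endpoints p l}"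

fun forward :: "arrow \<Rightarrow> bool" where
  "forward (k, l) \<longleftrightarrow> k < l"

text \<open>
  The boundary of the polygon is cut open at the first vertex and parametrised so that
  the \<open>k\<close>-th vertex has parameter \<open>k\<close> and the interior of the \<open>l\<close>-th side is the open
  interval from \<open>l - 1\<close> to \<open>l\<close>. By convexity, two chords with four distinct end points
  meet if and only if the end points of the first one separate those of the second one on
  the boundary.
\<close>

definition separated :: "real \<Rightarrow> real \<Rightarrow> real \<Rightarrow> real \<Rightarrow> bool" where
  "separated s t x y \<longleftrightarrow> (min s t < x \<and> x < max s t) \<noteq> (min s t < y \<and> y < max s t)"

fun non_intersecting :: "arrow \<Rightarrow> arrow \<Rightarrow> bool" where
  "non_intersecting (k, l) (k', l') \<longleftrightarrow>
     (\<exists>s s'. real l - 1 < s \<and> s < real l \<and> real l' - 1 < s' \<and> s' < real l' \<and> s \<noteq> s' \<and>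
        (k = k' \<or> \<not> separated (real k) s (real k') s'))"


section \<open>Dissections\<close>

text \<open>
  A dissection is given by its set of arrows; the empty set is the dissection without
  arrows.
\<close>

definition dissections :: "'r polygon \<Rightarrow> arrow set set" where
  "dissections p = {A. A \<subseteq> nontrivial_arrows p \<and>
     (\<forall>\<alpha>\<in>A. \<forall>\<beta>\<in>A. \<alpha> \<noteq> \<beta> \<longrightarrow> non_intersecting \<alpha> \<beta>)}"

text \<open>
  An arrow divides the polygon into two parts; the root part contains the corner between
  the root side and the first vertex. \<open>cut_off \<alpha>\<close> consists of the sides which have a piece
  in the other part, behind \<open>\<alpha>\<close>. All of them lie entirely behind \<open>\<alpha>\<close>, except for the
  side where \<open>\<alpha>\<close> ends, of which both parts contain a piece.
\<close>

fun cut_off :: "arrow \<Rightarrow> nat set" where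
  "cut_off (k, l) = (if k < l then {k + 1..l} else {l..k})"

text \<open>
  For distinct arrows of a dissection, the parts behind them are either disjoint or nested,
  and the following says that \<open>\<beta>\<close> lies behind \<open>\<alpha>\<close> (for disjoint parts there is no inclusion
  between the sets \<open>cut_off\<close>, which have at least two elements and share at most one side).
\<close>

definition lies_behind :: "arrow \<Rightarrow> arrow \<Rightarrow> bool" where
  "lies_behind \<beta> \<alpha> \<longleftrightarrow> cut_off \<beta> \<subset> cut_off \<alpha>"

text \<open>
  Every region other than the root region has a unique boundary arrow closest to the
  root, and every arrow \<open>\<alpha>\<close> is such a boundary arrow for exactly one region, namely for
  the one adjacent to \<open>\<alpha>\<close> in the part behind \<open>\<alpha>\<close>, denoted by \<open>Behind \<alpha>\<close>.
\<close>

datatype region = Root | Behind arrow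

definition regions :: "arrow set \<Rightarrow> region set" where
  "regions A = insert Root (Behind ` A)"

text \<open>
  The edges of the dual tree, oriented away from the root. The edge dual to \<open>\<beta>\<close> joins
  \<open>Behind \<beta>\<close> to the region on the other side of \<open>\<beta>\<close>.
\<close>

definition dual_tree :: "arrow set \<Rightarrow> (region \<times> region) set" where
  "dual_tree A =
     {(Root, Behind \<beta>) | \<beta>. \<beta> \<in> A \<and> \<not> (\<exists>\<gamma>\<in>A. lies_behind \<beta> \<gamma>)} \<union>
     {(Behind \<alpha>, Behind \<beta>) | \<alpha> \<beta>. \<alpha> \<in> A \<and> \<beta> \<in> A \<and> lies_behind \<beta> \<alpha> \<and>
        \<not> (\<exists>\<gamma>\<in>A. lies_behind \<beta> \<gamma> \<and> lies_behind \<gamma> \<alpha>)}"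

definition precedes :: "arrow set \<Rightarrow> (region \<times> region) set" where
  "precedes A = (dual_tree A)\<^sup>+"

definition linear_orders :: "arrow set \<Rightarrow> region list set" where
  "linear_orders A = {rs. distinct rs \<and> set rs = regions A \<and>
     (\<forall>i j. i < length rs \<longrightarrow> j < length rs \<longrightarrow> (rs ! i, rs ! j) \<in> precedes A \<longrightarrow> i < j)}"

text \<open>
  The sides having a piece in a given region. A side gets lost if it lies entirely behind
  some arrow \<open>\<beta>\<close> of which the region is on the root part; the side where \<open>\<beta>\<close> ends is not lost.
\<close>

fun region_sides :: "'r polygon \<Rightarrow> arrow set \<Rightarrow> region \<Rightarrow> nat set" where
  "region_sides p A Root = {1..weight p + 1} - (\<Union>\<beta>\<in>A. cut_off \<beta> - {snd \<beta>})"
| "region_sides p A (Behind \<alpha>) =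
     cut_off \<alpha> - (\<Union>\<beta>\<in>{\<beta>\<in>A. lies_behind \<beta> \<alpha>}. cut_off \<beta> - {snd \<beta>})"

text \<open>
  The sides listed according to the orientation of the region, which is that of the
  polygon for the root region and for forward arrows, and the opposite one for backward
  arrows. In the latter case the side where \<open>\<alpha>\<close> ends has the least number in \<open>cut_off \<alpha>\<close>,
  in the case of a forward arrow the largest one, so it always comes last. For a dissection,
  every region has at least two sides, as required for \<open>Polygon\<close>.
\<close>

fun region_side_list :: "'r polygon \<Rightarrow> arrow set \<Rightarrow> region \<Rightarrow> nat list" where
  "region_side_list p A Root = sorted_list_of_set (region_sides p A Root)"
| "region_side_list p A (Behind \<alpha>) =
     (if forward \<alpha> then sorted_list_of_set (region_sides p A (Behind \<alpha>))
      else rev (sorted_list_of_set (region_sides p A (Behind \<alpha>))))"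

definition region_polygon :: "'r polygon \<Rightarrow> arrow set \<Rightarrow> region \<Rightarrow> 'r polygon" where
  "region_polygon p A r = Polygon (map (decoration p) (region_side_list p A r))"

definition dissection_sgn :: "'r polygon \<Rightarrow> arrow set \<Rightarrow> rat" where
  "dissection_sgn p A =
     (\<Prod>\<alpha>\<in>{\<alpha>\<in>A. \<not> forward \<alpha>}. (- 1) ^ weight (region_polygon p A (Behind \<alpha>)))"

definition admissible_dissections :: "'r polygon \<Rightarrow> arrow set set" where
  "admissible_dissections p =
     {A \<in> dissections p. \<forall>r \<in> regions A - {Root}. (Root, r) \<in> dual_tree A}"


section \<open>The bar element of a polygon\<close>

definition polygon_word :: "'r polygon list \<Rightarrow> 'r polygon bar" where
  "polygon_word ps = basis (map (\<lambda>p. Wedge {p}) ps)"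

definition polygon_bar :: "'r polygon \<Rightarrow> 'r polygon bar" where
  "polygon_bar p =
     (\<Sum>A\<in>dissections p. pm_scale (dissection_sgn p A)
        (\<Sum>rs\<in>linear_orders A. polygon_word (map (region_polygon p A) rs)))"

text \<open>
  Shuffle product over the regions different from the root region. Letters which are
  polygons have degree \<open>0\<close>, so the factors commute and their order is immaterial; the
  lexicographic order of the arrows is used.
\<close>

definition shuffle_nonroot :: "'r polygon \<Rightarrow> arrow set \<Rightarrow> 'r polygon bar" where
  "shuffle_nonroot p A =
     shuffle_list (map (\<lambda>\<alpha>. polygon_bar (region_polygon p A (Behind \<alpha>))) (sorted_list_of_set A))"

end

theory Submission
  imports Defs
begin

text \<open>
  Everything is expressed by the coefficients \<open>bar_coeff p w\<close> of the word \<open>w\<close> in the bar element of \<open>p\<close>.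
  The last region of a linear order is cut off by an arrow \<open>\<alpha>\<close> behind which no other arrow lies;
  removing it leaves a linearly ordered dissection of the root part of \<open>p\<close> cut along \<open>\<alpha>\<close>. This gives a
  recursion for \<open>bar_coeff p (w @ [c])\<close>. The deconcatenation coproduct is \<open>(u, v) \<mapsto> bar_coeff p (u @ v)\<close>,
  and deleting a given last letter is a derivation of the shuffle product. Hence the coproduct formula follows
  by induction on \<open>v\<close> from a bijection: an admissible dissection of the root part of \<open>p\<close> cut along \<open>\<alpha>\<close>
  either becomes an admissible dissection of \<open>p\<close> containing \<open>\<alpha>\<close>, or it comes from an admissible dissection
  of \<open>p\<close> with exactly one arrow \<open>\<beta>\<close> in front of \<open>\<alpha>\<close>, and then \<open>\<alpha>\<close> is an arrow of the polygon behind \<open>\<beta>\<close>.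
  The coproduct formula also expresses the antipode of a bar element by those of bar elements of smaller weight.
\<close>

section \<open>Arrows as pairs of numbers\<close>

text \<open>The last region is removed rather than the root region because it is a leaf of the dual
  tree: what remains is a linearly ordered dissection of a single polygon, whereas removing the root
  region would leave several polygons with interleaved orders. Arrows of a part must be recognised
  as arrows of the whole. For the root part this is an increasing renumbering; nesting, an inclusion
  between sets of sides whose sizes change, is first rewritten as comparisons of end points. For the
  part behind a backward arrow the renumbering is decreasing and exchanges forward and backward
  arrows. The signs survive because the weights of the two parts of a cut polygon add up to its
  weight. All letters are single polygons, of shifted degree zero, so no Koszul signs occur. The
  shuffle can then be computed on arbitrary coefficient functions, where letters may be deleted
  freely and products over finite sets make sense without ordering the arrows. The summand 1 tensor
  B(\<pi>) is not indexed by a set of arrows; it is carried through the induction separately and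
  reproduces itself.\<close>

definition proper_arrows :: "nat \<Rightarrow> arrow set" where
  "proper_arrows n = {(k, l). k \<le> n \<and> 1 \<le> l \<and> l \<le> n + 1 \<and> k + 1 \<noteq> l \<and> k \<noteq> l \<and> \<not> (k = 0 \<and> l = n + 1)}"

text \<open>Triviality depends on the weight alone, so arrows of the parts of a cut polygon can be
  handled through a number. The last clause of \<open>proper_arrows\<close> comes from the root
  side, whose second end point wraps around to vertex 0.\<close>

lemma nontrivial_arrows_eq: "nontrivial_arrows p = proper_arrows (weight p)"
proof -
  have "k \<noteq> l - 1 \<and> k \<noteq> l mod (n + 1) \<longleftrightarrow> k + 1 \<noteq> l \<and> k \<noteq> l \<and> \<not> (k = 0 \<and> l = n + 1)"
    if "k \<le> n" "1 \<le> l" "l \<le> n + 1" for k l n :: nat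
    using that by (cases "l = n + 1") auto
  then show ?thesis
    unfolding nontrivial_arrows_def proper_arrows_def side_endpoints_def by auto
qed

section \<open>Crossing of arrows as a discrete condition\<close>

fun compatible :: "arrow \<Rightarrow> arrow \<Rightarrow> bool" where
  "compatible (k, l) (k', l') \<longleftrightarrow> k = k' \<or> l = l' \<or>
     ((k < k' \<and> k' < l \<or> l \<le> k' \<and> k' < k) \<longleftrightarrow> (k < l' \<and> l' < l \<or> l < l' \<and> l' \<le> k))"

lemma compatible_sym: "compatible \<alpha> \<beta> \<longleftrightarrow> compatible \<beta> \<alpha>"
proof -
  obtain k l k' l' where [simp]: "\<alpha> = (k, l)" "\<beta> = (k', l')" by (cases \<alpha>, cases \<beta>)
  consider "k = k'" | "l = l'" | "k < k'" "l < l'" | "k < k'" "l' < l" | "k' < k" "l < l'" | "k' < k" "l' < l"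
    by linarith
  then show ?thesis by cases (simp_all, linarith+)
qed

text \<open>For different vertices and different sides, separation does not depend on where the end
  points lie inside the sides, since a point of side \<open>l\<close> lies strictly between the
  vertices \<open>l - 1\<close> and \<open>l\<close>. On a common side the two end points may be
  placed in either order, and one of the orders avoids a crossing.\<close>

lemma non_intersecting_iff_compatible: "non_intersecting \<alpha> \<beta> \<longleftrightarrow> compatible \<alpha> \<beta>"
proof -
  obtain k l k' l' where [simp]: "\<alpha> = (k, l)" "\<beta> = (k', l')" by (cases \<alpha>, cases \<beta>)
  show ?thesis
  proof (cases "l = l' \<or> k = k'")
    case True
    have mid: "real l - 1 < real l - 1/3 \<and> real l - 1/3 < real l \<and> real l - 1 < real l - 2/3 \<and> real l - 2/3 < real l" for l
      by simp
    have "non_intersecting \<alpha> \<beta>"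
    proof (cases "k = k'")
      case True
      \<comment> \<open>Distinct end points are demanded even for a common starting vertex. The
        offsets 1/3 and 2/3 differ modulo 1, so one choice serves whether or not the sides
        coincide.\<close>
      have "real l - 1/3 \<noteq> real l' - 2/3"
      proof
        assume "real l - 1/3 = real l' - 2/3"
        then have "3 * l + 1 = 3 * l'" by linarith
        then show False by presburger
      qed
      with True mid[of l] mid[of l'] show ?thesis
        unfolding \<open>\<alpha> = _\<close> \<open>\<beta> = _\<close> non_intersecting.simps
        by (intro exI[of _ "real l - 1/3"] exI[of _ "real l' - 2/3"]) simp
    next
      case False
      with True have l: "l' = l" by simp
      have a: "k < l \<or> l \<le> k" "k' < l \<or> l \<le> k'" by auto
      have "\<not> separated (real k) (real l - 1/3) (real k') (real l - 2/3) \<or>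
            \<not> separated (real k) (real l - 2/3) (real k') (real l - 1/3)"
        using False a unfolding separated_def l by (auto simp: min_def max_def)
      then show ?thesis unfolding \<open>\<alpha> = (k, l)\<close> \<open>\<beta> = _\<close> l non_intersecting.simps
      proof
        assume "\<not> separated (real k) (real l - 1/3) (real k') (real l - 2/3)"
        with mid[of l] show "\<exists>s s'. real l - 1 < s \<and> s < real l \<and> real l - 1 < s' \<and> s' < real l \<and> s \<noteq> s' \<and>
          (k = k' \<or> \<not> separated (real k) s (real k') s')"
          by (intro exI[of _ "real l - 1/3"] exI[of _ "real l - 2/3"]) simp
      next
        assume "\<not> separated (real k) (real l - 2/3) (real k') (real l - 1/3)"
        with mid[of l] show "\<exists>s s'. real l - 1 < s \<and> s < real l \<and> real l - 1 < s' \<and> s' < real l \<and> s \<noteq> s' \<and>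
          (k = k' \<or> \<not> separated (real k) s (real k') s')"
          by (intro exI[of _ "real l - 2/3"] exI[of _ "real l - 1/3"]) simp
      qed
    qed
    moreover have "compatible \<alpha> \<beta>" using True by auto
    ultimately show ?thesis by simp
  next
    case False
    have sep: "separated (real k) s (real k') s' \<longleftrightarrow> \<not> compatible \<alpha> \<beta>"
      if "real l - 1 < s" "s < real l" "real l' - 1 < s'" "s' < real l'" for s s'
    proof -
      have "l < l' \<or> l' < l" "k < k' \<or> k' < k" using False by auto
      then have ll: "real l + 1 \<le> real l' \<or> real l' + 1 \<le> real l" "real k + 1 \<le> real k' \<or> real k' + 1 \<le> real k" by linarith+
      have 1: "min (real k) s < real k' \<and> real k' < max (real k) s \<longleftrightarrow> (k < k' \<and> k' < l \<or> l \<le> k' \<and> k' < k)"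
      proof -
        have "real k' < s \<longleftrightarrow> k' < l" using that by linarith
        moreover have "s < real k' \<longleftrightarrow> l \<le> k'" using that by linarith
        ultimately show ?thesis using ll by (auto simp: min_def max_def)
      qed
      have 2: "min (real k) s < s' \<and> s' < max (real k) s \<longleftrightarrow> (k < l' \<and> l' < l \<or> l < l' \<and> l' \<le> k)"
      proof -
        have "real k < s' \<longleftrightarrow> k < l'" using that by linarith
        moreover have "s' < real k \<longleftrightarrow> l' \<le> k" using that by linarith
        moreover have "s' < s \<longleftrightarrow> l' < l" using that False by linarith
        moreover have "s < s' \<longleftrightarrow> l < l'" using that False by linarith
        ultimately show ?thesis using False by (auto simp: min_def max_def)
      qed
      show ?thesis unfolding separated_def 1 2 using False by simp
    qed
    show ?thesis
    proof
      assume "non_intersecting \<alpha> \<beta>"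
      then show "compatible \<alpha> \<beta>" using sep False by fastforce
    next
      assume "compatible \<alpha> \<beta>"
      then have "\<not> separated (real k) (real l - 1/2) (real k') (real l' - 1/2)" by (subst sep) auto
      then show "non_intersecting \<alpha> \<beta>"
        using False unfolding \<open>\<alpha> = (k, l)\<close> \<open>\<beta> = (k', l')\<close> non_intersecting.simps
        by (intro exI[of _ "real l - 1/2"] exI[of _ "real l' - 1/2"]) auto
    qed
  qed
qed

lemma finite_cut_off [simp]: "finite (cut_off \<alpha>)"
  by (cases \<alpha>) auto

lemma lies_behind_pair: "lies_behind (k, l) (k', l') \<longleftrightarrow>
   (let a = (if k < l then k + 1 else l); b = (if k < l then l else k);
        a' = (if k' < l' then k' + 1 else l'); b' = (if k' < l' then l' else k')
    in a' \<le> a \<and> b \<le> b' \<and> (a' < a \<or> b < b'))"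
  unfolding lies_behind_def Let_def by (auto simp: psubset_eq)

text \<open>
  Cutting along an arrow removes \<open>gap\<close> sides and as many vertices from the root part. The functions
  \<open>rt_side\<close> and \<open>rt_vertex\<close> translate the numbering of the root part into that of the whole polygon.
\<close>

fun gap :: "arrow \<Rightarrow> nat" where
  "gap (k, l) = (if k < l then l - k - 1 else k - l)"

fun rt_side :: "arrow \<Rightarrow> nat \<Rightarrow> nat" where
  "rt_side (k, l) j = (if j \<le> min k l then j else j + gap (k, l))"

fun rt_vertex :: "arrow \<Rightarrow> nat \<Rightarrow> nat" where
  "rt_vertex (k, l) j = (if j \<le> k \<and> j < l then j else j + gap (k, l))"

definition rt_arrow :: "arrow \<Rightarrow> arrow \<Rightarrow> arrow" where
  "rt_arrow \<alpha> = map_prod (rt_vertex \<alpha>) (rt_side \<alpha>)"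

lemma rt_arrow_pair [simp]: "rt_arrow \<alpha> (k, l) = (rt_vertex \<alpha> k, rt_side \<alpha> l)"
  by (simp add: rt_arrow_def)

lemma in_proper_arrows: "(k, l) \<in> proper_arrows n \<longleftrightarrow>
   k \<le> n \<and> 1 \<le> l \<and> l \<le> n + 1 \<and> k + 1 \<noteq> l \<and> k \<noteq> l \<and> \<not> (k = 0 \<and> l = n + 1)"
  by (simp add: proper_arrows_def)

text \<open>The relative order of vertices and sides is all that \<open>forward\<close>,
  \<open>compatible\<close>, \<open>below\<close> and membership of a translated side in
  \<open>cut_off\<close> depend on. Hence this and the following comparison rules make
  \<open>rt_arrow\<close> preserve all of them.\<close>

lemma rt_side_less [simp]: "rt_side \<alpha> i < rt_side \<alpha> j \<longleftrightarrow> i < j"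
  by (cases \<alpha>) auto

lemma rt_vertex_less [simp]: "rt_vertex \<alpha> i < rt_vertex \<alpha> j \<longleftrightarrow> i < j"
  by (cases \<alpha>) auto

lemma rt_vertex_less_side [simp]: "rt_vertex \<alpha> i < rt_side \<alpha> j \<longleftrightarrow> i < j"
  by (cases \<alpha>) auto

lemma rt_side_le [simp]: "rt_side \<alpha> i \<le> rt_side \<alpha> j \<longleftrightarrow> i \<le> j"
  using rt_side_less[of \<alpha> j i] by linarith

lemma rt_vertex_le [simp]: "rt_vertex \<alpha> i \<le> rt_vertex \<alpha> j \<longleftrightarrow> i \<le> j"
  using rt_vertex_less[of \<alpha> j i] by linarith

lemma rt_side_le_vertex [simp]: "rt_side \<alpha> j \<le> rt_vertex \<alpha> i \<longleftrightarrow> j \<le> i"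
  using rt_vertex_less_side[of \<alpha> i j] by linarith

lemma rt_side_eq [simp]: "rt_side \<alpha> i = rt_side \<alpha> j \<longleftrightarrow> i = j"
  by (metis order_antisym rt_side_le order_refl)

lemma rt_vertex_eq [simp]: "rt_vertex \<alpha> i = rt_vertex \<alpha> j \<longleftrightarrow> i = j"
  by (metis order_antisym rt_vertex_le order_refl)

lemmas [simp del] = rt_side.simps rt_vertex.simps

lemma snd_rt_arrow [simp]: "snd (rt_arrow \<alpha> \<beta>) = rt_side \<alpha> (snd \<beta>)"
  by (cases \<beta>) simp

lemma rt_arrow_eq [simp]: "rt_arrow \<alpha> \<beta> = rt_arrow \<alpha> \<gamma> \<longleftrightarrow> \<beta> = \<gamma>"
  by (cases \<beta>; cases \<gamma>) simp

lemma gap_less: "\<alpha> \<in> proper_arrows n \<Longrightarrow> gap \<alpha> < n"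
  by (cases \<alpha>) (auto simp: in_proper_arrows)

lemma gap_pos: "\<alpha> \<in> proper_arrows n \<Longrightarrow> 0 < gap \<alpha>"
  by (cases \<alpha>) (auto simp: in_proper_arrows)

lemma forward_rt_arrow [simp]: "forward (rt_arrow \<alpha> \<beta>) = forward \<beta>"
  by (cases \<beta>) simp

lemma compatible_rt_arrow [simp]: "compatible (rt_arrow \<alpha> \<beta>) (rt_arrow \<alpha> \<gamma>) \<longleftrightarrow> compatible \<beta> \<gamma>"
  by (cases \<beta>; cases \<gamma>) simp

lemma rt_side_in_cut_off [simp]: "rt_side \<alpha> j \<in> cut_off (rt_arrow \<alpha> \<beta>) \<longleftrightarrow> j \<in> cut_off \<beta>"
  by (cases \<beta>) (simp add: Suc_le_eq)

text \<open>
  For compatible arrows \<open>lies_behind\<close> depends only on the relative position of the end points, and so is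
  preserved by \<open>rt_arrow\<close>.
\<close>

fun below :: "arrow \<Rightarrow> arrow \<Rightarrow> bool" where
  "below (k, l) (k', l') \<longleftrightarrow> (k, l) \<noteq> (k', l') \<and>
     (if k < l then (if k' < l' then k' \<le> k \<and> l \<le> l' else l' \<le> k \<and> l \<le> k')
      else (if k' < l' then k' < l \<and> k < l' else l' \<le> l \<and> k \<le> k'))"

lemma below_rt_arrow [simp]: "below (rt_arrow \<alpha> \<beta>) (rt_arrow \<alpha> \<gamma>) \<longleftrightarrow> below \<beta> \<gamma>"
  by (cases \<beta>; cases \<gamma>) simp

text \<open>Inclusion of the intervals of sides and \<open>below\<close> differ only by one at the
  boundary, for arrows of different directions: inclusion would also admit \<open>l' = k + 1\<close>
  or \<open>k = l'\<close>. These positions are excluded by properness and compatibility.\<close>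

lemma lies_behind_iff_below:
  assumes "\<alpha> \<in> proper_arrows n" "\<beta> \<in> proper_arrows n" "compatible \<alpha> \<beta>"
  shows "lies_behind \<alpha> \<beta> \<longleftrightarrow> below \<alpha> \<beta>"
proof -
  obtain k l k' l' where [simp]: "\<alpha> = (k, l)" "\<beta> = (k', l')" by (cases \<alpha>, cases \<beta>)
  consider "k < l" "k' < l'" | "k < l" "\<not> k' < l'" | "\<not> k < l" "k' < l'" | "\<not> k < l" "\<not> k' < l'"
    by linarith
  then show ?thesis
  proof cases
    case 1 then show ?thesis using assms by (simp add: lies_behind_pair in_proper_arrows; linarith)
  next
    case 2 then show ?thesis using assms by (simp add: lies_behind_pair in_proper_arrows; linarith)
  next
    case 3 then show ?thesis using assms by (simp add: lies_behind_pair in_proper_arrows; linarith)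
  next
    case 4 then show ?thesis using assms by (simp add: lies_behind_pair in_proper_arrows; linarith)
  qed
qed

section \<open>Sides behind disjoint and behind nested arrows\<close>

lemma snd_in_cut_off: "snd \<alpha> \<in> cut_off \<alpha>"
  by (cases \<alpha>) auto

lemma card_cut_off: "\<alpha> \<in> proper_arrows n \<Longrightarrow> card (cut_off \<alpha>) = gap \<alpha> + 1"
  by (cases \<alpha>) (auto simp: in_proper_arrows)

lemma cut_off_subset: "\<alpha> \<in> proper_arrows n \<Longrightarrow> cut_off \<alpha> \<subseteq> {1..n + 1}"
  by (cases \<alpha>) (auto simp: in_proper_arrows)

text \<open>Applied in both directions, this says that two parts which are not nested can share only
  a side on which both arrows end.\<close>

lemma cut_off_disjoint:
  assumes "\<alpha> \<in> proper_arrows n" "\<beta> \<in> proper_arrows n" "compatible \<alpha> \<beta>" "\<alpha> \<noteq> \<beta>"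
    "\<not> lies_behind \<alpha> \<beta>" "\<not> lies_behind \<beta> \<alpha>"
  shows "cut_off \<beta> \<inter> (cut_off \<alpha> - {snd \<alpha>}) = {}"
proof -
  obtain k l k' l' where [simp]: "\<alpha> = (k, l)" "\<beta> = (k', l')" by (cases \<alpha>, cases \<beta>)
  have b: "\<not> below \<alpha> \<beta>" "\<not> below \<beta> \<alpha>"
    using assms lies_behind_iff_below compatible_sym by blast+
  have D: "False" if "x \<in> cut_off \<beta>" "x \<in> cut_off \<alpha>" "x \<noteq> l" for x
  proof -
    consider "k < l" "k' < l'" | "k < l" "\<not> k' < l'" | "\<not> k < l" "k' < l'" | "\<not> k < l" "\<not> k' < l'"
      by linarith
    then show ?thesis
    proof cases
      case 1 then show ?thesis using assms(1-4) b that by (simp add: in_proper_arrows; linarith)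
    next
      case 2 then show ?thesis using assms(1-4) b that by (simp add: in_proper_arrows; linarith)
    next
      case 3 then show ?thesis using assms(1-4) b that by (simp add: in_proper_arrows; linarith)
    next
      case 4 then show ?thesis using assms(1-4) b that by (simp add: in_proper_arrows; linarith)
    qed
  qed
  then show ?thesis by (auto simp del: cut_off.simps)
qed

text \<open>Beyond the inclusion contained in \<open>lies_behind\<close>, the point is that the side
  where \<beta> ends is not lost behind \<alpha>. Consequently the root region does not notice an
  arrow added behind another one.\<close>

lemma cut_off_lies_behind:
  assumes "\<alpha> \<in> proper_arrows n" "\<beta> \<in> proper_arrows n" "compatible \<alpha> \<beta>" "lies_behind \<alpha> \<beta>"
  shows "cut_off \<alpha> - {snd \<alpha>} \<subseteq> cut_off \<beta> - {snd \<beta>}"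
proof -
  obtain k l k' l' where [simp]: "\<alpha> = (k, l)" "\<beta> = (k', l')" by (cases \<alpha>, cases \<beta>)
  have b: "below \<alpha> \<beta>"
    using assms lies_behind_iff_below by blast
  have D: "l' \<notin> cut_off \<alpha> - {l}"
  proof -
    consider "k < l" "k' < l'" | "k < l" "\<not> k' < l'" | "\<not> k < l" "k' < l'" | "\<not> k < l" "\<not> k' < l'"
      by linarith
    then show ?thesis
    proof cases
      case 1 then show ?thesis using assms(1-3) b by (simp add: in_proper_arrows; linarith)
    next
      case 2 then show ?thesis using assms(1-3) b by (simp add: in_proper_arrows; linarith)
    next
      case 3 then show ?thesis using assms(1-3) b by (simp add: in_proper_arrows; linarith)
    next
      case 4 then show ?thesis using assms(1-3) b by (simp add: in_proper_arrows; linarith)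
    qed
  qed
  then show ?thesis using assms(4) D unfolding lies_behind_def by (auto simp del: cut_off.simps)
qed

lemma rt_side_not_lost:
  assumes "\<alpha> \<in> proper_arrows n"
  shows "rt_side \<alpha> j \<notin> cut_off \<alpha> - {snd \<alpha>}"
  using assms by (cases \<alpha>) (auto simp: in_proper_arrows rt_side.simps)

lemma rt_side_image:
  assumes "\<alpha> \<in> proper_arrows n"
  shows "rt_side \<alpha> ` {1..n - gap \<alpha> + 1} = {1..n + 1} - (cut_off \<alpha> - {snd \<alpha>})"
proof (intro equalityI subsetI)
  fix x assume "x \<in> rt_side \<alpha> ` {1..n - gap \<alpha> + 1}"
  then obtain j where j: "x = rt_side \<alpha> j" "1 \<le> j" "j \<le> n - gap \<alpha> + 1" by auto
  have "rt_side \<alpha> j \<le> j + gap \<alpha>" "j \<le> rt_side \<alpha> j" by (cases \<alpha>; simp add: rt_side.simps)+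
  with j gap_less[OF assms] have "x \<in> {1..n+1}" by auto
  with j rt_side_not_lost[OF assms, of j] show "x \<in> {1..n + 1} - (cut_off \<alpha> - {snd \<alpha>})" by simp
next
  fix x assume x: "x \<in> {1..n + 1} - (cut_off \<alpha> - {snd \<alpha>})"
  obtain k l where [simp]: "\<alpha> = (k, l)" by (cases \<alpha>)
  show "x \<in> rt_side \<alpha> ` {1..n - gap \<alpha> + 1}"
  proof (cases "x \<le> min k l")
    case True
    then have "x = rt_side \<alpha> x" by (simp add: rt_side.simps)
    moreover have "x \<le> n - gap \<alpha> + 1" using True assms by (auto simp: in_proper_arrows)
    ultimately show ?thesis using x by (intro image_eqI[of _ _ x]) auto
  next
    case False
    then have "min k l + gap \<alpha> < x" using x assms by (auto simp: in_proper_arrows split: if_splits)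
    then have "x = rt_side \<alpha> (x - gap \<alpha>)" "1 \<le> x - gap \<alpha>" by (auto simp: rt_side.simps)
    moreover have "x - gap \<alpha> \<le> n - gap \<alpha> + 1" using x gap_less[OF assms] by auto
    ultimately show ?thesis by (intro image_eqI[of _ _ "x - gap \<alpha>"]) auto
  qed
qed

text \<open>This is what makes dissections of the root part correspond to the dissections of the
  whole polygon in which \<alpha> is a leaf.\<close>

lemma rt_arrow_image:
  assumes "\<alpha> \<in> proper_arrows n"
  shows "rt_arrow \<alpha> ` proper_arrows (n - gap \<alpha>) =
    {\<beta> \<in> proper_arrows n. \<beta> \<noteq> \<alpha> \<and> compatible \<beta> \<alpha> \<and> \<not> lies_behind \<beta> \<alpha>}"
proof (intro equalityI subsetI)
  fix \<beta>' assume "\<beta>' \<in> rt_arrow \<alpha> ` proper_arrows (n - gap \<alpha>)"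
  then obtain \<beta> where \<beta>: "\<beta> \<in> proper_arrows (n - gap \<alpha>)" "\<beta>' = rt_arrow \<alpha> \<beta>" by auto
  obtain k l k' l' where [simp]: "\<alpha> = (k, l)" "\<beta> = (k', l')" by (cases \<alpha>, cases \<beta>)
  note g = gap_less[OF assms]
  \<comment> \<open>The trivial arrow of the root part to which \<alpha> contracts: \<alpha> is its
    image under \<open>rt_arrow\<close>. Compatibility with \<alpha> therefore reduces to
    compatibility with \<alpha>0, and nothing proper fits behind \<alpha>0 because it cuts off a
    single side.\<close>
  define \<alpha>0 where "\<alpha>0 = (min k l, if k < l then k + 1 else l)"
  have \<alpha>: "\<alpha> = rt_arrow \<alpha> \<alpha>0"
    using assms by (auto simp: \<alpha>0_def in_proper_arrows rt_side.simps rt_vertex.simps)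
  have 1: "\<beta> \<noteq> \<alpha>0" using \<beta>(1) by (auto simp: \<alpha>0_def in_proper_arrows split: if_splits)
  have "compatible \<beta> \<alpha>0"
    by (cases "k < l") (simp_all add: \<alpha>0_def; linarith)+
  then have 2: "compatible \<beta>' \<alpha>" using \<alpha> \<beta> compatible_rt_arrow by metis
  have 3: "\<not> lies_behind \<beta>' \<alpha>"
  proof
    assume "lies_behind \<beta>' \<alpha>"
    then have "cut_off (rt_arrow \<alpha> \<beta>) \<subseteq> cut_off (rt_arrow \<alpha> \<alpha>0)"
      using \<alpha> \<beta>(2) unfolding lies_behind_def by auto
    then have "cut_off \<beta> \<subseteq> cut_off \<alpha>0" using rt_side_in_cut_off by blast
    then have "card (cut_off \<beta>) \<le> card (cut_off \<alpha>0)" by (intro card_mono) auto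
    moreover have "card (cut_off \<alpha>0) = 1" by (auto simp: \<alpha>0_def)
    ultimately show False using card_cut_off[OF \<beta>(1)] gap_pos[OF \<beta>(1)] by simp
  qed
  have v: "rt_vertex \<alpha> k' \<le> n" "rt_vertex \<alpha> 0 = 0 \<or> rt_vertex \<alpha> k' \<noteq> 0"
    using \<beta>(1) g by (auto simp: rt_vertex.simps in_proper_arrows)
  have "rt_side \<alpha> l' \<in> rt_side \<alpha> ` {1..n - gap \<alpha> + 1}" using \<beta>(1) by (auto simp: in_proper_arrows)
  then have s: "1 \<le> rt_side \<alpha> l'" "rt_side \<alpha> l' \<le> n + 1" unfolding rt_side_image[OF assms] by auto
  have le: "rt_side \<alpha> i \<le> rt_vertex \<alpha> i" "i \<le> rt_vertex \<alpha> i" "rt_side \<alpha> i \<le> i + gap \<alpha>" for i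
    by (auto simp: rt_side.simps rt_vertex.simps)
  have d1: "rt_vertex \<alpha> k' \<noteq> rt_side \<alpha> l'"
  proof (cases "k' < l'")
    case True
    then show ?thesis using rt_vertex_less_side[of \<alpha> k' l'] by linarith
  next
    case False
    then have "l' < k'" using \<beta>(1) by (auto simp: in_proper_arrows)
    then have "rt_side \<alpha> l' < rt_side \<alpha> k'" by (simp del: \<open>\<alpha> = (k, l)\<close>)
    then show ?thesis using le(1)[of k'] by linarith
  qed
  have d2: "rt_vertex \<alpha> k' + 1 \<noteq> rt_side \<alpha> l'"
  proof (cases "k' < l'")
    case True
    then have "k' + 1 < l'" using \<beta>(1) by (auto simp: in_proper_arrows)
    then have "rt_vertex \<alpha> k' < rt_vertex \<alpha> (k' + 1)" "rt_vertex \<alpha> (k' + 1) < rt_side \<alpha> l'"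
      by (simp_all del: \<open>\<alpha> = (k, l)\<close>)
    then show ?thesis by linarith
  next
    case False
    then show ?thesis using rt_vertex_less_side[of \<alpha> k' l'] by linarith
  qed
  have d3: "\<not> (rt_vertex \<alpha> k' = 0 \<and> rt_side \<alpha> l' = n + 1)"
    using \<beta>(1) g le(2)[of k'] le(3)[of l'] by (auto simp: in_proper_arrows simp del: gap.simps \<open>\<alpha> = (k, l)\<close>)
  with d1 d2 v s have "\<beta>' \<in> proper_arrows n" using \<beta>(2) by (simp add: in_proper_arrows)
  moreover have "\<beta>' \<noteq> \<alpha>" using \<alpha> \<beta>(2) 1 rt_arrow_eq by metis
  ultimately show "\<beta>' \<in> {\<beta> \<in> proper_arrows n. \<beta> \<noteq> \<alpha> \<and> compatible \<beta> \<alpha> \<and> \<not> lies_behind \<beta> \<alpha>}"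
    using 2 3 by simp
next
  fix \<beta> assume "\<beta> \<in> {\<beta> \<in> proper_arrows n. \<beta> \<noteq> \<alpha> \<and> compatible \<beta> \<alpha> \<and> \<not> lies_behind \<beta> \<alpha>}"
  then have \<beta>: "\<beta> \<in> proper_arrows n" "\<beta> \<noteq> \<alpha>" "compatible \<beta> \<alpha>" "\<not> below \<beta> \<alpha>"
    using lies_behind_iff_below[OF _ assms, of \<beta>] by blast+
  obtain k l k' l' where [simp]: "\<alpha> = (k, l)" "\<beta> = (k', l')" by (cases \<alpha>, cases \<beta>)
  \<comment> \<open>In words: \<beta> does not end on a side lost behind \<alpha>, and does not
    start at a vertex removed with them. The starting vertex of \<alpha> itself survives the
    cut.\<close>
  have "\<not> (if k < l then k < l' \<and> l' < l else l < l' \<and> l' \<le> k) \<and>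
    (k' \<le> k \<and> k' < l \<or> (if k < l then l \<le> k' else k \<le> k'))"
  proof -
    have "k \<noteq> l" "k' \<noteq> l'" using assms \<beta>(1) by (simp_all add: in_proper_arrows)
    then consider "k < l" "k' < l'" | "k < l" "l' < k'" | "l < k" "k' < l'" | "l < k" "l' < k'"
      by linarith
    then show ?thesis
    proof cases
      case 1 then show ?thesis using \<beta>(2-4) by (simp; linarith)
    next
      case 2 then show ?thesis using \<beta>(2-4) by (simp; linarith)
    next
      case 3 then show ?thesis using \<beta>(2-4) by (simp; linarith)
    next
      case 4 then show ?thesis using \<beta>(2-4) by (simp; linarith)
    qed
  qed
  then have "l' \<notin> cut_off \<alpha> - {l}" and k': "k' \<le> k \<and> k' < l \<or> min k l + gap \<alpha> < k' \<or> k' = k \<and> l < k"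
    using assms by (cases "k < l"; force simp: in_proper_arrows)+
  then have "l' \<in> rt_side \<alpha> ` {1..n - gap \<alpha> + 1}"
    unfolding rt_side_image[OF assms] using \<beta>(1) by (auto simp: in_proper_arrows)
  then obtain j where j: "l' = rt_side \<alpha> j" "1 \<le> j" "j \<le> n - gap \<alpha> + 1" by auto
  obtain i where i: "k' = rt_vertex \<alpha> i" "i \<le> n - gap \<alpha>"
  proof (cases "k' \<le> k \<and> k' < l")
    case True
    then have "k' = rt_vertex \<alpha> k'" "k' \<le> n - gap \<alpha>" using assms by (auto simp: rt_vertex.simps in_proper_arrows)
    then show ?thesis by (rule that)
  next
    case False
    have "k' \<le> n" "k \<noteq> l" using assms \<beta>(1) by (simp_all add: in_proper_arrows)
    have "gap \<alpha> \<le> k'" "\<not> (k' - gap \<alpha> \<le> k \<and> k' - gap \<alpha> < l)"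
      using k' False \<open>k \<noteq> l\<close> by (cases "k < l"; simp; linarith)+
    then have "k' = rt_vertex \<alpha> (k' - gap \<alpha>)" by (auto simp: rt_vertex.simps simp del: gap.simps)
    then show ?thesis using \<open>k' \<le> n\<close> by (intro that) auto
  qed
  \<comment> \<open>A preimage that is trivial in the root part would force \<beta> to be trivial or
    to be \<alpha> itself.\<close>
  have "i \<noteq> j"
  proof
    assume "i = j"
    then have "k' = l' \<or> k' = k \<and> l' = l"
      using i(1) j(1) assms by (auto simp: in_proper_arrows rt_side.simps rt_vertex.simps split: if_splits)
    then show False using \<beta>(1,2) by (auto simp: in_proper_arrows)
  qed
  moreover have "i + 1 \<noteq> j"
  proof
    assume "i + 1 = j"
    then have "k' + 1 = l' \<or> k' = k \<and> l' = l"
      using i(1) j(1) assms by (auto simp: in_proper_arrows rt_side.simps rt_vertex.simps split: if_splits)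
    then show False using \<beta>(1,2) by (auto simp: in_proper_arrows)
  qed
  moreover have "\<not> (i = 0 \<and> j = n - gap \<alpha> + 1)"
  proof
    assume ij: "i = 0 \<and> j = n - gap \<alpha> + 1"
    then have "k' = 0" using i(1) assms by (auto simp: in_proper_arrows rt_vertex.simps)
    moreover have "min k l < n - gap \<alpha> + 1" using assms by (auto simp: in_proper_arrows)
    then have "rt_side \<alpha> j = n - gap \<alpha> + 1 + gap \<alpha>"
      using ij by (auto simp: rt_side.simps simp del: gap.simps)
    then have "l' = n + 1" using j(1) gap_less[OF assms] by simp
    ultimately show False using \<beta>(1) by (auto simp: in_proper_arrows)
  qed
  ultimately have "(i, j) \<in> proper_arrows (n - gap \<alpha>)"
    using i j by (simp add: in_proper_arrows)
  then show "\<beta> \<in> rt_arrow \<alpha> ` proper_arrows (n - gap \<alpha>)"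
    using i j by (intro image_eqI[of _ _ "(i, j)"]) auto
qed

text \<open>
  The same translation for the part behind the arrow, which is traversed in the opposite direction if the arrow
  is backward.
\<close>

fun co_side :: "arrow \<Rightarrow> nat \<Rightarrow> nat" where
  "co_side (k, l) j = (if k < l then k + j else k + 1 - j)"

fun co_vertex :: "arrow \<Rightarrow> nat \<Rightarrow> nat" where
  "co_vertex (k, l) j = (if k < l then k + j else k - j)"

definition co_arrow :: "arrow \<Rightarrow> arrow \<Rightarrow> arrow" where
  "co_arrow \<alpha> = map_prod (co_vertex \<alpha>) (co_side \<alpha>)"

lemma co_arrow_pair [simp]: "co_arrow \<alpha> (k, l) = (co_vertex \<alpha> k, co_side \<alpha> l)"
  by (simp add: co_arrow_def)

lemma snd_co_arrow [simp]: "snd (co_arrow \<alpha> \<beta>) = co_side \<alpha> (snd \<beta>)"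
  by (cases \<beta>) simp

lemma inj_on_co_side: "\<alpha> \<in> proper_arrows n \<Longrightarrow> inj_on (co_side \<alpha>) {1..gap \<alpha> + 1}"
  by (cases \<alpha>) (auto simp: inj_on_def in_proper_arrows)

lemma co_side_image:
  assumes "\<alpha> \<in> proper_arrows n"
  shows "co_side \<alpha> ` {1..gap \<alpha> + 1} = cut_off \<alpha>"
proof -
  obtain k l where [simp]: "\<alpha> = (k, l)" by (cases \<alpha>)
  have "x \<in> co_side \<alpha> ` {1..gap \<alpha> + 1}" if "x \<in> cut_off \<alpha>" for x
    using that assms
    by (intro image_eqI[of _ _ "if k < l then x - k else k + 1 - x"]) (auto simp: in_proper_arrows split: if_splits)
  moreover have "co_side \<alpha> ` {1..gap \<alpha> + 1} \<subseteq> cut_off \<alpha>"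
    using assms by (auto simp: in_proper_arrows)
  ultimately show ?thesis by blast
qed

text \<open>The part behind a backward arrow is traversed in the opposite direction, which exchanges
  forward and backward. This is the reason why signs of nested arrows have to be compared
  later.\<close>

lemma forward_co_arrow:
  assumes "\<alpha> \<in> proper_arrows n" "\<beta> \<in> proper_arrows (gap \<alpha>)"
  shows "forward (co_arrow \<alpha> \<beta>) \<longleftrightarrow> (forward \<beta> \<longleftrightarrow> forward \<alpha>)"
proof -
  obtain k l k' l' where [simp]: "\<alpha> = (k, l)" "\<beta> = (k', l')" by (cases \<alpha>, cases \<beta>)
  have "k' \<le> gap \<alpha>" "1 \<le> l'" "l' \<le> gap \<alpha> + 1" "k' + 1 \<noteq> l'" "k' \<noteq> l'"
    using assms(2) by (simp_all add: in_proper_arrows del: gap.simps)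
  then show ?thesis by (cases "k < l") auto
qed

lemma co_bounds:
  assumes "(k', l') \<in> proper_arrows (gap (k, l))"
  shows "k < l \<Longrightarrow> k \<le> co_vertex (k, l) k' \<and> co_vertex (k, l) k' < l \<and> k < co_side (k, l) l' \<and> co_side (k, l) l' \<le> l"
    "\<not> k < l \<Longrightarrow> l \<le> co_vertex (k, l) k' \<and> co_vertex (k, l) k' \<le> k \<and> l \<le> co_side (k, l) l' \<and> co_side (k, l) l' \<le> k"
proof -
  have "k' \<le> gap (k, l)" "1 \<le> l'" "l' \<le> gap (k, l) + 1"
    using assms by (simp_all add: in_proper_arrows del: gap.simps)
  then show "k < l \<Longrightarrow> k \<le> co_vertex (k, l) k' \<and> co_vertex (k, l) k' < l \<and> k < co_side (k, l) l' \<and> co_side (k, l) l' \<le> l"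
    "\<not> k < l \<Longrightarrow> l \<le> co_vertex (k, l) k' \<and> co_vertex (k, l) k' \<le> k \<and> l \<le> co_side (k, l) l' \<and> co_side (k, l) l' \<le> k"
    by auto
qed

lemma cut_off_co_arrow:
  assumes "\<alpha> \<in> proper_arrows n" "\<beta> \<in> proper_arrows (gap \<alpha>)"
  shows "cut_off (co_arrow \<alpha> \<beta>) = co_side \<alpha> ` cut_off \<beta>"
proof -
  obtain k l k' l' where [simp]: "\<alpha> = (k, l)" "\<beta> = (k', l')" by (cases \<alpha>, cases \<beta>)
  show ?thesis
  proof (cases "k < l")
    case True
    have "x \<in> co_side \<alpha> ` cut_off \<beta>" if "x \<in> cut_off (co_arrow \<alpha> \<beta>)" for x
      using that True
      by (intro image_eqI[of _ _ "x - k"]) (auto split: if_splits)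
    moreover have "co_side \<alpha> ` cut_off \<beta> \<subseteq> cut_off (co_arrow \<alpha> \<beta>)"
      using True by auto
    ultimately show ?thesis by blast
  next
    case False
    have "x \<in> co_side \<alpha> ` cut_off \<beta>" if "x \<in> cut_off (co_arrow \<alpha> \<beta>)" for x
      using that False assms
      by (intro image_eqI[of _ _ "k + 1 - x"]) (auto simp: in_proper_arrows split: if_splits)
    moreover have "co_side \<alpha> ` cut_off \<beta> \<subseteq> cut_off (co_arrow \<alpha> \<beta>)"
      using False assms by (auto simp: in_proper_arrows split: if_splits)
    ultimately show ?thesis by blast
  qed
qed

lemma inj_on_co_arrow:
  assumes "\<alpha> \<in> proper_arrows n"
  shows "inj_on (co_arrow \<alpha>) (proper_arrows (gap \<alpha>))"
proof (rule inj_onI)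
  fix \<beta> \<gamma> assume bg: "\<beta> \<in> proper_arrows (gap \<alpha>)" "\<gamma> \<in> proper_arrows (gap \<alpha>)" "co_arrow \<alpha> \<beta> = co_arrow \<alpha> \<gamma>"
  obtain k l k' l' k'' l'' where [simp]: "\<alpha> = (k, l)" "\<beta> = (k', l')" "\<gamma> = (k'', l'')"
    by (cases \<alpha>, cases \<beta>, cases \<gamma>)
  have "l' \<in> {1..gap \<alpha> + 1}" "l'' \<in> {1..gap \<alpha> + 1}" "k' \<le> gap \<alpha>" "k'' \<le> gap \<alpha>"
    using bg(1,2) by (simp_all add: in_proper_arrows del: gap.simps)
  moreover from this have "k' = k''" using bg(3) by (cases "k < l") auto
  moreover have "co_side \<alpha> l' = co_side \<alpha> l''" using bg(3) by (simp del: co_side.simps co_vertex.simps \<open>\<alpha> = (k, l)\<close>)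
  ultimately show "\<beta> = \<gamma>" using inj_onD[OF inj_on_co_side[OF assms], of l' l''] by simp
qed

text \<open>Together with \<open>rt_arrow_image\<close>: every proper arrow compatible with \<alpha>
  and different from it comes from exactly one of the two parts. The preimages are found by
  inverting \<open>co_vertex\<close> and \<open>co_side\<close>, separately for the two
  directions.\<close>

lemma co_arrow_image:
  assumes "\<alpha> \<in> proper_arrows n"
  shows "co_arrow \<alpha> ` proper_arrows (gap \<alpha>) =
    {\<beta> \<in> proper_arrows n. compatible \<beta> \<alpha> \<and> lies_behind \<beta> \<alpha>}"
proof (intro equalityI subsetI)
  fix \<beta>' assume "\<beta>' \<in> co_arrow \<alpha> ` proper_arrows (gap \<alpha>)"
  then obtain \<beta> where \<beta>: "\<beta> \<in> proper_arrows (gap \<alpha>)" "\<beta>' = co_arrow \<alpha> \<beta>" by auto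
  obtain k l k' l' where [simp]: "\<alpha> = (k, l)" "\<beta> = (k', l')" by (cases \<alpha>, cases \<beta>)
  note bd = co_bounds[OF \<beta>(1)[unfolded \<open>\<alpha> = (k, l)\<close> \<open>\<beta> = (k', l')\<close>]]
  have \<beta>'_eq: "\<beta>' = (co_vertex (k, l) k', co_side (k, l) l')" using \<beta>(2) by (simp del: co_vertex.simps co_side.simps)
  have p: "k' \<le> gap (k, l)" "1 \<le> l'" "l' \<le> gap (k, l) + 1" "k' + 1 \<noteq> l'" "k' \<noteq> l'" "\<not> (k' = 0 \<and> l' = gap (k, l) + 1)"
    using \<beta>(1) by (simp_all add: in_proper_arrows del: gap.simps)
  have q: "k \<le> n" "1 \<le> l" "l \<le> n + 1" "k \<noteq> l" "\<not> (k = 0 \<and> l = n + 1)" using assms by (simp_all add: in_proper_arrows)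
  have d: "co_vertex (k, l) k' \<noteq> co_side (k, l) l'" "co_vertex (k, l) k' + 1 \<noteq> co_side (k, l) l'"
    "\<not> (co_vertex (k, l) k' = k \<and> co_side (k, l) l' = l)"
    using p q by (cases "k < l"; auto)+
  have 1: "\<beta>' \<in> proper_arrows n" "compatible \<beta>' \<alpha>"
    unfolding \<beta>'_eq in_proper_arrows \<open>\<alpha> = (k, l)\<close> compatible.simps
    using bd d q by (cases "k < l"; auto simp del: co_vertex.simps co_side.simps)+
  have "below \<beta>' \<alpha>"
    unfolding \<beta>'_eq \<open>\<alpha> = (k, l)\<close> below.simps
    using bd d q by (cases "k < l") (auto simp del: co_vertex.simps co_side.simps)
  with 1 show "\<beta>' \<in> {\<beta> \<in> proper_arrows n. compatible \<beta> \<alpha> \<and> lies_behind \<beta> \<alpha>}"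
    using lies_behind_iff_below[OF _ assms] by simp
next
  fix \<beta> assume "\<beta> \<in> {\<beta> \<in> proper_arrows n. compatible \<beta> \<alpha> \<and> lies_behind \<beta> \<alpha>}"
  then have \<beta>: "\<beta> \<in> proper_arrows n" "compatible \<beta> \<alpha>" "below \<beta> \<alpha>"
    using lies_behind_iff_below[OF _ assms, of \<beta>] by blast+
  obtain k l k' l' where [simp]: "\<alpha> = (k, l)" "\<beta> = (k', l')" by (cases \<alpha>, cases \<beta>)
  show "\<beta> \<in> co_arrow \<alpha> ` proper_arrows (gap \<alpha>)"
  proof (cases "k < l")
    case True
    show ?thesis
    proof (rule image_eqI[of _ _ "(k' - k, l' - k)"])
      show "\<beta> = co_arrow \<alpha> (k' - k, l' - k)"
        using True \<beta> assms by (cases "k' < l'"; simp add: in_proper_arrows)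
      show "(k' - k, l' - k) \<in> proper_arrows (gap \<alpha>)"
        using True \<beta> assms by (cases "k' < l'"; simp add: in_proper_arrows; linarith)
    qed
  next
    case False
    show ?thesis
    proof (rule image_eqI[of _ _ "(k - k', k + 1 - l')"])
      show "\<beta> = co_arrow \<alpha> (k - k', k + 1 - l')"
        using False \<beta> assms by (cases "k' < l'"; simp add: in_proper_arrows)
      show "(k - k', k + 1 - l') \<in> proper_arrows (gap \<alpha>)"
        using False \<beta> assms by (cases "k' < l'"; simp add: in_proper_arrows; linarith)
    qed
  qed
qed

text \<open>On the boundary cut open at the first vertex, no end point of the first arrow lies beyond one of the second.\<close>

fun before :: "arrow \<Rightarrow> arrow \<Rightarrow> bool" where
  "before (k, l) (k', l') \<longleftrightarrow> k \<le> k' \<and> k < l' \<and> l \<le> k' \<and> l \<le> l'"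

lemma before_compatible: "before \<alpha> \<beta> \<Longrightarrow> compatible \<alpha> \<beta>"
  by (cases \<alpha>; cases \<beta>) auto

lemma before_below:
  assumes "below \<alpha> \<beta>"
  shows "before \<beta> \<gamma> \<Longrightarrow> before \<alpha> \<gamma>" "before \<gamma> \<beta> \<Longrightarrow> before \<gamma> \<alpha>"
  using assms by (cases \<alpha>; cases \<beta>; cases \<gamma>; auto split: if_splits)+

text \<open>Incomparable compatible arrows occupy successive stretches of the cut boundary. Unlike
  mere incomparability, this order passes to arrows lying further behind, by
  \<open>before_below\<close>.\<close>

lemma before_antichain:
  assumes "\<alpha> \<in> proper_arrows n" "\<beta> \<in> proper_arrows n" "compatible \<alpha> \<beta>" "\<alpha> \<noteq> \<beta>"
    "\<not> below \<alpha> \<beta>" "\<not> below \<beta> \<alpha>"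
  shows "before \<alpha> \<beta> \<or> before \<beta> \<alpha>"
proof -
  obtain k l k' l' where [simp]: "\<alpha> = (k, l)" "\<beta> = (k', l')" by (cases \<alpha>, cases \<beta>)
  have "k \<noteq> l" "k' \<noteq> l'" using assms(1,2) by (simp_all add: in_proper_arrows)
  then consider "k < l" "k' < l'" | "k < l" "l' < k'" | "l < k" "k' < l'" | "l < k" "l' < k'"
    by linarith
  then show ?thesis
  proof cases
    case 1 then show ?thesis using assms(3-6)
      by (cases k k' rule: linorder_cases; cases l l' rule: linorder_cases; simp; linarith)
  next
    case 2 then show ?thesis using assms(3-6)
      by (cases k k' rule: linorder_cases; cases l l' rule: linorder_cases; simp; linarith)
  next
    case 3 then show ?thesis using assms(3-6)
      by (cases k k' rule: linorder_cases; cases l l' rule: linorder_cases; simp; linarith)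
  next
    case 4 then show ?thesis using assms(3-6)
      by (cases k k' rule: linorder_cases; cases l l' rule: linorder_cases; simp; linarith)
  qed
qed

text \<open>Since \<beta> and \<gamma> are ordered by \<open>before\<close>, so are \<alpha> and
  \<gamma>, hence they are compatible. Moreover \<alpha> cannot be behind both \<beta> and \<gamma>:
  the latter share at most one cut-off side, while a proper arrow cuts off at least two.\<close>

lemma compatible_behind_antichain:
  assumes "\<alpha> \<in> proper_arrows n" "\<beta> \<in> proper_arrows n" "\<gamma> \<in> proper_arrows n"
    "compatible \<alpha> \<beta>" "compatible \<beta> \<gamma>" "\<beta> \<noteq> \<gamma>"
    "lies_behind \<alpha> \<beta>" "\<not> lies_behind \<gamma> \<beta>" "\<not> lies_behind \<beta> \<gamma>"
  shows "\<alpha> \<noteq> \<gamma>" "compatible \<alpha> \<gamma>" "\<not> lies_behind \<gamma> \<alpha>" "\<not> lies_behind \<alpha> \<gamma>"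
proof -
  show "\<alpha> \<noteq> \<gamma>" "\<not> lies_behind \<gamma> \<alpha>" using assms(7,8) unfolding lies_behind_def by auto
  show "\<not> lies_behind \<alpha> \<gamma>"
  proof
    assume "lies_behind \<alpha> \<gamma>"
    then have "cut_off \<alpha> \<subseteq> cut_off \<beta> \<inter> cut_off \<gamma>" using assms(7) unfolding lies_behind_def by auto
    moreover have "cut_off \<gamma> \<inter> (cut_off \<beta> - {snd \<beta>}) = {}"
      using cut_off_disjoint assms by blast
    ultimately have "cut_off \<alpha> \<subseteq> {snd \<beta>}" by auto
    then have "card (cut_off \<alpha>) \<le> 1" using card_mono[of "{snd \<beta>}"] by simp
    then show False using card_cut_off[OF assms(1)] gap_pos[OF assms(1)] by simp
  qed
  have b: "below \<alpha> \<beta>" "\<not> below \<gamma> \<beta>" "\<not> below \<beta> \<gamma>"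
    using lies_behind_iff_below[of \<alpha> n \<beta>] lies_behind_iff_below[of \<gamma> n \<beta>] lies_behind_iff_below[of \<beta> n \<gamma>]
      assms compatible_sym[of \<beta> \<gamma>] by blast+
  then have "before \<alpha> \<gamma> \<or> before \<gamma> \<alpha>"
    using before_antichain[of \<beta> n \<gamma>] before_below assms by blast
  then show "compatible \<alpha> \<gamma>" using before_compatible compatible_sym by blast
qed

text \<open>If \<alpha> lies behind the translated arrow, the latter cuts off the lost sides of
  \<alpha> as well, and they must be removed. Otherwise the two sets are disjoint by
  \<open>cut_off_disjoint\<close>, and removing them changes nothing.\<close>

lemma rt_arrow_cut_off:
  assumes "\<alpha> \<in> proper_arrows n" "\<beta> \<in> proper_arrows (n - gap \<alpha>)"
  shows "cut_off (rt_arrow \<alpha> \<beta>) - (if lies_behind \<alpha> (rt_arrow \<alpha> \<beta>) then cut_off \<alpha> - {snd \<alpha>} else {})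
    = rt_side \<alpha> ` cut_off \<beta>"
proof -
  let ?b = "rt_arrow \<alpha> \<beta>"
  have "?b \<in> rt_arrow \<alpha> ` proper_arrows (n - gap \<alpha>)" using assms by blast
  then have b: "?b \<in> proper_arrows n" "?b \<noteq> \<alpha>" "compatible ?b \<alpha>" "\<not> lies_behind ?b \<alpha>"
    unfolding rt_arrow_image[OF assms(1)] by auto
  have "cut_off ?b \<inter> (cut_off \<alpha> - {snd \<alpha>}) = {}" if "\<not> lies_behind \<alpha> ?b"
    using cut_off_disjoint[OF assms(1) b(1)] b that compatible_sym by metis
  then have "cut_off ?b - (if lies_behind \<alpha> ?b then cut_off \<alpha> - {snd \<alpha>} else {}) = cut_off ?b - (cut_off \<alpha> - {snd \<alpha>})"
    by auto
  also have "\<dots> = cut_off ?b \<inter> rt_side \<alpha> ` {1..n - gap \<alpha> + 1}"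
    unfolding rt_side_image[OF assms(1)] using cut_off_subset[OF b(1)] by blast
  also have "\<dots> = rt_side \<alpha> ` cut_off \<beta>"
    using cut_off_subset[OF assms(2)] by auto
  finally show ?thesis .
qed

lemma lies_behind_rt_arrow:
  assumes "\<alpha> \<in> proper_arrows n" "\<beta> \<in> proper_arrows (n - gap \<alpha>)" "\<gamma> \<in> proper_arrows (n - gap \<alpha>)" "compatible \<beta> \<gamma>"
  shows "lies_behind (rt_arrow \<alpha> \<beta>) (rt_arrow \<alpha> \<gamma>) \<longleftrightarrow> lies_behind \<beta> \<gamma>"
proof -
  have "rt_arrow \<alpha> \<beta> \<in> proper_arrows n" "rt_arrow \<alpha> \<gamma> \<in> proper_arrows n"
    using rt_arrow_image[OF assms(1)] assms by blast+
  then show ?thesis using lies_behind_iff_below assms compatible_rt_arrow below_rt_arrow by metis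
qed

section \<open>Cutting a polygon along one arrow\<close>

lemma sorted_list_of_set_image_mono:
  fixes f :: "nat \<Rightarrow> nat"
  assumes "finite X" "\<And>x y. x \<in> X \<Longrightarrow> y \<in> X \<Longrightarrow> x < y \<Longrightarrow> f x < f y"
  shows "sorted_list_of_set (f ` X) = map f (sorted_list_of_set X)"
proof (rule strict_sorted_equal)
  have "sorted_wrt (<) (sorted_list_of_set X)" by simp
  then have "sorted_wrt (\<lambda>x y. f x < f y) (sorted_list_of_set X)"
    by (rule sorted_wrt_mono_rel[rotated]) (use assms in auto)
  then show "sorted_wrt (<) (map f (sorted_list_of_set X))" by (simp add: sorted_wrt_map)
qed (use assms in auto)

lemma sorted_list_of_set_image_antimono:
  fixes f :: "nat \<Rightarrow> nat"
  assumes "finite X" "\<And>x y. x \<in> X \<Longrightarrow> y \<in> X \<Longrightarrow> x < y \<Longrightarrow> f y < f x"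
  shows "sorted_list_of_set (f ` X) = rev (map f (sorted_list_of_set X))"
proof (rule strict_sorted_equal)
  have "sorted_wrt (<) (sorted_list_of_set X)" by simp
  then have "sorted_wrt (\<lambda>x y. f y < f x) (sorted_list_of_set X)"
    by (rule sorted_wrt_mono_rel[rotated]) (use assms in auto)
  then show "sorted_wrt (<) (rev (map f (sorted_list_of_set X)))"
    by (simp add: sorted_wrt_map sorted_wrt_rev)
qed (use assms in auto)

lemma sorted_list_of_set_Icc: "sorted_list_of_set {1..n + 1} = [1..<n + 2]"
proof -
  have "{1..n + 1} = {1..<n + 2}" by auto
  then show ?thesis by simp
qed

abbreviation rt_polygon :: "'r polygon \<Rightarrow> arrow \<Rightarrow> 'r polygon" where
  "rt_polygon p \<alpha> \<equiv> region_polygon p {\<alpha>} Root"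

abbreviation co_polygon :: "'r polygon \<Rightarrow> arrow \<Rightarrow> 'r polygon" where
  "co_polygon p \<alpha> \<equiv> region_polygon p {\<alpha>} (Behind \<alpha>)"

lemma weight_pos: "0 < weight p"
  using decorations[of p] unfolding weight_def by simp

lemma length_decorations: "length (decorations p) = weight p + 1"
  using decorations[of p] unfolding weight_def by simp

lemma Polygon_of_sides:
  assumes "0 < m" "p = Polygon (map d [1..<m + 2])"
  shows "weight p = m" "j \<in> {1..m + 1} \<Longrightarrow> decoration p j = d j"
proof -
  have "decorations p = map d [1..<m + 2]"
    unfolding assms(2) by (rule Polygon_inverse) (use assms(1) in simp)
  then show "weight p = m" "j \<in> {1..m + 1} \<Longrightarrow> decoration p j = d j"
    by (auto simp: weight_def decoration_def nth_append simp del: upt_Suc)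
qed

lemma region_polygon_empty: "region_polygon p {} Root = p"
proof -
  have "map (decoration p) [1..<weight p + 2] = decorations p"
    by (rule nth_equalityI) (auto simp: length_decorations decoration_def simp del: upt_Suc)
  moreover have "region_side_list p {} Root = [1..<weight p + 2]"
    by (simp only: region_side_list.simps region_sides.simps sorted_list_of_set_Icc UN_empty Diff_empty)
  ultimately show ?thesis
    unfolding region_polygon_def by (simp only: decorations_inverse)
qed

lemma rt_polygon:
  assumes "\<alpha> \<in> proper_arrows (weight p)"
  shows "weight (rt_polygon p \<alpha>) = weight p - gap \<alpha>"
    "j \<in> {1..weight p - gap \<alpha> + 1} \<Longrightarrow> decoration (rt_polygon p \<alpha>) j = decoration p (rt_side \<alpha> j)"
proof -
  have "rt_polygon p \<alpha> = Polygon (map (decoration p \<circ> rt_side \<alpha>) [1..<weight p - gap \<alpha> + 2])"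
  proof -
    have "region_sides p {\<alpha>} Root = rt_side \<alpha> ` {1..weight p - gap \<alpha> + 1}"
      unfolding rt_side_image[OF assms] by simp
    then have "region_side_list p {\<alpha>} Root = map (rt_side \<alpha>) [1..<weight p - gap \<alpha> + 2]"
      unfolding region_side_list.simps sorted_list_of_set_Icc[symmetric]
      by (simp only:, intro sorted_list_of_set_image_mono) simp_all
    then show ?thesis unfolding region_polygon_def by (simp only: list.map_comp)
  qed
  from Polygon_of_sides[OF _ this] show "weight (rt_polygon p \<alpha>) = weight p - gap \<alpha>"
    "j \<in> {1..weight p - gap \<alpha> + 1} \<Longrightarrow> decoration (rt_polygon p \<alpha>) j = decoration p (rt_side \<alpha> j)"
    using gap_less[OF assms] by auto
qed

lemma not_lies_behind_self [simp]: "\<not> lies_behind \<alpha> \<alpha>"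
  by (simp add: lies_behind_def)

lemma co_side_mono:
  assumes "\<alpha> \<in> proper_arrows n" "x \<in> {1..gap \<alpha> + 1}" "y \<in> {1..gap \<alpha> + 1}" "x < y"
  shows "if forward \<alpha> then co_side \<alpha> x < co_side \<alpha> y else co_side \<alpha> y < co_side \<alpha> x"
  using assms by (cases \<alpha>) (auto simp: in_proper_arrows)

text \<open>The boolean \<open>b\<close> is the orientation of a region inside the part behind
  \<alpha>. Read in the whole polygon, it is composed with the orientation given by \<alpha>, hence
  the test \<open>b = forward \<alpha>\<close>.\<close>

lemma oriented_list_co_side:
  assumes "\<alpha> \<in> proper_arrows n" "X \<subseteq> {1..gap \<alpha> + 1}"
  shows "(if b = forward \<alpha> then sorted_list_of_set (co_side \<alpha> ` X) else rev (sorted_list_of_set (co_side \<alpha> ` X)))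
    = map (co_side \<alpha>) (if b then sorted_list_of_set X else rev (sorted_list_of_set X))"
proof -
  have "finite X" using assms(2) by (rule finite_subset) simp
  show ?thesis
  proof (cases "forward \<alpha>")
    case True
    then have "sorted_list_of_set (co_side \<alpha> ` X) = map (co_side \<alpha>) (sorted_list_of_set X)"
      using co_side_mono[OF assms(1)] assms(2) \<open>finite X\<close>
      by (intro sorted_list_of_set_image_mono) (simp_all add: subset_iff)
    with True show ?thesis by (simp add: rev_map)
  next
    case False
    then have "sorted_list_of_set (co_side \<alpha> ` X) = rev (map (co_side \<alpha>) (sorted_list_of_set X))"
      using co_side_mono[OF assms(1)] assms(2) \<open>finite X\<close>
      by (intro sorted_list_of_set_image_antimono) (simp_all add: subset_iff)
    with False show ?thesis by (simp add: rev_map)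
  qed
qed

lemmas [simp del] = region_sides.simps(2)

lemma region_sides_leaf:
  assumes "\<And>\<beta>. \<beta> \<in> A \<Longrightarrow> \<not> lies_behind \<beta> \<alpha>"
  shows "region_sides p A (Behind \<alpha>) = cut_off \<alpha>"
  using assms by (auto simp: region_sides.simps(2))

lemma region_polygon_leaf:
  assumes "\<And>\<beta>. \<beta> \<in> A \<Longrightarrow> \<not> lies_behind \<beta> \<alpha>"
  shows "region_polygon p A (Behind \<alpha>) = co_polygon p \<alpha>"
  using region_sides_leaf[OF assms, where p = p] region_sides_leaf[of "{\<alpha>}" \<alpha> p]
  unfolding region_polygon_def region_side_list.simps by simp

lemma co_polygon:
  assumes "\<alpha> \<in> proper_arrows (weight p)"
  shows "weight (co_polygon p \<alpha>) = gap \<alpha>"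
    "j \<in> {1..gap \<alpha> + 1} \<Longrightarrow> decoration (co_polygon p \<alpha>) j = decoration p (co_side \<alpha> j)"
proof -
  have "co_polygon p \<alpha> = Polygon (map (decoration p \<circ> co_side \<alpha>) [1..<gap \<alpha> + 2])"
    unfolding region_polygon_def region_side_list.simps
    using oriented_list_co_side[OF assms, of "{1..gap \<alpha> + 1}" True] region_sides_leaf[of "{\<alpha>}" \<alpha> p]
    unfolding co_side_image[OF assms] sorted_list_of_set_Icc by (cases "forward \<alpha>") simp_all
  from Polygon_of_sides[OF _ this] show "weight (co_polygon p \<alpha>) = gap \<alpha>"
    "j \<in> {1..gap \<alpha> + 1} \<Longrightarrow> decoration (co_polygon p \<alpha>) j = decoration p (co_side \<alpha> j)"
    using gap_pos[OF assms] by auto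
qed

lemma compatible_refl [simp]: "compatible \<alpha> \<alpha>"
  by (cases \<alpha>) simp

lemma dissections_eq:
  "dissections p = {A. A \<subseteq> proper_arrows (weight p) \<and> (\<forall>\<alpha>\<in>A. \<forall>\<beta>\<in>A. compatible \<alpha> \<beta>)}"
proof -
  have "(\<alpha> \<noteq> \<beta> \<longrightarrow> compatible \<alpha> \<beta>) = compatible \<alpha> \<beta>" for \<alpha> \<beta> by (cases "\<alpha> = \<beta>") simp_all
  then show ?thesis
    unfolding dissections_def nontrivial_arrows_eq non_intersecting_iff_compatible by simp
qed

lemma finite_proper_arrows [simp]: "finite (proper_arrows n)"
  by (rule finite_subset[of _ "{..n} \<times> {..n + 1}"]) (auto simp: proper_arrows_def)

lemma finite_dissection: "A \<in> dissections p \<Longrightarrow> finite A"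
  unfolding dissections_eq by (auto intro: finite_subset)

lemma finite_dissections [simp]: "finite (dissections p)"
  unfolding dissections_eq by (rule finite_subset[of _ "Pow (proper_arrows (weight p))"]) auto

section \<open>Dissections with a prescribed leaf\<close>

fun rt_region :: "arrow \<Rightarrow> region \<Rightarrow> region" where
  "rt_region \<alpha> Root = Root"
| "rt_region \<alpha> (Behind \<beta>) = Behind (rt_arrow \<alpha> \<beta>)"

lemma inj_rt_region: "inj (rt_region \<alpha>)"
proof (rule injI)
  fix r s assume "rt_region \<alpha> r = rt_region \<alpha> s"
  then show "r = s" by (cases r; cases s) auto
qed

lemma dissections_insert_rt_arrow:
  assumes "\<alpha> \<in> proper_arrows (weight p)" "A \<in> dissections (rt_polygon p \<alpha>)"
  shows "insert \<alpha> (rt_arrow \<alpha> ` A) \<in> dissections p" "\<alpha> \<notin> rt_arrow \<alpha> ` A"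
    "\<And>\<beta>. \<beta> \<in> insert \<alpha> (rt_arrow \<alpha> ` A) \<Longrightarrow> \<not> lies_behind \<beta> \<alpha>"
proof -
  have A: "A \<subseteq> proper_arrows (weight p - gap \<alpha>)" "\<And>\<beta> \<gamma>. \<beta> \<in> A \<Longrightarrow> \<gamma> \<in> A \<Longrightarrow> compatible \<beta> \<gamma>"
    using assms(2) unfolding dissections_eq rt_polygon(1)[OF assms(1)] by auto
  have f: "rt_arrow \<alpha> ` A \<subseteq> {\<beta> \<in> proper_arrows (weight p). \<beta> \<noteq> \<alpha> \<and> compatible \<beta> \<alpha> \<and> \<not> lies_behind \<beta> \<alpha>}"
    using A(1) rt_arrow_image[OF assms(1)] by blast
  then show "\<alpha> \<notin> rt_arrow \<alpha> ` A" "\<And>\<beta>. \<beta> \<in> insert \<alpha> (rt_arrow \<alpha> ` A) \<Longrightarrow> \<not> lies_behind \<beta> \<alpha>"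
    by auto
  have "compatible \<beta> \<alpha>" "compatible \<alpha> \<beta>" if "\<beta> \<in> rt_arrow \<alpha> ` A" for \<beta>
    using f that compatible_sym[of \<alpha> \<beta>] by auto
  moreover have "compatible \<beta> \<gamma>" if "\<beta> \<in> rt_arrow \<alpha> ` A" "\<gamma> \<in> rt_arrow \<alpha> ` A" for \<beta> \<gamma>
    using that A(2) by auto
  ultimately have "compatible \<beta> \<gamma>" if "\<beta> \<in> insert \<alpha> (rt_arrow \<alpha> ` A)" "\<gamma> \<in> insert \<alpha> (rt_arrow \<alpha> ` A)" for \<beta> \<gamma>
    using that by (elim insertE) simp_all
  moreover have "insert \<alpha> (rt_arrow \<alpha> ` A) \<subseteq> proper_arrows (weight p)"
    using assms(1) f by blast
  ultimately show "insert \<alpha> (rt_arrow \<alpha> ` A) \<in> dissections p"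
    unfolding dissections_eq by simp
qed

text \<open>Converse of \<open>dissections_insert_rt_arrow\<close>: by \<open>rt_arrow_image\<close>
  the remaining arrows all come from the root part.\<close>

lemma dissections_leaf:
  assumes "\<alpha> \<in> A" "A \<in> dissections p" "\<And>\<beta>. \<beta> \<in> A \<Longrightarrow> \<not> lies_behind \<beta> \<alpha>"
  shows "\<exists>A' \<in> dissections (rt_polygon p \<alpha>). A = insert \<alpha> (rt_arrow \<alpha> ` A')"
proof -
  have A: "A \<subseteq> proper_arrows (weight p)" "\<And>\<beta> \<gamma>. \<beta> \<in> A \<Longrightarrow> \<gamma> \<in> A \<Longrightarrow> compatible \<beta> \<gamma>"
    using assms(2) unfolding dissections_eq by auto
  then have \<alpha>: "\<alpha> \<in> proper_arrows (weight p)" using assms(1) by blast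
  have "A - {\<alpha>} \<subseteq> rt_arrow \<alpha> ` proper_arrows (weight p - gap \<alpha>)"
    unfolding rt_arrow_image[OF \<alpha>] using A assms by blast
  then obtain A' where A': "A' \<subseteq> proper_arrows (weight p - gap \<alpha>)" "A - {\<alpha>} = rt_arrow \<alpha> ` A'"
    by (auto simp: subset_image_iff)
  have "compatible \<beta> \<gamma>" if "\<beta> \<in> A'" "\<gamma> \<in> A'" for \<beta> \<gamma>
    using A(2)[of "rt_arrow \<alpha> \<beta>" "rt_arrow \<alpha> \<gamma>"] A'(2) that by auto
  then have "A' \<in> dissections (rt_polygon p \<alpha>)"
    unfolding dissections_eq rt_polygon(1)[OF \<alpha>] using A'(1) by blast
  moreover have "A = insert \<alpha> (rt_arrow \<alpha> ` A')" using A'(2) assms(1) by blast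
  ultimately show ?thesis by blast
qed

lemma region_sides_subset: "A \<subseteq> proper_arrows (weight p) \<Longrightarrow> r \<in> regions A \<Longrightarrow> region_sides p A r \<subseteq> {1..weight p + 1}"
  using cut_off_subset by (cases r) (auto simp: regions_def region_sides.simps(2) simp del: cut_off.simps, fastforce+)

text \<open>Cutting off the part behind a leaf \<alpha> leaves every other region as it was:
  \<open>rt_side\<close> carries its sides over, and being increasing it preserves their cyclic
  reading in both orientations.\<close>

lemma region_polygon_rt:
  assumes "\<alpha> \<in> proper_arrows (weight p)" "A \<in> dissections (rt_polygon p \<alpha>)" "r \<in> regions A"
  shows "region_polygon p (insert \<alpha> (rt_arrow \<alpha> ` A)) (rt_region \<alpha> r) = region_polygon (rt_polygon p \<alpha>) A r"
proof -
  let ?D = "insert \<alpha> (rt_arrow \<alpha> ` A)" and ?q = "rt_polygon p \<alpha>" and ?m = "weight p - gap \<alpha>"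
  have A: "A \<subseteq> proper_arrows ?m" "\<And>\<beta> \<gamma>. \<beta> \<in> A \<Longrightarrow> \<gamma> \<in> A \<Longrightarrow> compatible \<beta> \<gamma>"
    using assms(2) unfolding dissections_eq rt_polygon(1)[OF assms(1)] by auto
  note leaf = dissections_insert_rt_arrow(3)[OF assms(1,2)]
  have "region_sides p ?D (rt_region \<alpha> r) = rt_side \<alpha> ` region_sides ?q A r"
  proof (cases r)
    case Root
    have "region_sides p ?D Root = rt_side \<alpha> ` {1..?m + 1} - (\<Union>\<beta>\<in>A. cut_off (rt_arrow \<alpha> \<beta>) - {snd (rt_arrow \<alpha> \<beta>)})"
      unfolding rt_side_image[OF assms(1)] by (auto simp del: cut_off.simps rt_arrow_pair)
    also have "\<dots> = rt_side \<alpha> ` ({1..?m + 1} - (\<Union>\<beta>\<in>A. cut_off \<beta> - {snd \<beta>}))"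
      by (auto simp del: cut_off.simps rt_arrow_pair)
    finally show ?thesis using Root by (simp add: rt_polygon(1)[OF assms(1)])
  next
    case (Behind \<beta>)
    then have \<beta>: "\<beta> \<in> A" using assms(3) by (auto simp: regions_def)
    have lb: "lies_behind (rt_arrow \<alpha> \<gamma>) (rt_arrow \<alpha> \<beta>) \<longleftrightarrow> lies_behind \<gamma> \<beta>" if "\<gamma> \<in> A" for \<gamma>
      using lies_behind_rt_arrow[OF assms(1)] A that \<beta> by blast
    \<comment> \<open>The arrow \<alpha> takes sides away from this region only if it lies behind
      the translated \<beta>. Its contribution is isolated so that \<open>rt_arrow_cut_off\<close>
      can absorb it.\<close>
    have "region_sides p ?D (Behind (rt_arrow \<alpha> \<beta>)) =
      (cut_off (rt_arrow \<alpha> \<beta>) - (if lies_behind \<alpha> (rt_arrow \<alpha> \<beta>) then cut_off \<alpha> - {snd \<alpha>} else {})) -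
      (\<Union>\<gamma>\<in>{\<gamma>\<in>A. lies_behind \<gamma> \<beta>}. cut_off (rt_arrow \<alpha> \<gamma>) - {snd (rt_arrow \<alpha> \<gamma>)})"
      using lb by (auto simp: region_sides.simps(2) simp del: cut_off.simps rt_arrow_pair)
    also have "\<dots> = rt_side \<alpha> ` cut_off \<beta> -
      (\<Union>\<gamma>\<in>{\<gamma>\<in>A. lies_behind \<gamma> \<beta>}. cut_off (rt_arrow \<alpha> \<gamma>) - {snd (rt_arrow \<alpha> \<gamma>)})"
      using rt_arrow_cut_off[OF assms(1)] A(1) \<beta> by (subst rt_arrow_cut_off) (use assms(1) A(1) \<beta> in auto)
    also have "\<dots> = rt_side \<alpha> ` (cut_off \<beta> - (\<Union>\<gamma>\<in>{\<gamma>\<in>A. lies_behind \<gamma> \<beta>}. cut_off \<gamma> - {snd \<gamma>}))"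
      by (auto simp del: cut_off.simps rt_arrow_pair)
    finally show ?thesis using Behind by (simp add: region_sides.simps(2))
  qed
  moreover have sub: "region_sides ?q A r \<subseteq> {1..?m + 1}"
    using region_sides_subset[of A ?q r] assms(3) A(1) rt_polygon(1)[OF assms(1)] by simp
  then have fin: "finite (region_sides ?q A r)" by (rule finite_subset) simp
  ultimately have "region_side_list p ?D (rt_region \<alpha> r) = map (rt_side \<alpha>) (region_side_list ?q A r)"
    using sorted_list_of_set_image_mono[OF fin, of "rt_side \<alpha>"]
    by (cases r) (auto simp: rev_map simp del: region_sides.simps)
  moreover have "set (region_side_list ?q A r) = region_sides ?q A r" using fin by (cases r) (auto simp del: region_sides.simps)
  ultimately have "map (decoration p) (region_side_list p ?D (rt_region \<alpha> r)) = map (decoration ?q) (region_side_list ?q A r)"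
    using rt_polygon(2)[OF assms(1)] sub by (auto simp del: atLeastAtMost_iff)
  then show ?thesis
    unfolding region_polygon_def[of p ?D "rt_region \<alpha> r"] region_polygon_def[of ?q A r] by (rule arg_cong)
qed

text \<open>The factor of \<alpha> in the sign of any dissection in which no arrow lies behind
  \<alpha>; there the region behind \<alpha> depends on \<alpha> alone.\<close>

definition arrow_sgn :: "'r polygon \<Rightarrow> arrow \<Rightarrow> rat" where
  "arrow_sgn p \<alpha> = (if forward \<alpha> then 1 else (- 1) ^ weight (co_polygon p \<alpha>))"

lemma dissection_sgn_rt:
  assumes "\<alpha> \<in> proper_arrows (weight p)" "A \<in> dissections (rt_polygon p \<alpha>)"
  shows "dissection_sgn p (insert \<alpha> (rt_arrow \<alpha> ` A)) = arrow_sgn p \<alpha> * dissection_sgn (rt_polygon p \<alpha>) A"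
proof -
  let ?D = "insert \<alpha> (rt_arrow \<alpha> ` A)"
  let ?g = "\<lambda>\<beta>. if forward \<beta> then 1 else (- 1) ^ weight (region_polygon p ?D (Behind \<beta>))"
  have sgn: "dissection_sgn p A = (\<Prod>\<beta>\<in>A. if forward \<beta> then 1 else (- 1) ^ weight (region_polygon p A (Behind \<beta>)))"
    if "finite A" for p :: "'r polygon" and A
    unfolding dissection_sgn_def using that by (simp add: prod.inter_filter if_distrib cong: if_cong)
      (intro prod.cong, auto)
  have fin: "finite A" using finite_dissection[OF assms(2)] .
  have "dissection_sgn p ?D = ?g \<alpha> * (\<Prod>\<beta>\<in>A. ?g (rt_arrow \<alpha> \<beta>))"
    using sgn[of ?D p] fin dissections_insert_rt_arrow(2)[OF assms]
    by (simp add: prod.reindex inj_on_def)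
  also have "?g \<alpha> = arrow_sgn p \<alpha>"
    unfolding arrow_sgn_def using region_polygon_leaf[of ?D \<alpha> p, OF dissections_insert_rt_arrow(3)[OF assms]] by simp
  also have "(\<Prod>\<beta>\<in>A. ?g (rt_arrow \<alpha> \<beta>)) = dissection_sgn (rt_polygon p \<alpha>) A"
    unfolding sgn[OF fin]
  proof (intro prod.cong refl)
    fix \<beta> assume "\<beta> \<in> A"
    then show "?g (rt_arrow \<alpha> \<beta>) = (if forward \<beta> then 1 else (- 1) ^ weight (region_polygon (rt_polygon p \<alpha>) A (Behind \<beta>)))"
      using region_polygon_rt[OF assms, of "Behind \<beta>"] by (simp add: regions_def)
  qed
  finally show ?thesis .
qed

section \<open>Removing the last region\<close>

declare cut_off.simps [simp del] rt_arrow_pair [simp del]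

lemma lies_behind_trans: "lies_behind \<alpha> \<beta> \<Longrightarrow> lies_behind \<beta> \<gamma> \<Longrightarrow> lies_behind \<alpha> \<gamma>"
  unfolding lies_behind_def by (rule psubset_trans)

lemma in_regions [simp]: "Root \<in> regions A" "Behind \<beta> \<in> regions A \<longleftrightarrow> \<beta> \<in> A"
  by (auto simp: regions_def)

lemma regions_insert_rt_arrow:
  "regions (insert \<alpha> (rt_arrow \<alpha> ` A)) = insert (Behind \<alpha>) (rt_region \<alpha> ` regions A)"
  by (simp add: regions_def image_image insert_commute)

lemma dual_tree_iff:
  "(Root, Behind \<beta>) \<in> dual_tree A \<longleftrightarrow> \<beta> \<in> A \<and> \<not> (\<exists>\<gamma>\<in>A. lies_behind \<beta> \<gamma>)"
  "(Behind \<alpha>, Behind \<beta>) \<in> dual_tree A \<longleftrightarrow> \<alpha> \<in> A \<and> \<beta> \<in> A \<and> lies_behind \<beta> \<alpha> \<and>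
    \<not> (\<exists>\<gamma>\<in>A. lies_behind \<beta> \<gamma> \<and> lies_behind \<gamma> \<alpha>)"
  unfolding dual_tree_def by blast+

text \<open>The dual tree is the covering relation of the nesting order, with the root region added
  in front. For finitely many arrows the transitive closure of the coverings recovers the whole
  order.\<close>

lemma precedes_eq:
  assumes "finite A"
  shows "precedes A = {(Root, Behind \<beta>) | \<beta>. \<beta> \<in> A} \<union>
    {(Behind \<alpha>, Behind \<beta>) | \<alpha> \<beta>. \<alpha> \<in> A \<and> \<beta> \<in> A \<and> lies_behind \<beta> \<alpha>}" (is "_ = ?P")
proof (intro equalityI subrelI)
  fix r s assume "(r, s) \<in> precedes A"
  then have "(r, s) \<in> (dual_tree A)\<^sup>+" by (simp add: precedes_def)
  then show "(r, s) \<in> ?P"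
  proof induction
    case (base s)
    then show ?case by (auto simp: dual_tree_def)
  next
    case (step s t)
    then show ?case by (auto simp: dual_tree_def intro: lies_behind_trans)
  qed
next
  \<comment> \<open>Induction on the difference of the numbers of cut-off sides: an arrow strictly
    between splits it into two strictly smaller differences.\<close>
  have below: "(Behind \<alpha>, Behind \<beta>) \<in> (dual_tree A)\<^sup>+" if "\<alpha> \<in> A" "\<beta> \<in> A" "lies_behind \<beta> \<alpha>" for \<alpha> \<beta>
    using that
  proof (induction "card (cut_off \<alpha>) - card (cut_off \<beta>)" arbitrary: \<alpha> \<beta> rule: less_induct)
    case less
    show ?case
    proof (cases "\<exists>\<gamma>\<in>A. lies_behind \<beta> \<gamma> \<and> lies_behind \<gamma> \<alpha>")
      case True
      then obtain \<gamma> where \<gamma>: "\<gamma> \<in> A" "lies_behind \<beta> \<gamma>" "lies_behind \<gamma> \<alpha>" by blast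
      then have "card (cut_off \<beta>) < card (cut_off \<gamma>)" "card (cut_off \<gamma>) < card (cut_off \<alpha>)"
        by (auto simp: lies_behind_def intro!: psubset_card_mono)
      then have "card (cut_off \<alpha>) - card (cut_off \<gamma>) < card (cut_off \<alpha>) - card (cut_off \<beta>)"
        "card (cut_off \<gamma>) - card (cut_off \<beta>) < card (cut_off \<alpha>) - card (cut_off \<beta>)"
        by linarith+
      then have "(Behind \<alpha>, Behind \<gamma>) \<in> (dual_tree A)\<^sup>+" "(Behind \<gamma>, Behind \<beta>) \<in> (dual_tree A)\<^sup>+"
        using less.hyps less.prems \<gamma> by blast+
      then show ?thesis by (rule trancl_trans)
    next
      case False
      then have "(Behind \<alpha>, Behind \<beta>) \<in> dual_tree A" using less.prems by (simp add: dual_tree_iff)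
      then show ?thesis by blast
    qed
  qed
  have root: "(Root, Behind \<beta>) \<in> (dual_tree A)\<^sup>+" if "\<beta> \<in> A" for \<beta>
  proof -
    have "\<exists>m\<in>cut_off ` A. cut_off \<beta> \<le> m \<and> (\<forall>b\<in>cut_off ` A. m \<le> b \<longrightarrow> m = b)"
      by (rule finite_has_maximal2) (use assms that in simp_all)
    then obtain m where m: "m \<in> cut_off ` A" "cut_off \<beta> \<subseteq> m" "\<forall>b\<in>cut_off ` A. m \<subseteq> b \<longrightarrow> m = b" by blast
    then obtain \<alpha> where \<alpha>: "\<alpha> \<in> A" "m = cut_off \<alpha>" by blast
    have top: "\<not> lies_behind \<alpha> \<gamma>" if "\<gamma> \<in> A" for \<gamma>
      using m(3) \<alpha>(2) that by (auto simp: lies_behind_def)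
    show ?thesis
    proof (cases "lies_behind \<beta> \<alpha>")
      case True
      have "(Root, Behind \<alpha>) \<in> dual_tree A" using top \<alpha>(1) by (simp add: dual_tree_iff)
      with below[OF \<alpha>(1) that True] show ?thesis by (meson trancl_into_trancl2)
    next
      case False
      \<comment> \<open>The arrows themselves may differ: \<open>A\<close> is only assumed finite,
        and a forward and a backward arrow can cut off the same sides.\<close>
      then have "cut_off \<beta> = cut_off \<alpha>" using m(2) \<alpha>(2) by (auto simp: lies_behind_def)
      then have "(Root, Behind \<beta>) \<in> dual_tree A" using top that by (simp add: dual_tree_iff lies_behind_def)
      then show ?thesis by blast
    qed
  qed
  fix r s assume "(r, s) \<in> ?P"
  then show "(r, s) \<in> precedes A" using below root unfolding precedes_def by blast
qed

lemma precedes_iff: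
  assumes "finite A"
  shows "(r, Root) \<notin> precedes A" "(Root, Behind \<beta>) \<in> precedes A \<longleftrightarrow> \<beta> \<in> A"
    "(Behind \<alpha>, Behind \<beta>) \<in> precedes A \<longleftrightarrow> \<alpha> \<in> A \<and> \<beta> \<in> A \<and> lies_behind \<beta> \<alpha>"
  unfolding precedes_eq[OF assms] by blast+

text \<open>As \<open>precedes\<close> is irreflexive, the condition on positions becomes
  \<open>sorted_wrt\<close>, which decomposes when a last region is appended.\<close>

lemma linear_orders_eq:
  assumes "finite A"
  shows "linear_orders A =
    {rs. distinct rs \<and> set rs = regions A \<and> sorted_wrt (\<lambda>r s. (s, r) \<notin> precedes A) rs}"
proof -
  have irrefl: "(r, r) \<notin> precedes A" for r
    by (cases r) (simp_all add: precedes_iff[OF assms])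
  have "(\<forall>i j. i < length rs \<longrightarrow> j < length rs \<longrightarrow> (rs ! i, rs ! j) \<in> precedes A \<longrightarrow> i < j) \<longleftrightarrow>
    sorted_wrt (\<lambda>r s. (s, r) \<notin> precedes A) rs" for rs
    unfolding sorted_wrt_iff_nth_less
  proof (intro iffI allI impI notI)
    fix i j
    assume *: "\<forall>i j. i < length rs \<longrightarrow> j < length rs \<longrightarrow> (rs ! i, rs ! j) \<in> precedes A \<longrightarrow> i < j"
      "i < j" "j < length rs" "(rs ! j, rs ! i) \<in> precedes A"
    then have "j < i" by (meson order.strict_trans)
    with * show False by simp
  next
    fix i j
    assume *: "\<forall>i j. i < j \<longrightarrow> j < length rs \<longrightarrow> (rs ! j, rs ! i) \<notin> precedes A"
      "i < length rs" "j < length rs" "(rs ! i, rs ! j) \<in> precedes A"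
    then have "i \<noteq> j" "\<not> j < i" using irrefl by auto
    then show "i < j" by simp
  qed
  then show ?thesis unfolding linear_orders_def by simp
qed

lemma finite_linear_orders: "finite A \<Longrightarrow> finite (linear_orders A)"
proof -
  assume "finite A"
  then have "finite (regions A)" by (simp add: regions_def)
  then show ?thesis
    by (rule finite_subset[rotated, OF finite_subset_distinct]) (auto simp: linear_orders_def)
qed

definition linearized_dissections :: "'r polygon \<Rightarrow> (arrow set \<times> region list) set" where
  "linearized_dissections p = (SIGMA A:dissections p. linear_orders A)"

definition add_leaf :: "arrow \<Rightarrow> arrow set \<times> region list \<Rightarrow> arrow set \<times> region list" where
  "add_leaf \<alpha> = (\<lambda>(A, rs). (insert \<alpha> (rt_arrow \<alpha> ` A), map (rt_region \<alpha>) rs @ [Behind \<alpha>]))"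

lemma precedes_rt:
  assumes "\<alpha> \<in> proper_arrows (weight p)" "A \<in> dissections (rt_polygon p \<alpha>)" "r \<in> regions A" "s \<in> regions A"
  shows "(rt_region \<alpha> r, rt_region \<alpha> s) \<in> precedes (insert \<alpha> (rt_arrow \<alpha> ` A)) \<longleftrightarrow> (r, s) \<in> precedes A"
proof -
  have A: "A \<subseteq> proper_arrows (weight p - gap \<alpha>)" "\<And>\<beta> \<gamma>. \<beta> \<in> A \<Longrightarrow> \<gamma> \<in> A \<Longrightarrow> compatible \<beta> \<gamma>"
    using assms(2) unfolding dissections_eq rt_polygon(1)[OF assms(1)] by auto
  have lb: "lies_behind (rt_arrow \<alpha> \<gamma>) (rt_arrow \<alpha> \<beta>) \<longleftrightarrow> lies_behind \<gamma> \<beta>" if "\<beta> \<in> A" "\<gamma> \<in> A" for \<beta> \<gamma>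
    using lies_behind_rt_arrow[OF assms(1)] A that by blast
  show ?thesis
    using finite_dissection[OF assms(2)] assms(3,4) lb
    by (cases r; cases s) (simp_all add: precedes_iff)
qed

text \<open>No region comes after the one behind a leaf, so appending it last adds no constraint;
  the constraints among the other regions are transported by \<open>precedes_rt\<close>.\<close>

lemma linear_orders_add_leaf:
  assumes "\<alpha> \<in> proper_arrows (weight p)" "A \<in> dissections (rt_polygon p \<alpha>)"
  shows "map (rt_region \<alpha>) rs @ [Behind \<alpha>] \<in> linear_orders (insert \<alpha> (rt_arrow \<alpha> ` A)) \<longleftrightarrow> rs \<in> linear_orders A"
proof -
  let ?D = "insert \<alpha> (rt_arrow \<alpha> ` A)"
  note leaf = dissections_insert_rt_arrow[OF assms]
  have fin: "finite A" "finite ?D" using finite_dissection assms(2) by auto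
  have reg: "regions ?D = insert (Behind \<alpha>) (rt_region \<alpha> ` regions A)"
    by (rule regions_insert_rt_arrow)
  have notin: "Behind \<alpha> \<notin> rt_region \<alpha> ` X" if X: "X \<subseteq> regions A" for X
  proof
    assume "Behind \<alpha> \<in> rt_region \<alpha> ` X"
    then obtain r where r: "r \<in> regions A" "Behind \<alpha> = rt_region \<alpha> r" using X by blast
    with leaf(2) show False by (cases r) auto
  qed
  have s: "(sorted_wrt (\<lambda>r s. (s, r) \<notin> precedes ?D) (map (rt_region \<alpha>) rs @ [Behind \<alpha>])) \<longleftrightarrow>
    sorted_wrt (\<lambda>r s. (s, r) \<notin> precedes A) rs" if rs: "set rs = regions A"
  proof -
    have "(Behind \<alpha>, s) \<notin> precedes ?D" for s
      using leaf(3) by (cases s) (auto simp: precedes_iff[OF fin(2)])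
    moreover have "sorted_wrt (\<lambda>r s. (rt_region \<alpha> s, rt_region \<alpha> r) \<notin> precedes ?D) rs \<longleftrightarrow>
      sorted_wrt (\<lambda>r s. (s, r) \<notin> precedes A) rs"
      using precedes_rt[OF assms] rs by (auto elim!: sorted_wrt_mono_rel[rotated])
    ultimately show ?thesis by (simp add: sorted_wrt_append sorted_wrt_map)
  qed
  have set: "set (map (rt_region \<alpha>) rs @ [Behind \<alpha>]) = regions ?D \<and> distinct (map (rt_region \<alpha>) rs @ [Behind \<alpha>])
    \<longleftrightarrow> set rs = regions A \<and> distinct rs"
  proof
    assume *: "set rs = regions A \<and> distinct rs"
    then show "set (map (rt_region \<alpha>) rs @ [Behind \<alpha>]) = regions ?D \<and> distinct (map (rt_region \<alpha>) rs @ [Behind \<alpha>])"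
      using reg notin[of "set rs"] inj_rt_region[of \<alpha>] by (auto simp: distinct_map inj_on_def)
  next
    assume *: "set (map (rt_region \<alpha>) rs @ [Behind \<alpha>]) = regions ?D \<and> distinct (map (rt_region \<alpha>) rs @ [Behind \<alpha>])"
    then have "Behind \<alpha> \<notin> rt_region \<alpha> ` set rs" by auto
    moreover have "insert (Behind \<alpha>) (rt_region \<alpha> ` set rs) = insert (Behind \<alpha>) (rt_region \<alpha> ` regions A)"
      using * reg by simp
    ultimately have "rt_region \<alpha> ` set rs = rt_region \<alpha> ` regions A"
      using notin[of "regions A"] by (metis insert_ident order_refl)
    then have "set rs = regions A" by (simp add: inj_image_eq_iff[OF inj_rt_region])
    with * show "set rs = regions A \<and> distinct rs" by (simp add: distinct_map)
  qed
  show ?thesis unfolding linear_orders_eq[OF fin(1)] linear_orders_eq[OF fin(2)] using s set by blast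
qed

lemma linearized_dissections_rec:
  "linearized_dissections p = insert ({}, [Root])
    (\<Union>\<alpha>\<in>nontrivial_arrows p. add_leaf \<alpha> ` linearized_dissections (rt_polygon p \<alpha>))"
proof (intro equalityI subsetI)
  fix x assume "x \<in> linearized_dissections p"
  then obtain A rs where x: "x = (A, rs)" "A \<in> dissections p" "rs \<in> linear_orders A"
    by (auto simp: linearized_dissections_def)
  have fin: "finite A" using x finite_dissection by blast
  have rs: "distinct rs" "set rs = regions A" "sorted_wrt (\<lambda>r s. (s, r) \<notin> precedes A) rs"
    using x(3) unfolding linear_orders_eq[OF fin] by auto
  have "rs \<noteq> []" using rs(2) by (auto simp: regions_def)
  then obtain rs' r where r: "rs = rs' @ [r]" by (metis append_butlast_last_id)
  show "x \<in> insert ({}, [Root]) (\<Union>\<alpha>\<in>nontrivial_arrows p. add_leaf \<alpha> ` linearized_dissections (rt_polygon p \<alpha>))"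
  proof (cases r)
    case Root
    \<comment> \<open>The root region precedes all others, so it can be last only if it is
      alone.\<close>
    have "A = {}"
    proof (rule ccontr)
      assume "A \<noteq> {}"
      then obtain \<beta> where "\<beta> \<in> A" by blast
      then have "Behind \<beta> \<in> set rs'" "(Root, Behind \<beta>) \<in> precedes A"
        using rs(2)[symmetric, THEN equalityD1, THEN subsetD, of "Behind \<beta>"] r Root
        by (simp_all add: precedes_iff[OF fin])
      then show False using rs(3) r Root by (auto simp: sorted_wrt_append)
    qed
    moreover have "rs' = []" using rs(1,2) r Root \<open>A = {}\<close> by (cases rs') (auto simp: regions_def)
    ultimately show ?thesis using x r Root by simp
  next
    case (Behind \<alpha>)
    then have \<alpha>: "\<alpha> \<in> A" using rs(2) r by (auto simp: regions_def)
    then have \<alpha>p: "\<alpha> \<in> proper_arrows (weight p)" using x(2) unfolding dissections_eq by blast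
    \<comment> \<open>A region behind \<beta> would have to come after the last one.\<close>
    have leaf: "\<not> lies_behind \<beta> \<alpha>" if "\<beta> \<in> A" for \<beta>
    proof
      assume l: "lies_behind \<beta> \<alpha>"
      then have "\<beta> \<noteq> \<alpha>" by auto
      then have "Behind \<beta> \<in> set rs'" "(Behind \<alpha>, Behind \<beta>) \<in> precedes A"
        using rs(2)[symmetric, THEN equalityD1, THEN subsetD, of "Behind \<beta>"] r Behind that l \<alpha>
        by (simp_all add: precedes_iff[OF fin])
      then show False using rs(3) r Behind by (auto simp: sorted_wrt_append)
    qed
    obtain A' where A': "A' \<in> dissections (rt_polygon p \<alpha>)" "A = insert \<alpha> (rt_arrow \<alpha> ` A')"
      using dissections_leaf[OF \<alpha> x(2) leaf] by blast
    have "insert (Behind \<alpha>) (set rs') = insert (Behind \<alpha>) (rt_region \<alpha> ` regions A')"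
      using rs(2) r Behind A'(2) regions_insert_rt_arrow[of \<alpha> A'] by simp
    moreover have "Behind \<alpha> \<notin> set rs'" using rs(1) r Behind by simp
    ultimately have "set rs' \<subseteq> rt_region \<alpha> ` regions A'" by (metis insertE insertI2 subsetI)
    then obtain rs'' where rs'': "rs' = map (rt_region \<alpha>) rs''"
      by (metis ex_map_conv subset_iff imageE)
    then have "rs'' \<in> linear_orders A'"
      using linear_orders_add_leaf[OF \<alpha>p A'(1)] x(3) r Behind A'(2) by simp
    then have "(A', rs'') \<in> linearized_dissections (rt_polygon p \<alpha>)" "x = add_leaf \<alpha> (A', rs'')"
      using A' rs'' r Behind x by (auto simp: linearized_dissections_def add_leaf_def)
    then show ?thesis using \<alpha>p nontrivial_arrows_eq by blast
  qed
next
  fix x assume "x \<in> insert ({}, [Root]) (\<Union>\<alpha>\<in>nontrivial_arrows p. add_leaf \<alpha> ` linearized_dissections (rt_polygon p \<alpha>))"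
  then consider "x = ({}, [Root])" |
    (leaf) \<alpha> A rs where "\<alpha> \<in> proper_arrows (weight p)" "A \<in> dissections (rt_polygon p \<alpha>)" "rs \<in> linear_orders A"
      "x = add_leaf \<alpha> (A, rs)"
    by (auto simp: linearized_dissections_def nontrivial_arrows_eq)
  then show "x \<in> linearized_dissections p"
  proof cases
    case 1
    then show ?thesis by (simp add: linearized_dissections_def dissections_eq linear_orders_eq regions_def)
  next
    case leaf
    then show ?thesis
      using linear_orders_add_leaf[OF leaf(1,2), of rs] dissections_insert_rt_arrow(1)[OF leaf(1,2)]
      by (auto simp: linearized_dissections_def add_leaf_def)
  qed
qed

section \<open>The recursion for the coefficients\<close>

definition letter :: "'r polygon \<Rightarrow> 'r polygon wedge" where
  "letter p = Wedge {p}"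

definition bar_coeff :: "'r polygon \<Rightarrow> 'r polygon word \<Rightarrow> rat" where
  "bar_coeff p = Poly_Mapping.lookup (polygon_bar p)"

definition dissection_word :: "'r polygon \<Rightarrow> arrow set \<times> region list \<Rightarrow> 'r polygon word" where
  "dissection_word p = (\<lambda>(A, rs). map (letter \<circ> region_polygon p A) rs)"

lemma finite_linearized_dissections [simp]: "finite (linearized_dissections p)"
  unfolding linearized_dissections_def by (intro finite_SigmaI) (auto intro: finite_linear_orders finite_dissection)

lemma bar_coeff_eq:
  "bar_coeff p w = (\<Sum>x\<in>linearized_dissections p. dissection_sgn p (fst x) * of_bool (dissection_word p x = w))"
proof -
  have "bar_coeff p w = (\<Sum>A\<in>dissections p. \<Sum>rs\<in>linear_orders A. dissection_sgn p A * of_bool (dissection_word p (A, rs) = w))"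
    unfolding bar_coeff_def polygon_bar_def polygon_word_def dissection_word_def letter_def
    by (simp add: Poly_Mapping.lookup_sum Poly_Mapping.lookup_single sum_distrib_left when_def of_bool_def comp_def)
  also have "\<dots> = (\<Sum>x\<in>linearized_dissections p. dissection_sgn p (fst x) * of_bool (dissection_word p x = w))"
    unfolding linearized_dissections_def using finite_dissection finite_linear_orders
    by (subst sum.Sigma) (auto simp: case_prod_beta)
  finally show ?thesis .
qed

lemma dissection_word_add_leaf:
  assumes "\<alpha> \<in> nontrivial_arrows p" "x \<in> linearized_dissections (rt_polygon p \<alpha>)"
  shows "dissection_word p (add_leaf \<alpha> x) = dissection_word (rt_polygon p \<alpha>) x @ [letter (co_polygon p \<alpha>)]"
    "dissection_sgn p (fst (add_leaf \<alpha> x)) = arrow_sgn p \<alpha> * dissection_sgn (rt_polygon p \<alpha>) (fst x)"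
proof -
  obtain A rs where x: "x = (A, rs)" "A \<in> dissections (rt_polygon p \<alpha>)" "rs \<in> linear_orders A"
    using assms(2) by (auto simp: linearized_dissections_def)
  have \<alpha>: "\<alpha> \<in> proper_arrows (weight p)" using assms(1) by (simp add: nontrivial_arrows_eq)
  have "set rs = regions A" using x(3) by (simp add: linear_orders_def)
  then show "dissection_word p (add_leaf \<alpha> x) = dissection_word (rt_polygon p \<alpha>) x @ [letter (co_polygon p \<alpha>)]"
    using region_polygon_rt[OF \<alpha> x(2)] region_polygon_leaf[of "insert \<alpha> (rt_arrow \<alpha> ` A)" \<alpha> p, OF dissections_insert_rt_arrow(3)[OF \<alpha> x(2)]]
    by (simp add: dissection_word_def add_leaf_def x)
  show "dissection_sgn p (fst (add_leaf \<alpha> x)) = arrow_sgn p \<alpha> * dissection_sgn (rt_polygon p \<alpha>) (fst x)"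
    using dissection_sgn_rt[OF \<alpha> x(2)] by (simp add: add_leaf_def x)
qed

text \<open>The last entry of the list of regions recovers \<alpha>, so the union in
  \<open>linearized_dissections_rec\<close> is disjoint and the sum over it splits.\<close>

lemma inj_on_add_leaf:
  "inj_on (\<lambda>(\<alpha>, x). add_leaf \<alpha> x) (SIGMA \<alpha>:nontrivial_arrows p. linearized_dissections (rt_polygon p \<alpha>))"
proof (rule inj_onI, clarsimp)
  fix k l A rs k' l' A' rs'
  assume "(k, l) \<in> nontrivial_arrows p" "(k', l') \<in> nontrivial_arrows p"
    "(A, rs) \<in> linearized_dissections (rt_polygon p (k, l))" "(A', rs') \<in> linearized_dissections (rt_polygon p (k', l'))"
    and eq: "add_leaf (k, l) (A, rs) = add_leaf (k', l') (A', rs')"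
  have a: "(k, l) = (k', l')" using eq by (simp add: add_leaf_def del: rt_arrow_pair)
  let ?\<alpha> = "(k, l)"
  have \<alpha>: "?\<alpha> \<in> proper_arrows (weight p)" using \<open>?\<alpha> \<in> _\<close> by (simp add: nontrivial_arrows_eq)
  have "A \<in> dissections (rt_polygon p ?\<alpha>)" "A' \<in> dissections (rt_polygon p ?\<alpha>)"
    using \<open>(A, rs) \<in> _\<close> \<open>(A', rs') \<in> _\<close> a by (auto simp: linearized_dissections_def)
  then have "?\<alpha> \<notin> rt_arrow ?\<alpha> ` A" "?\<alpha> \<notin> rt_arrow ?\<alpha> ` A'"
    using dissections_insert_rt_arrow(2)[OF \<alpha>] by blast+
  moreover have "insert ?\<alpha> (rt_arrow ?\<alpha> ` A) = insert ?\<alpha> (rt_arrow ?\<alpha> ` A')" "rs = rs'"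
    using eq a inj_map_eq_map[OF inj_rt_region] by (auto simp: add_leaf_def)
  ultimately have "rt_arrow ?\<alpha> ` A = rt_arrow ?\<alpha> ` A'" by (simp add: insert_ident)
  then have "A = A'" by (simp add: inj_image_eq_iff inj_on_def)
  with a \<open>rs = rs'\<close> show "k = k' \<and> l = l' \<and> A = A' \<and> rs = rs'" by simp
qed

text \<open>This is \<open>linearized_dissections_rec\<close> read off on words. The isolated
  summand belongs to the dissection without arrows, whose word is the single letter of
  \<open>p\<close>.\<close>

theorem bar_coeff_snoc:
  "bar_coeff p (w @ [c]) = of_bool (w = [] \<and> c = letter p) +
    (\<Sum>\<alpha>\<in>nontrivial_arrows p. of_bool (c = letter (co_polygon p \<alpha>)) * arrow_sgn p \<alpha> * bar_coeff (rt_polygon p \<alpha>) w)"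
proof -
  let ?f = "\<lambda>x. dissection_sgn p (fst x) * of_bool (dissection_word p x = w @ [c])"
  let ?S = "SIGMA \<alpha>:nontrivial_arrows p. linearized_dissections (rt_polygon p \<alpha>)"
  have S: "(\<Union>\<alpha>\<in>nontrivial_arrows p. add_leaf \<alpha> ` linearized_dissections (rt_polygon p \<alpha>)) = (\<lambda>(\<alpha>, x). add_leaf \<alpha> x) ` ?S"
    by force
  have fin: "finite (nontrivial_arrows p)" by (simp add: nontrivial_arrows_eq)
  have "({}, [Root]) \<notin> (\<lambda>(\<alpha>, x). add_leaf \<alpha> x) ` ?S" by (auto simp: add_leaf_def)
  then have "bar_coeff p (w @ [c]) = ?f ({}, [Root]) + sum ?f ((\<lambda>(\<alpha>, x). add_leaf \<alpha> x) ` ?S)"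
    unfolding bar_coeff_eq[of p] linearized_dissections_rec[of p] S using fin by (subst sum.insert) auto
  also have "sum ?f ((\<lambda>(\<alpha>, x). add_leaf \<alpha> x) ` ?S) =
    (\<Sum>\<alpha>\<in>nontrivial_arrows p. \<Sum>x\<in>linearized_dissections (rt_polygon p \<alpha>). ?f (add_leaf \<alpha> x))"
    using fin by (subst sum.reindex[OF inj_on_add_leaf], subst sum.Sigma) (auto simp: case_prod_beta)
  also have "\<dots> = (\<Sum>\<alpha>\<in>nontrivial_arrows p. of_bool (c = letter (co_polygon p \<alpha>)) * arrow_sgn p \<alpha> * bar_coeff (rt_polygon p \<alpha>) w)"
    unfolding bar_coeff_eq sum_distrib_left
    by (intro sum.cong refl) (auto simp: dissection_word_add_leaf)
  also have "?f ({}, [Root]) = of_bool (w = [] \<and> c = letter p)"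
    by (auto simp: dissection_word_def dissection_sgn_def region_polygon_empty)
  finally show ?thesis .
qed

lemma bar_coeff_Nil [simp]: "bar_coeff p [] = 0"
proof -
  have "dissection_word p x \<noteq> []" if "x \<in> linearized_dissections p" for x
    using that by (auto simp: linearized_dissections_def linear_orders_def dissection_word_def regions_def)
  then show ?thesis unfolding bar_coeff_eq by (simp add: sum.neutral)
qed

section \<open>Coefficients of tensors and coproducts\<close>

lemma lookup_lin_ext:
  "Poly_Mapping.lookup (lin_ext f x) w = (\<Sum>u\<in>Poly_Mapping.keys x. Poly_Mapping.lookup x u * Poly_Mapping.lookup (f u) w)"
  by (simp add: lin_ext_def Poly_Mapping.lookup_sum)

lemma sum_keys_of_bool:
  "(\<Sum>u\<in>Poly_Mapping.keys x. Poly_Mapping.lookup x u * of_bool (u = w)) = (Poly_Mapping.lookup x w :: rat)"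
proof -
  have "(\<Sum>u\<in>Poly_Mapping.keys x. Poly_Mapping.lookup x u * of_bool (u = w)) =
    (\<Sum>u\<in>Poly_Mapping.keys x. if u = w then Poly_Mapping.lookup x u else 0)"
    by (intro sum.cong) auto
  also have "\<dots> = Poly_Mapping.lookup x w"
    by (simp add: Poly_Mapping.in_keys_iff)
  finally show ?thesis .
qed

lemma sum_keys_cmult_of_bool:
  "(\<Sum>u\<in>Poly_Mapping.keys x. Poly_Mapping.lookup x u * (k * of_bool (u = w))) = (k * Poly_Mapping.lookup x w :: rat)"
proof -
  have "(\<Sum>u\<in>Poly_Mapping.keys x. Poly_Mapping.lookup x u * (k * of_bool (u = w))) =
    k * (\<Sum>u\<in>Poly_Mapping.keys x. Poly_Mapping.lookup x u * of_bool (u = w))"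
    unfolding sum_distrib_left by (intro sum.cong refl mult.left_commute)
  then show ?thesis unfolding sum_keys_of_bool .
qed

lemma lookup_basis: "Poly_Mapping.lookup (basis u) w = (of_bool (u = w) :: rat)"
  by (simp add: Poly_Mapping.lookup_single when_def)

lemma lookup_tensor: "Poly_Mapping.lookup (x \<otimes> y) (u, v) = Poly_Mapping.lookup x u * Poly_Mapping.lookup y v"
proof -
  have "Poly_Mapping.lookup (x \<otimes> y) (u, v) =
    (\<Sum>a\<in>Poly_Mapping.keys x. Poly_Mapping.lookup x a *
      ((\<Sum>b\<in>Poly_Mapping.keys y. Poly_Mapping.lookup y b * of_bool (b = v)) * of_bool (a = u)))"
    unfolding tensor_def lookup_lin_ext lookup_basis sum_distrib_left sum_distrib_right
    by (intro sum.cong refl) auto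
  then show ?thesis unfolding sum_keys_of_bool sum_keys_cmult_of_bool by (simp only: mult.commute)
qed

lemma lookup_coproduct: "Poly_Mapping.lookup (coproduct x) (u, v) = Poly_Mapping.lookup x (u @ v)"
proof -
  have "(\<Sum>j\<le>length w. of_bool ((take j w, drop j w) = (u, v))) = (of_bool (w = u @ v) :: rat)" for w :: "'a word"
  proof -
    have "(take j w, drop j w) = (u, v) \<longleftrightarrow> j = length u \<and> w = u @ v" if "j \<le> length w" for j
      using that by auto
    then have "(\<Sum>j\<le>length w. of_bool ((take j w, drop j w) = (u, v))) =
      (\<Sum>j\<le>length w. if j = length u then of_bool (w = u @ v) else (0 :: rat))"
      by (intro sum.cong) auto
    also have "\<dots> = of_bool (w = u @ v)" by auto
    finally show ?thesis .
  qed
  then show ?thesis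
    unfolding coproduct_def lookup_lin_ext Poly_Mapping.lookup_sum lookup_basis
    by (simp add: sum_keys_of_bool)
qed

lemma lookup_bar_one: "Poly_Mapping.lookup bar_one w = of_bool (w = [])"
  by (auto simp: bar_one_def lookup_basis)

section \<open>Shuffles of coefficient functions\<close>

text \<open>The transpose of the shuffle of words: \<open>F u v\<close> is summed over all ways of
  distributing the letters of the given word to two complementary subsequences \<open>u\<close> and
  \<open>v\<close>.\<close>

fun merge_sum :: "('a list \<Rightarrow> 'a list \<Rightarrow> rat) \<Rightarrow> 'a list \<Rightarrow> rat" where
  "merge_sum F [] = F [] []"
| "merge_sum F (c # w) = merge_sum (\<lambda>u v. F (c # u) v) w + merge_sum (\<lambda>u v. F u (c # v)) w"

lemma merge_sum_add: "merge_sum (\<lambda>u v. F u v + G u v) w = merge_sum F w + merge_sum G w"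
  by (induction w arbitrary: F G) simp_all

lemma merge_sum_zero [simp]: "merge_sum (\<lambda>u v. 0) w = 0"
  by (induction w) simp_all

lemma merge_sum_cmult: "merge_sum (\<lambda>u v. a * F u v) w = a * merge_sum F w"
  by (induction w arbitrary: F) (simp_all add: algebra_simps)

lemma merge_sum_sum: "merge_sum (\<lambda>u v. \<Sum>i\<in>I. F i u v) w = (\<Sum>i\<in>I. merge_sum (F i) w)"
  by (induction I rule: infinite_finite_induct) (simp_all add: merge_sum_add)

lemma merge_sum_swap: "merge_sum (\<lambda>u v. F v u) w = merge_sum F w"
proof (induction w arbitrary: F)
  case (Cons c w)
  show ?case
    using Cons.IH[of "\<lambda>u v. F (c # u) v"] Cons.IH[of "\<lambda>u v. F u (c # v)"] by simp
qed simp

lemma merge_sum_snoc: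
  "merge_sum F (w @ [c]) = merge_sum (\<lambda>u v. F (u @ [c]) v) w + merge_sum (\<lambda>u v. F u (v @ [c])) w"
  by (induction w arbitrary: F) simp_all

definition shuf :: "('a list \<Rightarrow> rat) \<Rightarrow> ('a list \<Rightarrow> rat) \<Rightarrow> 'a list \<Rightarrow> rat" where
  "shuf f g = merge_sum (\<lambda>u v. f u * g v)"

definition shuf_unit :: "'a list \<Rightarrow> rat" where
  "shuf_unit w = of_bool (w = [])"

lemma shuf_Nil [simp]: "shuf f g [] = f [] * g []"
  by (simp add: shuf_def)

lemma shuf_Cons: "shuf f g (c # w) = shuf (\<lambda>u. f (c # u)) g w + shuf f (\<lambda>v. g (c # v)) w"
  by (simp add: shuf_def)

lemma shuf_snoc: "shuf f g (w @ [c]) = shuf (\<lambda>u. f (u @ [c])) g w + shuf f (\<lambda>v. g (v @ [c])) w"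
  by (simp add: shuf_def merge_sum_snoc)

lemma shuf_commute: "shuf f g = shuf g f"
proof
  fix w show "shuf f g w = shuf g f w"
    using merge_sum_swap[of "\<lambda>u v. f u * g v" w] by (simp add: shuf_def mult.commute)
qed

lemma shuf_add_left: "shuf (\<lambda>u. f u + g u) h w = shuf f h w + shuf g h w"
  by (simp add: shuf_def merge_sum_add algebra_simps)

lemma shuf_add_right: "shuf h (\<lambda>u. f u + g u) w = shuf h f w + shuf h g w"
  by (simp add: shuf_def merge_sum_add algebra_simps)

lemma shuf_cmult_left: "shuf (\<lambda>u. a * f u) h w = a * shuf f h w"
  by (simp add: shuf_def flip: merge_sum_cmult) (simp add: algebra_simps)

lemma shuf_cmult_right: "shuf h (\<lambda>u. a * f u) w = a * shuf h f w"
  using shuf_cmult_left shuf_commute by metis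

lemma shuf_zero_left [simp]: "shuf (\<lambda>u. 0) h w = 0"
  by (simp add: shuf_def)

lemma shuf_zero_right [simp]: "shuf h (\<lambda>u. 0) w = 0"
  by (simp add: shuf_def)

lemma shuf_sum_left: "shuf (\<lambda>u. \<Sum>i\<in>I. f i u) h w = (\<Sum>i\<in>I. shuf (f i) h w)"
  by (simp add: shuf_def merge_sum_sum sum_distrib_right)

lemma shuf_sum_right: "shuf h (\<lambda>u. \<Sum>i\<in>I. f i u) w = (\<Sum>i\<in>I. shuf h (f i) w)"
  by (simp add: shuf_def merge_sum_sum sum_distrib_left)

lemma shuf_assoc: "shuf (shuf f g) h = shuf f (shuf g h)"
proof
  fix w show "shuf (shuf f g) h w = shuf f (shuf g h) w"
  proof (induction w arbitrary: f g h)
    case (Cons c w)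
    then show ?case
      by (simp add: shuf_Cons shuf_add_left shuf_add_right)
  qed simp
qed

lemma shuf_unit_left: "shuf shuf_unit f = f"
proof
  fix w show "shuf shuf_unit f w = f w"
    by (induction w arbitrary: f) (simp_all add: shuf_Cons shuf_unit_def)
qed

text \<open>This provides shuffle products over finite sets, which replace the product over the
  sorted list of arrows and can be reindexed along bijections.\<close>

global_interpretation shuf_prod: comm_monoid_set shuf shuf_unit
proof
  show "shuf (shuf f g) h = shuf f (shuf g h)" for f g h :: "'a list \<Rightarrow> rat" by (rule shuf_assoc)
  show "shuf f g = shuf g f" for f g :: "'a list \<Rightarrow> rat" by (rule shuf_commute)
  show "shuf f shuf_unit = f" for f :: "'a list \<Rightarrow> rat" using shuf_unit_left shuf_commute by metis
qed

lemma shuf_prod_Nil: "finite A \<Longrightarrow> shuf_prod.F f A [] = (\<Prod>a\<in>A. f a [])"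
  by (induction A rule: finite_induct) (simp_all add: shuf_unit_def)

text \<open>Deleting a given last letter is a derivation of the shuffle product.\<close>

lemma shuf_prod_snoc:
  "finite A \<Longrightarrow> shuf_prod.F f A (w @ [c]) = (\<Sum>a\<in>A. shuf (\<lambda>u. f a (u @ [c])) (shuf_prod.F f (A - {a})) w)"
proof (induction A arbitrary: w rule: finite_induct)
  case empty
  then show ?case by (simp add: shuf_unit_def)
next
  case (insert b A)
  have "shuf_prod.F f (insert b A) (w @ [c]) =
    shuf (\<lambda>u. f b (u @ [c])) (shuf_prod.F f A) w + shuf (f b) (\<lambda>v. shuf_prod.F f A (v @ [c])) w"
    using insert.hyps by (simp add: shuf_snoc)
  also have "shuf (f b) (\<lambda>v. shuf_prod.F f A (v @ [c])) w =
    (\<Sum>a\<in>A. shuf (f b) (shuf (\<lambda>u. f a (u @ [c])) (shuf_prod.F f (A - {a}))) w)"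
    unfolding insert.IH shuf_sum_right ..
  also have "\<dots> = (\<Sum>a\<in>A. shuf (\<lambda>u. f a (u @ [c])) (shuf_prod.F f (insert b A - {a})) w)"
  proof (intro sum.cong refl)
    fix a assume a: "a \<in> A"
    then have "insert b A - {a} = insert b (A - {a})" using insert.hyps by auto
    then have *: "shuf_prod.F f (insert b A - {a}) = shuf (f b) (shuf_prod.F f (A - {a}))"
      using insert.hyps by simp
    show "shuf (f b) (shuf (\<lambda>u. f a (u @ [c])) (shuf_prod.F f (A - {a}))) w =
      shuf (\<lambda>u. f a (u @ [c])) (shuf_prod.F f (insert b A - {a})) w"
      unfolding * by (rule fun_cong[OF shuf_prod.left_commute])
  qed
  also have "shuf_prod.F f A = shuf_prod.F f (insert b A - {b})"
    using insert.hyps by simp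
  finally show ?case using insert.hyps by simp
qed

text \<open>Compatibility of deconcatenation with the shuffle product. The lists \<open>L\<close>
  and \<open>M\<close> hold the tensors of the two coproducts, and deleting the first letter acts on
  their left entries only.\<close>

lemma shuf_append:
  assumes "\<And>u v. f (u @ v) = (\<Sum>(a, b)\<leftarrow>L. a u * b v)" "\<And>u v. g (u @ v) = (\<Sum>(a, b)\<leftarrow>M. a u * b v)"
  shows "shuf f g (u @ v) = (\<Sum>(a, b)\<leftarrow>L. \<Sum>(a', b')\<leftarrow>M. shuf a a' u * shuf b b' v)"
  using assms
proof (induction u arbitrary: f g L M)
  case Nil
  \<comment> \<open>The counit axiom: splitting off the empty word expresses both functions through
    their own right tensor factors, and bilinearity finishes the base case.\<close>
  have eq: "f = (\<lambda>v. \<Sum>(a, b)\<leftarrow>L. a [] * b v)" "g = (\<lambda>v. \<Sum>(a, b)\<leftarrow>M. a [] * b v)"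
    using Nil(1)[of "[]"] Nil(2)[of "[]"] by auto
  have r: "shuf h (\<lambda>v. \<Sum>(a, b)\<leftarrow>M. a [] * b v) w = (\<Sum>(a, b)\<leftarrow>M. a [] * shuf h b w)" for h w
    by (induction M) (auto simp: shuf_add_right shuf_cmult_right)
  have l: "shuf (\<lambda>v. \<Sum>(a, b)\<leftarrow>L. a [] * b v) h w = (\<Sum>(a, b)\<leftarrow>L. a [] * shuf b h w)" for h w
    by (induction L) (auto simp: shuf_add_left shuf_cmult_left)
  have "shuf f g v = (\<Sum>(a, b)\<leftarrow>L. a [] * shuf b g v)" "\<And>h. shuf h g v = (\<Sum>(a, b)\<leftarrow>M. a [] * shuf h b v)"
    by (subst eq(1), rule l) (subst eq(2), rule r)
  then show ?case
    by (simp add: split_def mult.assoc flip: sum_list_const_mult)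
next
  case (Cons c u)
  let ?d = "map (\<lambda>(a, b). (\<lambda>u. a (c # u), b))"
  have "shuf (\<lambda>u. f (c # u)) g (u @ v) = (\<Sum>(a, b)\<leftarrow>?d L. \<Sum>(a', b')\<leftarrow>M. shuf a a' u * shuf b b' v)"
    by (rule Cons.IH) (use Cons.prems(1)[of "c # _"] Cons.prems(2) in \<open>auto simp: case_prod_beta comp_def\<close>)
  moreover have "shuf f (\<lambda>u. g (c # u)) (u @ v) = (\<Sum>(a, b)\<leftarrow>L. \<Sum>(a', b')\<leftarrow>?d M. shuf a a' u * shuf b b' v)"
    by (rule Cons.IH) (use Cons.prems(1) Cons.prems(2)[of "c # _"] in \<open>auto simp: case_prod_beta comp_def\<close>)
  ultimately show ?case
    by (simp add: shuf_Cons split_def comp_def sum_list_addf algebra_simps)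
qed

text \<open>The antipode on letters of shifted degree zero, for which the Koszul sign is 1.\<close>

definition signed_rev :: "('a list \<Rightarrow> rat) \<Rightarrow> 'a list \<Rightarrow> rat" where
  "signed_rev f w = (- 1) ^ length w * f (rev w)"

text \<open>Reversal exchanges deleting a first letter with deleting a last one, and both are
  derivations of \<open>shuf\<close>.\<close>

lemma signed_rev_shuf: "signed_rev (shuf f g) = shuf (signed_rev f) (signed_rev g)"
proof
  fix w show "signed_rev (shuf f g) w = shuf (signed_rev f) (signed_rev g) w"
  proof (induction w arbitrary: f g)
    case (Cons c w)
    have "(\<lambda>u. signed_rev f (c # u)) = (\<lambda>u. - 1 * signed_rev (\<lambda>u. f (u @ [c])) u)" for f :: "'a list \<Rightarrow> rat"
      by (auto simp: signed_rev_def)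
    then have "shuf (signed_rev f) (signed_rev g) (c # w) =
      - 1 * shuf (signed_rev (\<lambda>u. f (u @ [c]))) (signed_rev g) w + - 1 * shuf (signed_rev f) (signed_rev (\<lambda>u. g (u @ [c]))) w"
      unfolding shuf_Cons by (simp only: shuf_cmult_left shuf_cmult_right)
    moreover have "signed_rev (shuf f g) (c # w) =
      - 1 * signed_rev (shuf (\<lambda>u. f (u @ [c])) g) w + - 1 * signed_rev (shuf f (\<lambda>u. g (u @ [c]))) w"
      by (simp add: signed_rev_def shuf_snoc distrib_left)
    ultimately show ?case by (simp only: Cons.IH)
  qed (simp add: signed_rev_def)
qed

text \<open>The antipode is the convolution inverse of the identity: after removing the first letter the two
  contributions to the convolution cancel.\<close>

lemma convolution_signed_rev:
  assumes "\<And>u v. f (u @ v) = (\<Sum>i\<in>I. g i u * h i v)"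
  shows "(\<Sum>i\<in>I. shuf (signed_rev (g i)) (h i) w) = of_bool (w = []) * f []"
proof -
  have "(\<Sum>i\<in>I. shuf (signed_rev (g i)) (h i) w) = merge_sum (\<lambda>u v. (- 1) ^ length u * f (rev u @ v)) w"
    unfolding shuf_def merge_sum_sum[symmetric] assms signed_rev_def
    by (simp add: sum_distrib_left mult.assoc)
  also have "\<dots> = of_bool (w = []) * f []"
  proof (cases w)
    case (Cons c w')
    then show ?thesis
      by (simp flip: merge_sum_add)
  qed simp
  finally show ?thesis .
qed

section \<open>Letters of degree zero\<close>

definition flat_word :: "'a word \<Rightarrow> bool" where
  "flat_word w \<longleftrightarrow> (\<forall>x\<in>set w. shifted_degree x = 0)"

definition flat :: "'a bar \<Rightarrow> bool" where
  "flat x \<longleftrightarrow> (\<forall>w\<in>Poly_Mapping.keys x. flat_word w)"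

lemma shuf_support:
  assumes "\<And>w. f w \<noteq> 0 \<Longrightarrow> \<forall>x\<in>set w. P x" "\<And>w. g w \<noteq> 0 \<Longrightarrow> \<forall>x\<in>set w. P x" "shuf f g w \<noteq> 0"
  shows "\<forall>x\<in>set w. P x"
  using assms
proof (induction w arbitrary: f g)
  case (Cons c w)
  have ne: "\<exists>v. f v \<noteq> 0" if "shuf f g w \<noteq> 0" for f g :: "'a list \<Rightarrow> rat"
  proof (rule ccontr)
    assume "\<nexists>v. f v \<noteq> 0"
    then have "f = (\<lambda>v. 0)" by auto
    with that show False by simp
  qed
  from Cons.prems(3) consider "shuf (\<lambda>u. f (c # u)) g w \<noteq> 0" | "shuf f (\<lambda>u. g (c # u)) w \<noteq> 0"
    unfolding shuf_Cons by fastforce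
  then show ?case
  proof cases
    case 1
    have "\<forall>x\<in>set w. P x" by (rule Cons.IH[OF _ _ 1]) (use Cons.prems(1)[of "c # _"] Cons.prems(2) in auto)
    moreover have "P c" using ne[OF 1] Cons.prems(1) by fastforce
    ultimately show ?thesis by simp
  next
    case 2
    have "\<forall>x\<in>set w. P x" by (rule Cons.IH[OF _ _ 2]) (use Cons.prems(1) Cons.prems(2)[of "c # _"] in auto)
    moreover have "P c" using ne[of "\<lambda>u. g (c # u)" f] 2 Cons.prems(2) shuf_commute by (metis list.set_intros(1))
    ultimately show ?thesis by simp
  qed
qed simp

lemma lookup_lin_ext_Cons:
  "Poly_Mapping.lookup (lin_ext (\<lambda>w. basis (a # w)) x) [] = (0 :: rat)"
  "Poly_Mapping.lookup (lin_ext (\<lambda>w. basis (a # w)) x) (c # w) = of_bool (a = c) * (Poly_Mapping.lookup x w :: rat)"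
  unfolding lookup_lin_ext lookup_basis
  using sum_keys_cmult_of_bool[of x "of_bool (a = c)" w] by (simp_all add: of_bool_conj)

text \<open>The recursion of \<open>shuffle_words\<close> prepends the letter that
  \<open>shuf_Cons\<close> deletes; its sign is 1 because the exponent contains the shifted degree
  of \<open>y\<close>, which is zero.\<close>

lemma lookup_shuffle_words:
  "flat_word u \<Longrightarrow> flat_word v \<Longrightarrow> Poly_Mapping.lookup (shuffle_words u v) w = shuf (\<lambda>x. of_bool (u = x)) (\<lambda>x. of_bool (v = x)) w"
proof (induction u v arbitrary: w rule: shuffle_words.induct)
  case (1 v)
  have "(\<lambda>x. of_bool ([] = x)) = (shuf_unit :: 'a word \<Rightarrow> rat)" by (auto simp: shuf_unit_def)
  then show ?case by (simp add: shuf_unit_left lookup_basis)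
next
  case (2 x u)
  have "(\<lambda>x. of_bool ([] = x)) = (shuf_unit :: 'a word \<Rightarrow> rat)" by (auto simp: shuf_unit_def)
  then show ?case by (simp add: lookup_basis)
next
  case (3 x u y v)
  have s: "flat_word u" "flat_word v" "shifted_degree y = 0" using 3 by (auto simp: flat_word_def)
  have *: "shuf (\<lambda>x. of_bool (a \<and> z = x)) g w = of_bool a * shuf (\<lambda>x. of_bool (z = x)) g w"
    "shuf g (\<lambda>x. of_bool (a \<and> z = x)) w = of_bool a * shuf g (\<lambda>x. of_bool (z = x)) w"
    for a and z :: "'a word" and g :: "'a word \<Rightarrow> rat" and w
    by (cases a; simp)+
  show ?case
  proof (cases w)
    case Nil
    then show ?thesis by (simp add: lookup_add lookup_lin_ext_Cons)
  next
    case (Cons c w')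
    then show ?thesis
      using 3 s by (simp add: lookup_add lookup_lin_ext_Cons shuf_Cons *)
  qed
qed

lemma shuf_keys:
  "shuf f g w = (\<Sum>u\<in>Poly_Mapping.keys x. \<Sum>v\<in>Poly_Mapping.keys y.
      Poly_Mapping.lookup x u * (Poly_Mapping.lookup y v * shuf (\<lambda>z. of_bool (u = z)) (\<lambda>z. of_bool (v = z)) w))"
  if "f = Poly_Mapping.lookup x" "g = Poly_Mapping.lookup y"
proof -
  have "f = (\<lambda>z. \<Sum>u\<in>Poly_Mapping.keys x. Poly_Mapping.lookup x u * of_bool (u = z))"
    "g = (\<lambda>z. \<Sum>v\<in>Poly_Mapping.keys y. Poly_Mapping.lookup y v * of_bool (v = z))"
    unfolding that sum_keys_of_bool by simp_all
  then show ?thesis by (simp only: shuf_sum_left shuf_sum_right shuf_cmult_left shuf_cmult_right sum_distrib_left)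
qed

lemma lookup_shuffle:
  assumes "flat x" "flat y"
  shows "Poly_Mapping.lookup (shuffle x y) = shuf (Poly_Mapping.lookup x) (Poly_Mapping.lookup y)"
proof
  fix w
  show "Poly_Mapping.lookup (shuffle x y) w = shuf (Poly_Mapping.lookup x) (Poly_Mapping.lookup y) w"
    unfolding shuf_keys[OF refl refl] shuffle_def lookup_lin_ext sum_distrib_left
    using assms by (intro sum.cong refl) (simp add: lookup_shuffle_words flat_def)
qed

lemma flat_iff: "flat x \<longleftrightarrow> (\<forall>w. Poly_Mapping.lookup x w \<noteq> 0 \<longrightarrow> (\<forall>a\<in>set w. shifted_degree a = 0))"
  by (auto simp: flat_def flat_word_def Poly_Mapping.in_keys_iff)

lemma flat_shuffle: "flat x \<Longrightarrow> flat y \<Longrightarrow> flat (shuffle x y)"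
  unfolding flat_iff[of "shuffle x y"] lookup_shuffle
  by (intro allI impI, rule shuf_support[of "Poly_Mapping.lookup x" _ "Poly_Mapping.lookup y"]) (auto simp: flat_iff)

lemma flat_bar_one: "flat bar_one"
  by (auto simp: flat_iff lookup_bar_one)

lemma shuffle_list_eq:
  assumes "\<And>x. x \<in> set xs \<Longrightarrow> flat (f x)" "distinct xs"
  shows "flat (shuffle_list (map f xs)) \<and>
    Poly_Mapping.lookup (shuffle_list (map f xs)) = shuf_prod.F (\<lambda>x. Poly_Mapping.lookup (f x)) (set xs)"
  using assms
proof (induction xs)
  case Nil
  then show ?case by (auto simp: shuffle_list_def flat_bar_one lookup_bar_one shuf_unit_def)
next
  case (Cons a xs)
  then show ?case by (simp add: shuffle_list_def flat_shuffle lookup_shuffle)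
qed

lemma lookup_antipode:
  assumes "flat x"
  shows "Poly_Mapping.lookup (antipode x) = signed_rev (Poly_Mapping.lookup x)"
proof
  fix w
  have "Poly_Mapping.lookup (antipode x) w =
    (\<Sum>u\<in>Poly_Mapping.keys x. Poly_Mapping.lookup x u * ((- 1) ^ length w * of_bool (u = rev w)))"
    unfolding antipode_def lookup_lin_ext
  proof (intro sum.cong refl arg_cong2[of _ _ _ _ "(*)"])
    fix u assume "u \<in> Poly_Mapping.keys x"
    then have "(\<Prod>(i, j)\<in>{(i, j). i < j \<and> j < length u}.
        (- 1 :: rat) ^ (shifted_degree (u ! i) * shifted_degree (u ! j))) = 1"
      using assms by (intro prod.neutral) (auto simp: flat_def flat_word_def)
    then show "Poly_Mapping.lookup (pm_scale ((- 1) ^ length u * (\<Prod>(i, j)\<in>{(i, j). i < j \<and> j < length u}.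
        (- 1) ^ (shifted_degree (u ! i) * shifted_degree (u ! j)))) (basis (rev u))) w =
        (- 1) ^ length w * of_bool (u = rev w)"
      by (auto simp: lookup_basis)
  qed
  also have "\<dots> = signed_rev (Poly_Mapping.lookup x) w"
    unfolding signed_rev_def sum_keys_cmult_of_bool ..
  finally show "Poly_Mapping.lookup (antipode x) w = signed_rev (Poly_Mapping.lookup x) w" .
qed

section \<open>The coproduct formula for coefficients\<close>

lemma admissible_iff:
  "A \<in> admissible_dissections p \<longleftrightarrow> A \<in> dissections p \<and> (\<forall>\<beta>\<in>A. \<forall>\<gamma>\<in>A. \<not> lies_behind \<beta> \<gamma>)"
proof -
  have "(\<forall>r\<in>regions A - {Root}. (Root, r) \<in> dual_tree A) \<longleftrightarrow> (\<forall>\<beta>\<in>A. (Root, Behind \<beta>) \<in> dual_tree A)"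
    unfolding regions_def by blast
  then show ?thesis unfolding admissible_dissections_def dual_tree_iff by blast
qed

lemma finite_admissible_dissections [simp]: "finite (admissible_dissections p)"
  unfolding admissible_dissections_def by simp

lemma dissection_arrows:
  assumes "A \<in> dissections p"
  shows "\<alpha> \<in> A \<Longrightarrow> \<alpha> \<in> proper_arrows (weight p)" "\<alpha> \<in> A \<Longrightarrow> \<beta> \<in> A \<Longrightarrow> compatible \<alpha> \<beta>" "finite A"
  using assms finite_dissection unfolding dissections_eq by auto

lemma admissible_arrows: "A \<in> admissible_dissections p \<Longrightarrow> \<alpha> \<in> A \<Longrightarrow> \<alpha> \<in> proper_arrows (weight p)"
  using dissection_arrows(1) admissible_iff by blast

lemma finite_admissible: "A \<in> admissible_dissections p \<Longrightarrow> finite A"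
  using finite_dissection admissible_iff by blast

text \<open>Cutting the polygon behind \<beta> along \<gamma> gives the polygons obtained by cutting
  \<open>p\<close> along \<beta> and the translated \<gamma>. For backward \<beta> the translation
  reverses the order of the sides, which matches the \<open>rev\<close> in
  \<open>region_side_list\<close>.\<close>

lemma region_polygon_co:
  assumes "\<beta> \<in> proper_arrows (weight p)" "\<gamma> \<in> proper_arrows (gap \<beta>)"
  shows "co_polygon p (co_arrow \<beta> \<gamma>) = co_polygon (co_polygon p \<beta>) \<gamma>" (is ?A)
    "{\<alpha> \<in> A. lies_behind \<alpha> \<beta>} = {co_arrow \<beta> \<gamma>} \<Longrightarrow>
      region_polygon p A (Behind \<beta>) = rt_polygon (co_polygon p \<beta>) \<gamma>" (is "_ \<Longrightarrow> ?B")
proof -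
  let ?q = "co_polygon p \<beta>" and ?\<alpha> = "co_arrow \<beta> \<gamma>"
  have dec: "map (decoration p) (map (co_side \<beta>) L) = map (decoration ?q) L" if "set L \<subseteq> {1..gap \<beta> + 1}" for L
    using that co_polygon(2)[OF assms(1)] by auto
  have \<gamma>: "cut_off \<gamma> \<subseteq> {1..gap \<beta> + 1}" using cut_off_subset[OF assms(2)] .
  have "region_side_list p {?\<alpha>} (Behind ?\<alpha>) = map (co_side \<beta>) (region_side_list ?q {\<gamma>} (Behind \<gamma>))"
    using oriented_list_co_side[OF assms(1) \<gamma>, of "forward \<gamma>"] forward_co_arrow[OF assms] cut_off_co_arrow[OF assms]
      region_sides_leaf[of "{?\<alpha>}" ?\<alpha> p] region_sides_leaf[of "{\<gamma>}" \<gamma> ?q]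
    by (cases "forward \<beta>"; cases "forward \<gamma>"; simp)
  moreover have "set (region_side_list ?q {\<gamma>} (Behind \<gamma>)) \<subseteq> {1..gap \<beta> + 1}"
    using \<gamma> region_sides_leaf[of "{\<gamma>}" \<gamma> ?q] by simp
  ultimately have "map (decoration p) (region_side_list p {?\<alpha>} (Behind ?\<alpha>)) = map (decoration ?q) (region_side_list ?q {\<gamma>} (Behind \<gamma>))"
    using dec by simp
  then show ?A
    unfolding region_polygon_def[of p "{?\<alpha>}"] region_polygon_def[of ?q "{\<gamma>}"] by (rule arg_cong)
  assume A: "{\<alpha> \<in> A. lies_behind \<alpha> \<beta>} = {?\<alpha>}"
  let ?X = "{1..gap \<beta> + 1} - (cut_off \<gamma> - {snd \<gamma>})"
  have "region_sides p A (Behind \<beta>) = cut_off \<beta> - (cut_off ?\<alpha> - {snd ?\<alpha>})"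
    unfolding region_sides.simps A by simp
  also have "\<dots> = co_side \<beta> ` {1..gap \<beta> + 1} - (co_side \<beta> ` cut_off \<gamma> - co_side \<beta> ` {snd \<gamma>})"
    using cut_off_co_arrow[OF assms] co_side_image[OF assms(1)] by simp
  also have "\<dots> = co_side \<beta> ` ?X"
  proof -
    have "co_side \<beta> ` (cut_off \<gamma> - {snd \<gamma>}) = co_side \<beta> ` cut_off \<gamma> - co_side \<beta> ` {snd \<gamma>}"
      by (rule inj_on_image_set_diff[OF inj_on_co_side[OF assms(1)]]) (use \<gamma> snd_in_cut_off in blast)+
    moreover have "co_side \<beta> ` ?X = co_side \<beta> ` {1..gap \<beta> + 1} - co_side \<beta> ` (cut_off \<gamma> - {snd \<gamma>})"
      by (rule inj_on_image_set_diff[OF inj_on_co_side[OF assms(1)]]) (use \<gamma> in blast)+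
    ultimately show ?thesis by simp
  qed
  finally have "region_sides p A (Behind \<beta>) = co_side \<beta> ` ?X" .
  then have "region_side_list p A (Behind \<beta>) = map (co_side \<beta>) (region_side_list ?q {\<gamma>} Root)"
    using oriented_list_co_side[OF assms(1), of ?X True] co_polygon(1)[OF assms(1)]
    by (cases "forward \<beta>") simp_all
  moreover have "set (region_side_list ?q {\<gamma>} Root) \<subseteq> {1..gap \<beta> + 1}"
    using co_polygon(1)[OF assms(1)] by simp
  ultimately have "map (decoration p) (region_side_list p A (Behind \<beta>)) = map (decoration ?q) (region_side_list ?q {\<gamma>} Root)"
    using dec by (simp only:)
  then show ?B
    unfolding region_polygon_def[of p A] region_polygon_def[of ?q "{\<gamma>}"] by (rule arg_cong)
qed

section \<open>Nested arrows added to an admissible dissection\<close>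

definition region_sgn :: "'r polygon \<Rightarrow> arrow set \<Rightarrow> arrow \<Rightarrow> rat" where
  "region_sgn p A \<alpha> = (if forward \<alpha> then 1 else (- 1) ^ weight (region_polygon p A (Behind \<alpha>)))"

lemma dissection_sgn_eq: "finite A \<Longrightarrow> dissection_sgn p A = (\<Prod>\<alpha>\<in>A. region_sgn p A \<alpha>)"
  unfolding dissection_sgn_def region_sgn_def
  by (simp add: prod.inter_filter if_distrib cong: if_cong) (intro prod.cong, auto)

lemma region_polygon_admissible:
  assumes "A \<in> admissible_dissections p" "\<beta> \<in> A"
  shows "region_polygon p A (Behind \<beta>) = co_polygon p \<beta>"
  using assms by (intro region_polygon_leaf) (simp add: admissible_iff)

definition behind_coeff :: "'r polygon \<Rightarrow> arrow set \<Rightarrow> arrow \<Rightarrow> 'r polygon word \<Rightarrow> rat" where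
  "behind_coeff p A \<alpha> = bar_coeff (region_polygon p A (Behind \<alpha>))"

text \<open>Only the region behind \<beta> is affected when it is cut once more: it is replaced by
  its root part, and the cut-off part becomes the new region.\<close>

lemma add_nested_arrow:
  fixes p :: "'r polygon"
  assumes "A \<in> admissible_dissections p" "\<beta> \<in> A" "\<gamma> \<in> nontrivial_arrows (co_polygon p \<beta>)"
  defines "\<alpha> \<equiv> co_arrow \<beta> \<gamma>"
  shows "\<alpha> \<notin> A" "lies_behind \<alpha> \<beta>" "\<And>x. x \<in> A \<Longrightarrow> \<not> lies_behind x \<alpha>" "\<And>x. x \<in> A \<Longrightarrow> lies_behind \<alpha> x \<Longrightarrow> x = \<beta>"
    "insert \<alpha> A \<in> dissections p"
    "region_polygon p (insert \<alpha> A) Root = region_polygon p A Root"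
    "dissection_sgn p (insert \<alpha> A) = dissection_sgn p A * arrow_sgn (co_polygon p \<beta>) \<gamma>"
    "shuf_prod.F (behind_coeff p (insert \<alpha> A)) A =
      shuf (bar_coeff (rt_polygon (co_polygon p \<beta>) \<gamma>)) (shuf_prod.F (behind_coeff p A) (A - {\<beta>}))"
proof -
  let ?n = "weight p" and ?D = "insert \<alpha> A"
  have A: "A \<in> dissections p" "\<And>x y. x \<in> A \<Longrightarrow> y \<in> A \<Longrightarrow> \<not> lies_behind x y"
    using assms(1) by (auto simp: admissible_iff)
  note A' = dissection_arrows[OF A(1)]
  have \<beta>: "\<beta> \<in> proper_arrows ?n" using A'(1) assms(2) .
  have \<gamma>: "\<gamma> \<in> proper_arrows (gap \<beta>)"
    using assms(3) by (simp add: nontrivial_arrows_eq co_polygon(1)[OF \<beta>])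
  have "\<alpha> \<in> co_arrow \<beta> ` proper_arrows (gap \<beta>)" using \<gamma> by (simp add: \<alpha>_def)
  then have \<alpha>: "\<alpha> \<in> proper_arrows ?n" "compatible \<alpha> \<beta>" and ab: "lies_behind \<alpha> \<beta>"
    unfolding co_arrow_image[OF \<beta>] by auto
  show "lies_behind \<alpha> \<beta>" by (rule ab)
  \<comment> \<open>Admissibility makes \<beta> and \<open>x\<close> incomparable, so
    \<open>compatible_behind_antichain\<close> passes from \<beta> to the arrow \<alpha> behind
    it.\<close>
  have other: "\<alpha> \<noteq> x" "compatible \<alpha> x" "\<not> lies_behind x \<alpha>" "\<not> lies_behind \<alpha> x" if "x \<in> A" "x \<noteq> \<beta>" for x
    using compatible_behind_antichain[OF \<alpha>(1) \<beta> A'(1)[OF that(1)] \<alpha>(2) A'(2)[OF assms(2) that(1)] _ ab]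
      A(2) that assms(2) by metis+
  have ne: "\<alpha> \<noteq> \<beta>" "\<not> lies_behind \<beta> \<alpha>" using ab by (auto simp: lies_behind_def)
  show notin: "\<alpha> \<notin> A" using ne(1) other(1) by blast
  show leaf: "\<not> lies_behind x \<alpha>" if "x \<in> A" for x using ne(2) other(3) that by blast
  show uniq: "x = \<beta>" if "x \<in> A" "lies_behind \<alpha> x" for x using that other(4) by blast
  have "compatible \<alpha> x" if "x \<in> A" for x using \<alpha>(2) other(2) that by blast
  then have "compatible x y" if "x \<in> ?D" "y \<in> ?D" for x y
    using that A'(2) compatible_sym[of x y] by (elim insertE) auto
  then show D: "?D \<in> dissections p"
    unfolding dissections_eq using \<alpha>(1) A'(1) by blast
  have "cut_off \<alpha> - {snd \<alpha>} \<subseteq> cut_off \<beta> - {snd \<beta>}"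
    by (rule cut_off_lies_behind[OF \<alpha>(1) \<beta> \<alpha>(2) ab])
  then have "(\<Union>x\<in>?D. cut_off x - {snd x}) = (\<Union>x\<in>A. cut_off x - {snd x})"
    using assms(2) by blast
  then show "region_polygon p ?D Root = region_polygon p A Root"
    unfolding region_polygon_def region_side_list.simps region_sides.simps by simp
  have reg_other: "region_polygon p ?D (Behind x) = region_polygon p A (Behind x)" if "x \<in> A" "x \<noteq> \<beta>" for x
    unfolding region_polygon_admissible[OF assms(1) that(1)]
  proof (rule region_polygon_leaf)
    fix y assume "y \<in> ?D"
    then show "\<not> lies_behind y x"
      using A(2)[OF _ that(1), of y] other(4)[OF that] by (elim insertE) simp_all
  qed
  have reg_\<alpha>: "region_polygon p ?D (Behind \<alpha>) = co_polygon (co_polygon p \<beta>) \<gamma>"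
  proof -
    have "region_polygon p ?D (Behind \<alpha>) = co_polygon p \<alpha>"
      by (rule region_polygon_leaf) (use leaf in auto)
    then show ?thesis unfolding \<alpha>_def region_polygon_co(1)[OF \<beta> \<gamma>] .
  qed
  have "{x \<in> ?D. lies_behind x \<beta>} = {\<alpha>}" using A(2) assms(2) ab by blast
  then have reg_\<beta>: "region_polygon p ?D (Behind \<beta>) = rt_polygon (co_polygon p \<beta>) \<gamma>"
    unfolding \<alpha>_def by (rule region_polygon_co(2)[OF \<beta> \<gamma>])
  have A_eq: "A = insert \<beta> (A - {\<beta>})" using assms(2) by blast
  show "shuf_prod.F (behind_coeff p ?D) A =
      shuf (bar_coeff (rt_polygon (co_polygon p \<beta>) \<gamma>)) (shuf_prod.F (behind_coeff p A) (A - {\<beta>}))"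
  proof -
    have "shuf_prod.F (behind_coeff p ?D) A = shuf (behind_coeff p ?D \<beta>) (shuf_prod.F (behind_coeff p ?D) (A - {\<beta>}))"
      using A'(3) assms(2) by (rule shuf_prod.remove)
    also have "shuf_prod.F (behind_coeff p ?D) (A - {\<beta>}) = shuf_prod.F (behind_coeff p A) (A - {\<beta>})"
      by (intro shuf_prod.cong refl) (simp add: behind_coeff_def reg_other)
    finally show ?thesis by (simp add: behind_coeff_def reg_\<beta>)
  qed
  have \<gamma>': "\<gamma> \<in> proper_arrows (weight (co_polygon p \<beta>))" using \<gamma> co_polygon(1)[OF \<beta>] by simp
  have w: "weight (co_polygon p \<beta>) = weight (rt_polygon (co_polygon p \<beta>) \<gamma>) + weight (co_polygon (co_polygon p \<beta>) \<gamma>)"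
    using rt_polygon(1)[OF \<gamma>'] co_polygon(1)[OF \<gamma>'] gap_less[OF \<gamma>'] by simp
  \<comment> \<open>For forward \<beta> the directions of \<alpha> and \<gamma> agree. For backward
    \<beta> they are opposite, and the weight of the cut-off part, contained in that of the polygon
    behind \<beta> by \<open>w\<close>, makes up for the difference.\<close>
  have sgn2: "region_sgn p ?D \<alpha> * region_sgn p ?D \<beta> = region_sgn p A \<beta> * arrow_sgn (co_polygon p \<beta>) \<gamma>"
  proof -
    have "region_sgn p A \<beta> = (if forward \<beta> then 1 else (- 1) ^ weight (co_polygon p \<beta>))"
      unfolding region_sgn_def region_polygon_admissible[OF assms(1,2)] ..
    moreover have "forward \<alpha> \<longleftrightarrow> (forward \<gamma> \<longleftrightarrow> forward \<beta>)" unfolding \<alpha>_def by (rule forward_co_arrow[OF \<beta> \<gamma>])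
    ultimately show ?thesis
      unfolding region_sgn_def[of p ?D] reg_\<alpha> reg_\<beta> arrow_sgn_def w
      by (auto simp: power_add)
  qed
  have "dissection_sgn p ?D = region_sgn p ?D \<alpha> * (\<Prod>x\<in>A. region_sgn p ?D x)"
    unfolding dissection_sgn_eq[OF finite.insertI[OF A'(3)]] using A'(3) notin by simp
  also have "(\<Prod>x\<in>A. region_sgn p ?D x) = region_sgn p ?D \<beta> * (\<Prod>x\<in>A - {\<beta>}. region_sgn p ?D x)"
    using A'(3) assms(2) by (rule prod.remove)
  also have "(\<Prod>x\<in>A - {\<beta>}. region_sgn p ?D x) = (\<Prod>x\<in>A - {\<beta>}. region_sgn p A x)"
    by (intro prod.cong refl) (simp add: region_sgn_def reg_other)
  also have "region_sgn p ?D \<alpha> * (region_sgn p ?D \<beta> * (\<Prod>x\<in>A - {\<beta>}. region_sgn p A x)) =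
    region_sgn p A \<beta> * (\<Prod>x\<in>A - {\<beta>}. region_sgn p A x) * arrow_sgn (co_polygon p \<beta>) \<gamma>"
    using sgn2 by (simp add: algebra_simps)
  also have "region_sgn p A \<beta> * (\<Prod>x\<in>A - {\<beta>}. region_sgn p A x) = dissection_sgn p A"
    unfolding dissection_sgn_eq[OF A'(3)] using prod.remove[OF A'(3) assms(2)] by metis
  finally show "dissection_sgn p ?D = dissection_sgn p A * arrow_sgn (co_polygon p \<beta>) \<gamma>" .
qed

text \<open>Common index set for both sides of the induction step; the region behind \<alpha>
  supplies the deleted letter. The other arrows are pairwise not nested, but \<alpha> may lie behind
  one of them.\<close>

definition leafed_dissections :: "'r polygon \<Rightarrow> (arrow set \<times> arrow) set" where
  "leafed_dissections p = {(A, \<alpha>). A \<in> dissections p \<and> \<alpha> \<in> A \<and> (\<forall>\<beta>\<in>A. \<not> lies_behind \<beta> \<alpha>) \<and>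
    A - {\<alpha>} \<in> admissible_dissections p}"

definition leafed_term :: "'r polygon \<Rightarrow> 'r polygon wedge \<Rightarrow> 'r polygon word \<Rightarrow> 'r polygon word \<Rightarrow> arrow set \<Rightarrow> arrow \<Rightarrow> rat" where
  "leafed_term p c u v A \<alpha> = of_bool (c = letter (co_polygon p \<alpha>)) * dissection_sgn p A *
    bar_coeff (region_polygon p A Root) u * shuf_prod.F (behind_coeff p A) (A - {\<alpha>}) v"

definition coproduct_term :: "'r polygon \<Rightarrow> 'r polygon word \<Rightarrow> 'r polygon word \<Rightarrow> arrow set \<Rightarrow> rat" where
  "coproduct_term p u v A = dissection_sgn p A * bar_coeff (region_polygon p A Root) u * shuf_prod.F (behind_coeff p A) A v"

lemma dissections_subset: "A \<in> dissections p \<Longrightarrow> B \<subseteq> A \<Longrightarrow> B \<in> dissections p"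
  unfolding dissections_eq by blast

lemma admissible_rt_iff:
  assumes "\<alpha> \<in> proper_arrows (weight p)" "A \<in> dissections (rt_polygon p \<alpha>)"
  shows "rt_arrow \<alpha> ` A \<in> admissible_dissections p \<longleftrightarrow> A \<in> admissible_dissections (rt_polygon p \<alpha>)"
proof -
  have "rt_arrow \<alpha> ` A \<in> dissections p"
    by (rule dissections_subset[OF dissections_insert_rt_arrow(1)[OF assms]]) blast
  moreover have "lies_behind (rt_arrow \<alpha> \<beta>) (rt_arrow \<alpha> \<gamma>) \<longleftrightarrow> lies_behind \<beta> \<gamma>" if "\<beta> \<in> A" "\<gamma> \<in> A" for \<beta> \<gamma>
    using lies_behind_rt_arrow[OF assms(1)] dissection_arrows[OF assms(2)] that
    unfolding rt_polygon(1)[OF assms(1)] by blast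
  ultimately show ?thesis using assms(2) by (simp add: admissible_iff)
qed

text \<open>First parametrisation: cut along \<alpha> first, then dissect the root part.
  Admissibility agrees on both sides because \<open>rt_arrow\<close> preserves and reflects
  nesting.\<close>

lemma leafed_dissections_bij:
  "bij_betw (\<lambda>(\<alpha>, A). (insert \<alpha> (rt_arrow \<alpha> ` A), \<alpha>))
    (SIGMA \<alpha>:nontrivial_arrows p. admissible_dissections (rt_polygon p \<alpha>)) (leafed_dissections p)"
  unfolding bij_betw_def
proof
  show "inj_on (\<lambda>(\<alpha>, A). (insert \<alpha> (rt_arrow \<alpha> ` A), \<alpha>)) (SIGMA \<alpha>:nontrivial_arrows p. admissible_dissections (rt_polygon p \<alpha>))"
  proof (rule inj_onI)
    fix x y
    assume xy: "x \<in> (SIGMA \<alpha>:nontrivial_arrows p. admissible_dissections (rt_polygon p \<alpha>))"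
      "y \<in> (SIGMA \<alpha>:nontrivial_arrows p. admissible_dissections (rt_polygon p \<alpha>))"
      "(\<lambda>(\<alpha>, A). (insert \<alpha> (rt_arrow \<alpha> ` A), \<alpha>)) x = (\<lambda>(\<alpha>, A). (insert \<alpha> (rt_arrow \<alpha> ` A), \<alpha>)) y"
    obtain \<alpha> A B where [simp]: "x = (\<alpha>, A)" "y = (\<alpha>, B)" using xy(3) by (cases x; cases y) simp
    have "\<alpha> \<in> proper_arrows (weight p)" "A \<in> dissections (rt_polygon p \<alpha>)" "B \<in> dissections (rt_polygon p \<alpha>)"
      using xy(1,2) by (simp_all add: nontrivial_arrows_eq admissible_iff)
    then have "\<alpha> \<notin> rt_arrow \<alpha> ` A" "\<alpha> \<notin> rt_arrow \<alpha> ` B"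
      using dissections_insert_rt_arrow(2) by blast+
    moreover have "insert \<alpha> (rt_arrow \<alpha> ` A) = insert \<alpha> (rt_arrow \<alpha> ` B)" using xy(3) by simp
    ultimately have "rt_arrow \<alpha> ` A = rt_arrow \<alpha> ` B" by (simp add: insert_ident)
    then show "x = y" by (simp add: inj_image_eq_iff inj_on_def)
  qed
  show "(\<lambda>(\<alpha>, A). (insert \<alpha> (rt_arrow \<alpha> ` A), \<alpha>)) ` (SIGMA \<alpha>:nontrivial_arrows p. admissible_dissections (rt_polygon p \<alpha>)) =
    leafed_dissections p"
  proof (intro equalityI subsetI)
    fix y assume "y \<in> (\<lambda>(\<alpha>, A). (insert \<alpha> (rt_arrow \<alpha> ` A), \<alpha>)) ` (SIGMA \<alpha>:nontrivial_arrows p. admissible_dissections (rt_polygon p \<alpha>))"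
    then obtain \<alpha> A where y: "y = (insert \<alpha> (rt_arrow \<alpha> ` A), \<alpha>)" and \<alpha>: "\<alpha> \<in> proper_arrows (weight p)"
      and A: "A \<in> admissible_dissections (rt_polygon p \<alpha>)"
      by (auto simp: nontrivial_arrows_eq)
    have A': "A \<in> dissections (rt_polygon p \<alpha>)" using A by (simp add: admissible_iff)
    have "rt_arrow \<alpha> ` A \<in> admissible_dissections p" using admissible_rt_iff[OF \<alpha> A'] A by simp
    then show "y \<in> leafed_dissections p"
      using dissections_insert_rt_arrow[OF \<alpha> A'] y by (simp add: leafed_dissections_def)
  next
    fix y assume "y \<in> leafed_dissections p"
    then obtain D \<alpha> where y: "y = (D, \<alpha>)" "D \<in> dissections p" "\<alpha> \<in> D" "\<forall>\<beta>\<in>D. \<not> lies_behind \<beta> \<alpha>"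
      "D - {\<alpha>} \<in> admissible_dissections p"
      by (cases y) (simp add: leafed_dissections_def)
    have \<alpha>: "\<alpha> \<in> proper_arrows (weight p)" using dissection_arrows(1)[OF y(2,3)] .
    obtain A where A: "A \<in> dissections (rt_polygon p \<alpha>)" "D = insert \<alpha> (rt_arrow \<alpha> ` A)"
      using dissections_leaf[OF y(3,2)] y(4) by blast
    then have "D - {\<alpha>} = rt_arrow \<alpha> ` A" using dissections_insert_rt_arrow(2)[OF \<alpha> A(1)] by simp
    then have "A \<in> admissible_dissections (rt_polygon p \<alpha>)" using y(5) admissible_rt_iff[OF \<alpha> A(1)] by simp
    then have "(\<alpha>, A) \<in> (SIGMA \<alpha>:nontrivial_arrows p. admissible_dissections (rt_polygon p \<alpha>))"
      using \<alpha> by (simp add: nontrivial_arrows_eq)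
    then show "y \<in> (\<lambda>(\<alpha>, A). (insert \<alpha> (rt_arrow \<alpha> ` A), \<alpha>)) ` (SIGMA \<alpha>:nontrivial_arrows p. admissible_dissections (rt_polygon p \<alpha>))"
      using y(1) A(2) by (intro image_eqI[of _ _ "(\<alpha>, A)"]) auto
  qed
qed

lemma sum_leafed_dissections:
  "(\<Sum>\<alpha>\<in>nontrivial_arrows p. of_bool (c = letter (co_polygon p \<alpha>)) * arrow_sgn p \<alpha> *
      (\<Sum>A\<in>admissible_dissections (rt_polygon p \<alpha>). coproduct_term (rt_polygon p \<alpha>) u v A)) =
   (\<Sum>(A, \<alpha>)\<in>leafed_dissections p. leafed_term p c u v A \<alpha>)"
proof -
  have eq: "of_bool (c = letter (co_polygon p \<alpha>)) * arrow_sgn p \<alpha> * coproduct_term (rt_polygon p \<alpha>) u v A =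
    leafed_term p c u v (insert \<alpha> (rt_arrow \<alpha> ` A)) \<alpha>"
    if "\<alpha> \<in> nontrivial_arrows p" "A \<in> admissible_dissections (rt_polygon p \<alpha>)" for \<alpha> A
  proof -
    have \<alpha>: "\<alpha> \<in> proper_arrows (weight p)" using that by (simp add: nontrivial_arrows_eq)
    have A: "A \<in> dissections (rt_polygon p \<alpha>)" using that by (simp add: admissible_iff)
    let ?D = "insert \<alpha> (rt_arrow \<alpha> ` A)"
    have "shuf_prod.F (behind_coeff p ?D) (?D - {\<alpha>}) = shuf_prod.F (behind_coeff p ?D) (rt_arrow \<alpha> ` A)"
      using dissections_insert_rt_arrow(2)[OF \<alpha> A] by simp
    also have "\<dots> = shuf_prod.F (behind_coeff p ?D \<circ> rt_arrow \<alpha>) A"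
      by (intro shuf_prod.reindex) (simp add: inj_on_def)
    also have "\<dots> = shuf_prod.F (behind_coeff (rt_polygon p \<alpha>) A) A"
      using region_polygon_rt[OF \<alpha> A, of "Behind _"]
      by (intro shuf_prod.cong refl) (simp add: behind_coeff_def)
    finally show ?thesis
      unfolding leafed_term_def coproduct_term_def dissection_sgn_rt[OF \<alpha> A]
      using region_polygon_rt[OF \<alpha> A, of Root] by simp
  qed
  have "(\<Sum>\<alpha>\<in>nontrivial_arrows p. of_bool (c = letter (co_polygon p \<alpha>)) * arrow_sgn p \<alpha> *
      (\<Sum>A\<in>admissible_dissections (rt_polygon p \<alpha>). coproduct_term (rt_polygon p \<alpha>) u v A)) =
    (\<Sum>\<alpha>\<in>nontrivial_arrows p. \<Sum>A\<in>admissible_dissections (rt_polygon p \<alpha>). leafed_term p c u v (insert \<alpha> (rt_arrow \<alpha> ` A)) \<alpha>)"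
    unfolding sum_distrib_left by (intro sum.cong refl) (simp add: eq)
  also have "\<dots> = (\<Sum>x\<in>(SIGMA \<alpha>:nontrivial_arrows p. admissible_dissections (rt_polygon p \<alpha>)).
      (\<lambda>(A, \<alpha>). leafed_term p c u v A \<alpha>) ((\<lambda>(\<alpha>, A). (insert \<alpha> (rt_arrow \<alpha> ` A), \<alpha>)) x))"
    by (subst sum.Sigma) (auto simp: nontrivial_arrows_eq split_def)
  also have "\<dots> = (\<Sum>(A, \<alpha>)\<in>leafed_dissections p. leafed_term p c u v A \<alpha>)"
    by (rule sum.reindex_bij_betw[OF leafed_dissections_bij])
  finally show ?thesis .
qed

lemma finite_nontrivial_arrows [simp]: "finite (nontrivial_arrows p)"
  by (simp add: nontrivial_arrows_eq)

lemma finite_leafed_dissections: "finite (leafed_dissections p)"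
  using bij_betw_finite[OF leafed_dissections_bij[of p]] by simp

definition add_nested :: "arrow set \<times> arrow \<times> arrow \<Rightarrow> arrow set \<times> arrow" where
  "add_nested = (\<lambda>(A, \<beta>, \<gamma>). (insert (co_arrow \<beta> \<gamma>) A, co_arrow \<beta> \<gamma>))"

lemma add_nested_bij:
  "bij_betw add_nested (SIGMA A:admissible_dissections p. SIGMA \<beta>:A. nontrivial_arrows (co_polygon p \<beta>))
    {(A, \<alpha>) \<in> leafed_dissections p. A \<notin> admissible_dissections p}"
  (is "bij_betw _ ?X ?Y")
  unfolding bij_betw_def
proof
  have \<gamma>: "\<beta> \<in> proper_arrows (weight p) \<and> \<gamma> \<in> proper_arrows (gap \<beta>)"
    if "A \<in> admissible_dissections p" "\<beta> \<in> A" "\<gamma> \<in> nontrivial_arrows (co_polygon p \<beta>)" for A \<beta> \<gamma>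
  proof -
    have "\<beta> \<in> proper_arrows (weight p)" using that(1,2) by (rule admissible_arrows)
    then show ?thesis using that(3) co_polygon(1)[of \<beta> p] by (simp add: nontrivial_arrows_eq)
  qed
  show "inj_on add_nested ?X"
  proof (rule inj_onI)
    fix x y assume xy: "x \<in> ?X" "y \<in> ?X" "add_nested x = add_nested y"
    obtain A \<beta> \<gamma> B \<delta> \<epsilon> where [simp]: "x = (A, \<beta>, \<gamma>)" "y = (B, \<delta>, \<epsilon>)" by (cases x; cases y) blast
    have x: "A \<in> admissible_dissections p" "\<beta> \<in> A" "\<gamma> \<in> nontrivial_arrows (co_polygon p \<beta>)"
      and y: "B \<in> admissible_dissections p" "\<delta> \<in> B" "\<epsilon> \<in> nontrivial_arrows (co_polygon p \<delta>)"
      using xy(1,2) by simp_all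
    have \<alpha>: "co_arrow \<beta> \<gamma> = co_arrow \<delta> \<epsilon>" "insert (co_arrow \<beta> \<gamma>) A = insert (co_arrow \<delta> \<epsilon>) B"
      using xy(3) by (simp only: add_nested_def \<open>x = _\<close> \<open>y = _\<close> prod.case prod.inject)+
    then have AB: "A = B" using add_nested_arrow(1)[OF x] add_nested_arrow(1)[OF y] by (simp add: insert_ident)
    \<comment> \<open>The outer arrow is recovered as the only arrow of \<open>A\<close> in front of
      the nested one.\<close>
    then have "\<beta> = \<delta>" using add_nested_arrow(4)[OF y x(2)[unfolded AB]] add_nested_arrow(2)[OF x] \<alpha>(1) by simp
    moreover from this have "\<gamma> = \<epsilon>"
      using inj_onD[OF inj_on_co_arrow, of \<beta> "weight p" \<gamma> \<epsilon>] \<alpha>(1) \<gamma>[OF x] \<gamma>[OF y] by simp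
    ultimately show "x = y" using AB by simp
  qed
  show "add_nested ` ?X = ?Y"
  proof (intro equalityI subsetI)
    fix y assume "y \<in> add_nested ` ?X"
    then obtain A \<beta> \<gamma> where x: "A \<in> admissible_dissections p" "\<beta> \<in> A" "\<gamma> \<in> nontrivial_arrows (co_polygon p \<beta>)"
      and y: "y = (insert (co_arrow \<beta> \<gamma>) A, co_arrow \<beta> \<gamma>)"
      by (auto simp: add_nested_def)
    let ?\<alpha> = "co_arrow \<beta> \<gamma>"
    note n = add_nested_arrow(1-5)[OF x]
    have "insert ?\<alpha> A \<notin> admissible_dissections p"
      using n(2) x(2) unfolding admissible_iff by blast
    moreover have "insert ?\<alpha> A - {?\<alpha>} = A" using n(1) by simp
    ultimately show "y \<in> ?Y"
      using n(3,5) x(1) by (simp add: leafed_dissections_def y)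
  next
    fix y assume "y \<in> ?Y"
    then obtain D \<alpha> where y: "y = (D, \<alpha>)" "D \<in> dissections p" "\<alpha> \<in> D" "\<forall>\<beta>\<in>D. \<not> lies_behind \<beta> \<alpha>"
      "D - {\<alpha>} \<in> admissible_dissections p" "D \<notin> admissible_dissections p"
      by (cases y) (simp add: leafed_dissections_def)
    have anti: "\<not> lies_behind x z" if "x \<in> D - {\<alpha>}" "z \<in> D - {\<alpha>}" for x z
      using y(5) that unfolding admissible_iff by blast
    \<comment> \<open>A nested pair must involve \<alpha>, as the other arrows are not nested; and
      \<alpha> must be the one behind, as nothing lies behind \<alpha>.\<close>
    obtain x \<beta> where x: "x \<in> D" "\<beta> \<in> D" "lies_behind x \<beta>" using y(2,6) unfolding admissible_iff by blast
    then have "\<beta> \<noteq> \<alpha>" using y(4) by blast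
    then have \<beta>: "\<beta> \<in> D - {\<alpha>}" "lies_behind \<alpha> \<beta>" using x anti by blast+
    have p: "\<alpha> \<in> proper_arrows (weight p)" "\<beta> \<in> proper_arrows (weight p)" "compatible \<alpha> \<beta>"
      using dissection_arrows[OF y(2)] y(3) x(2) by blast+
    have "\<alpha> \<in> co_arrow \<beta> ` proper_arrows (gap \<beta>)"
      unfolding co_arrow_image[OF p(2)] using p \<beta>(2) by simp
    then obtain \<gamma> where \<gamma>: "\<gamma> \<in> proper_arrows (gap \<beta>)" "\<alpha> = co_arrow \<beta> \<gamma>" by blast
    have "(D - {\<alpha>}, \<beta>, \<gamma>) \<in> ?X"
      using y(5) \<beta>(1) \<gamma>(1) co_polygon(1)[OF p(2)] by (simp add: nontrivial_arrows_eq)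
    moreover have "y = add_nested (D - {\<alpha>}, \<beta>, \<gamma>)"
      unfolding y(1) add_nested_def using \<gamma>(2) y(3) by (simp add: insert_absorb)
    ultimately show "y \<in> add_nested ` ?X" by (rule image_eqI[rotated])
  qed
qed

lemma shuf_of_bool_Nil:
  fixes h :: "'a list \<Rightarrow> rat"
  shows "shuf (\<lambda>x. of_bool (x = [] \<and> P)) h v = of_bool P * h v"
proof (cases P)
  case True
  then have "(\<lambda>x :: 'a list. of_bool (x = [] \<and> P) :: rat) = shuf_unit" by (auto simp: shuf_unit_def)
  with True show ?thesis by (simp add: shuf_unit_left)
qed simp

text \<open>By the derivation rule the letter is deleted from the bar element behind one arrow
  \<beta>. By \<open>bar_coeff_snoc\<close> either that whole polygon is the letter, which gives the
  first sum, or it is cut along an arrow \<gamma>, which gives the nested dissections.\<close>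

lemma coproduct_term_snoc:
  fixes p :: "'r polygon"
  assumes "A \<in> admissible_dissections p"
  shows "coproduct_term p u (v @ [c]) A = (\<Sum>\<beta>\<in>A. leafed_term p c u v A \<beta>) +
    (\<Sum>\<beta>\<in>A. \<Sum>\<gamma>\<in>nontrivial_arrows (co_polygon p \<beta>). (\<lambda>(A, \<alpha>). leafed_term p c u v A \<alpha>) (add_nested (A, \<beta>, \<gamma>)))"
proof -
  have fin: "finite A" using assms finite_dissection by (auto simp: admissible_iff)
  let ?C = "dissection_sgn p A * bar_coeff (region_polygon p A Root) u"
  let ?h = "\<lambda>\<beta>. shuf_prod.F (behind_coeff p A) (A - {\<beta>})"
  have "?C * shuf (\<lambda>x. behind_coeff p A \<beta> (x @ [c])) (?h \<beta>) v = leafed_term p c u v A \<beta> +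
    (\<Sum>\<gamma>\<in>nontrivial_arrows (co_polygon p \<beta>). (\<lambda>(A, \<alpha>). leafed_term p c u v A \<alpha>) (add_nested (A, \<beta>, \<gamma>)))"
    if \<beta>: "\<beta> \<in> A" for \<beta>
  proof -
    let ?q = "co_polygon p \<beta>"
    have \<beta>p: "\<beta> \<in> proper_arrows (weight p)" using assms \<beta> by (rule admissible_arrows)
    have "shuf (\<lambda>x. behind_coeff p A \<beta> (x @ [c])) (?h \<beta>) v = of_bool (c = letter ?q) * ?h \<beta> v +
      (\<Sum>\<gamma>\<in>nontrivial_arrows ?q. of_bool (c = letter (co_polygon ?q \<gamma>)) * arrow_sgn ?q \<gamma> *
        shuf (bar_coeff (rt_polygon ?q \<gamma>)) (?h \<beta>) v)"
      unfolding behind_coeff_def[of p A \<beta>] region_polygon_admissible[OF assms \<beta>] bar_coeff_snoc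
      by (simp only: shuf_add_left shuf_sum_left shuf_cmult_left shuf_of_bool_Nil)
    then have "?C * shuf (\<lambda>x. behind_coeff p A \<beta> (x @ [c])) (?h \<beta>) v =
      ?C * (of_bool (c = letter ?q) * ?h \<beta> v) +
      (\<Sum>\<gamma>\<in>nontrivial_arrows ?q. ?C * (of_bool (c = letter (co_polygon ?q \<gamma>)) * arrow_sgn ?q \<gamma> *
        shuf (bar_coeff (rt_polygon ?q \<gamma>)) (?h \<beta>) v))"
      by (simp only: distrib_left sum_distrib_left)
    also have "?C * (of_bool (c = letter ?q) * ?h \<beta> v) = leafed_term p c u v A \<beta>"
      by (simp only: leafed_term_def mult_ac)
    also have "(\<Sum>\<gamma>\<in>nontrivial_arrows ?q. ?C * (of_bool (c = letter (co_polygon ?q \<gamma>)) * arrow_sgn ?q \<gamma> *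
        shuf (bar_coeff (rt_polygon ?q \<gamma>)) (?h \<beta>) v)) =
      (\<Sum>\<gamma>\<in>nontrivial_arrows ?q. (\<lambda>(A, \<alpha>). leafed_term p c u v A \<alpha>) (add_nested (A, \<beta>, \<gamma>)))"
    proof (intro sum.cong refl)
      fix \<gamma> assume \<gamma>: "\<gamma> \<in> nontrivial_arrows ?q"
      note n = add_nested_arrow[OF assms \<beta> \<gamma>]
      have "\<gamma> \<in> proper_arrows (gap \<beta>)" using \<gamma> by (simp add: nontrivial_arrows_eq co_polygon(1)[OF \<beta>p])
      then have "co_polygon p (co_arrow \<beta> \<gamma>) = co_polygon ?q \<gamma>" by (rule region_polygon_co(1)[OF \<beta>p])
      moreover have "insert (co_arrow \<beta> \<gamma>) A - {co_arrow \<beta> \<gamma>} = A" using n(1) by simp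
      ultimately show "?C * (of_bool (c = letter (co_polygon ?q \<gamma>)) * arrow_sgn ?q \<gamma> *
        shuf (bar_coeff (rt_polygon ?q \<gamma>)) (?h \<beta>) v) =
        (\<lambda>(A, \<alpha>). leafed_term p c u v A \<alpha>) (add_nested (A, \<beta>, \<gamma>))"
        unfolding add_nested_def prod.case leafed_term_def n(6-8) by (simp only: n(6-8) mult_ac)
    qed
    finally show ?thesis .
  qed
  then show ?thesis
    unfolding coproduct_term_def shuf_prod_snoc[OF fin] sum_distrib_left
    by (simp only: sum.distrib[symmetric] cong: sum.cong)
qed

text \<open>Second parametrisation of the leafed dissections, split by admissibility: in an
  admissible one any arrow may be marked, and the others arise through
  \<open>add_nested_bij\<close>.\<close>

lemma sum_coproduct_term_snoc:
  "(\<Sum>A\<in>admissible_dissections p. coproduct_term p u (v @ [c]) A) =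
   (\<Sum>(A, \<alpha>)\<in>leafed_dissections p. leafed_term p c u v A \<alpha>)"
proof -
  let ?adm = "admissible_dissections p" and ?f = "\<lambda>(A, \<alpha>). leafed_term p c u v A \<alpha>"
  let ?Y = "{(A, \<alpha>) \<in> leafed_dissections p. A \<notin> ?adm}"
  have fin: "finite A" if "A \<in> ?adm" for A using that finite_dissection by (auto simp: admissible_iff)
  have un: "(SIGMA A:?adm. A) \<union> ?Y = leafed_dissections p"
  proof -
    have "(A, \<alpha>) \<in> leafed_dissections p" if "A \<in> ?adm" "\<alpha> \<in> A" for A \<alpha>
      using that dissections_subset[of A p "A - {\<alpha>}"] unfolding leafed_dissections_def admissible_iff by blast
    moreover have "\<alpha> \<in> A" if "(A, \<alpha>) \<in> leafed_dissections p" for A \<alpha>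
      using that by (simp add: leafed_dissections_def)
    ultimately show ?thesis by blast
  qed
  have "finite ((SIGMA A:?adm. A) \<union> ?Y)" unfolding un by (rule finite_leafed_dissections)
  then have f: "finite (SIGMA A:?adm. A)" "finite ?Y" by (simp_all only: finite_Un)
  have "(SIGMA A:?adm. A) \<inter> ?Y = {}" by blast
  from sum.union_disjoint[OF f this, of ?f]
  have "sum ?f (leafed_dissections p) = sum ?f (SIGMA A:?adm. A) + sum ?f ?Y" unfolding un .
  also have "sum ?f (SIGMA A:?adm. A) = (\<Sum>A\<in>?adm. \<Sum>\<beta>\<in>A. leafed_term p c u v A \<beta>)"
    using fin by (subst sum.Sigma) auto
  also have "sum ?f ?Y = (\<Sum>x\<in>(SIGMA A:?adm. SIGMA \<beta>:A. nontrivial_arrows (co_polygon p \<beta>)). ?f (add_nested x))"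
    by (rule sum.reindex_bij_betw[OF add_nested_bij, symmetric])
  also have "\<dots> = (\<Sum>A\<in>?adm. \<Sum>\<beta>\<in>A. \<Sum>\<gamma>\<in>nontrivial_arrows (co_polygon p \<beta>). ?f (add_nested (A, \<beta>, \<gamma>)))"
  proof -
    have "(\<Sum>A\<in>?adm. \<Sum>\<beta>\<in>A. \<Sum>\<gamma>\<in>nontrivial_arrows (co_polygon p \<beta>). ?f (add_nested (A, \<beta>, \<gamma>))) =
      (\<Sum>A\<in>?adm. \<Sum>y\<in>(SIGMA \<beta>:A. nontrivial_arrows (co_polygon p \<beta>)). ?f (add_nested (A, y)))"
      by (intro sum.cong refl, subst sum.Sigma) (use fin in \<open>auto simp: split_def\<close>)
    also have "\<dots> = (\<Sum>x\<in>(SIGMA A:?adm. SIGMA \<beta>:A. nontrivial_arrows (co_polygon p \<beta>)). ?f (add_nested x))"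
      by (subst sum.Sigma) (use fin in \<open>auto simp: split_def\<close>)
    finally show ?thesis ..
  qed
  also have "(\<Sum>A\<in>?adm. \<Sum>\<beta>\<in>A. leafed_term p c u v A \<beta>) + \<dots> = (\<Sum>A\<in>?adm. coproduct_term p u (v @ [c]) A)"
    by (subst sum.distrib[symmetric]) (intro sum.cong refl coproduct_term_snoc[symmetric])
  finally show ?thesis ..
qed

theorem bar_coeff_append:
  "bar_coeff p (u @ v) = of_bool (u = []) * bar_coeff p v + (\<Sum>A\<in>admissible_dissections p. coproduct_term p u v A)"
proof (induction v arbitrary: p rule: rev_induct)
  case Nil
  have "{} \<in> admissible_dissections p" by (simp add: admissible_iff dissections_eq)
  \<comment> \<open>At the empty word a shuffle product is the product of the coefficients of its
    factors. These vanish, since every word of a bar element contains a letter for its root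
    region.\<close>
  moreover have "coproduct_term p u [] A = 0" if "A \<in> admissible_dissections p - {{}}" for A
  proof -
    have "finite A" "A \<noteq> {}" using that finite_dissection by (auto simp: admissible_iff)
    then show ?thesis by (auto simp: coproduct_term_def shuf_prod_Nil behind_coeff_def)
  qed
  ultimately have "(\<Sum>A\<in>admissible_dissections p. coproduct_term p u [] A) = coproduct_term p u [] {}"
    by (subst sum.remove[of _ "{}"]) simp_all
  also have "\<dots> = bar_coeff p u"
    by (simp add: coproduct_term_def dissection_sgn_def region_polygon_empty shuf_unit_def)
  finally show ?case by simp
next
  case (snoc c v)
  have "bar_coeff p (u @ v @ [c]) = of_bool (u @ v = [] \<and> c = letter p) +
    (\<Sum>\<alpha>\<in>nontrivial_arrows p. of_bool (c = letter (co_polygon p \<alpha>)) * arrow_sgn p \<alpha> * bar_coeff (rt_polygon p \<alpha>) (u @ v))"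
    using bar_coeff_snoc[of p "u @ v" c] by simp
  \<comment> \<open>The dissection without arrows contributes only for \<open>u = []\<close>.
    Together with the separate terms from the induction hypothesis it reassembles, by
    \<open>bar_coeff_snoc\<close>, to the separate term for \<open>p\<close>.\<close>
  also have "\<dots> = of_bool (u = []) * bar_coeff p (v @ [c]) +
    (\<Sum>\<alpha>\<in>nontrivial_arrows p. of_bool (c = letter (co_polygon p \<alpha>)) * arrow_sgn p \<alpha> *
      (\<Sum>A\<in>admissible_dissections (rt_polygon p \<alpha>). coproduct_term (rt_polygon p \<alpha>) u v A))"
    unfolding snoc.IH bar_coeff_snoc
    by (cases "u = []") (simp_all add: distrib_left sum.distrib)
  finally show ?case unfolding sum_leafed_dissections sum_coproduct_term_snoc .
qed

section \<open>The Hopf subalgebra\<close>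

lemma factors_letter: "factors (letter p) = {p}"
  unfolding letter_def by (rule Wedge_inverse) simp

lemma flat_polygon_bar: "flat (polygon_bar p)"
  unfolding flat_iff
proof (intro allI impI ballI)
  fix w a assume w: "Poly_Mapping.lookup (polygon_bar p) w \<noteq> 0" and a: "a \<in> set w"
  have "\<exists>x. dissection_word p x = w"
  proof (rule ccontr)
    assume "\<nexists>x. dissection_word p x = w"
    then have "bar_coeff p w = 0" unfolding bar_coeff_eq by (intro sum.neutral ballI) auto
    with w show False by (simp add: bar_coeff_def)
  qed
  then obtain A rs where "w = map (letter \<circ> region_polygon p A) rs"
    by (auto simp: dissection_word_def split: prod.splits)
  with a obtain q where "a = letter q" by auto
  then show "shifted_degree a = 0" by (simp add: shifted_degree_def factors_letter)
qed

lemma lookup_shuffle_nonroot: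
  assumes "A \<in> admissible_dissections p"
  shows "flat (shuffle_nonroot p A)" "Poly_Mapping.lookup (shuffle_nonroot p A) = shuf_prod.F (behind_coeff p A) A"
  using shuffle_list_eq[of "sorted_list_of_set A" "\<lambda>\<alpha>. polygon_bar (region_polygon p A (Behind \<alpha>))", OF flat_polygon_bar]
    finite_admissible[OF assms]
  by (simp_all add: shuffle_nonroot_def behind_coeff_def[abs_def] bar_coeff_def)

theorem coproduct_polygon_bar:
  "coproduct (polygon_bar p) = bar_one \<otimes> polygon_bar p +
    (\<Sum>A\<in>admissible_dissections p. pm_scale (dissection_sgn p A)
      (polygon_bar (region_polygon p A Root) \<otimes> shuffle_nonroot p A))"
proof (rule poly_mapping_eqI)
  fix x :: "'a polygon word \<times> 'a polygon word"
  obtain u v where x: "x = (u, v)" by (cases x)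
  show "Poly_Mapping.lookup (coproduct (polygon_bar p)) x = Poly_Mapping.lookup (bar_one \<otimes> polygon_bar p +
    (\<Sum>A\<in>admissible_dissections p. pm_scale (dissection_sgn p A)
      (polygon_bar (region_polygon p A Root) \<otimes> shuffle_nonroot p A))) x"
    unfolding x using bar_coeff_append[of p u v]
    by (simp add: lookup_coproduct Poly_Mapping.lookup_add Poly_Mapping.lookup_sum lookup_tensor lookup_bar_one
        lookup_shuffle_nonroot coproduct_term_def bar_coeff_def mult.assoc)
qed

text \<open>Each arrow costs the root region at least one side, by \<open>gap_pos\<close>. This
  gives the descent in the recursion for the antipode.\<close>

lemma weight_root_polygon:
  "A \<in> admissible_dissections p \<Longrightarrow> weight (region_polygon p A Root) \<le> weight p - card A"
proof (induction "card A" arbitrary: A p)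
  case 0
  then have "A = {}" using finite_admissible by fastforce
  then show ?case by (simp add: region_polygon_empty)
next
  case (Suc m)
  then have "A \<noteq> {}" by (cases "A = {}") simp_all
  then obtain \<alpha> where \<alpha>: "\<alpha> \<in> A" by blast
  have A: "A \<in> dissections p" "\<And>\<beta>. \<beta> \<in> A \<Longrightarrow> \<not> lies_behind \<beta> \<alpha>"
    using Suc.prems \<alpha> by (auto simp: admissible_iff)
  have \<alpha>p: "\<alpha> \<in> proper_arrows (weight p)" using Suc.prems \<alpha> by (rule admissible_arrows)
  obtain B where B: "B \<in> dissections (rt_polygon p \<alpha>)" "A = insert \<alpha> (rt_arrow \<alpha> ` B)"
    using dissections_leaf[OF \<alpha> A] by blast
  have "rt_arrow \<alpha> ` B \<in> admissible_dissections p"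
    using Suc.prems dissections_subset[OF A(1)] B(2) unfolding admissible_iff by blast
  then have adm: "B \<in> admissible_dissections (rt_polygon p \<alpha>)" using admissible_rt_iff[OF \<alpha>p B(1)] by simp
  have c: "card A = Suc (card B)"
    using B dissections_insert_rt_arrow(2)[OF \<alpha>p B(1)] finite_dissection[OF B(1)]
    by (simp add: card_image inj_on_def)
  have "weight (region_polygon (rt_polygon p \<alpha>) B Root) \<le> weight (rt_polygon p \<alpha>) - card B"
    using Suc.hyps(1)[OF _ adm] Suc.hyps(2) c by simp
  then show ?case
    using region_polygon_rt[OF \<alpha>p B(1), of Root] rt_polygon(1)[OF \<alpha>p] gap_pos[OF \<alpha>p] B(2) c by simp
qed

section \<open>Closure of the generated algebra under the coproduct and the antipode\<close>

abbreviation (input) polygon_algebra :: "'r polygon bar set" where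
  "polygon_algebra \<equiv> generated_subalgebra (range polygon_bar)"

text \<open>Hence product and antipode on the generated algebra are given by the sign-free
  \<open>shuf\<close> and \<open>signed_rev\<close>.\<close>

lemma flat_generated: "x \<in> polygon_algebra \<Longrightarrow> flat x"
proof (induction rule: generated_subalgebra.induct)
  case (add x y)
  then show ?case unfolding flat_iff by (metis Poly_Mapping.lookup_add add.right_neutral)
next
  case (scale x c)
  then show ?case unfolding flat_iff by (metis lookup_pm_scale mult_zero_right)
qed (auto simp: flat_polygon_bar flat_bar_one flat_shuffle)

lemma zero_generated: "0 \<in> polygon_algebra"
proof -
  have "pm_scale 0 bar_one \<in> polygon_algebra" by (intro generated_subalgebra.intros)
  moreover have "pm_scale 0 bar_one = 0" by (rule poly_mapping_eqI) simp
  ultimately show ?thesis by simp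
qed

lemma sum_generated: "(\<And>i. i \<in> I \<Longrightarrow> f i \<in> polygon_algebra) \<Longrightarrow> sum f I \<in> polygon_algebra"
  by (induction I rule: infinite_finite_induct) (auto simp: zero_generated intro: generated_subalgebra.add)

lemma shuffle_list_generated: "set xs \<subseteq> polygon_algebra \<Longrightarrow> shuffle_list xs \<in> polygon_algebra"
  by (induction xs) (auto simp: shuffle_list_def intro: generated_subalgebra.intros)

lemma shuffle_nonroot_generated: "shuffle_nonroot p A \<in> polygon_algebra"
  unfolding shuffle_nonroot_def
  by (rule shuffle_list_generated) (auto intro: generated_subalgebra.gen)

text \<open>A list of pairs stands for the sum of the tensor products of its entries.\<close>

definition splits :: "'r polygon bar \<Rightarrow> ('r polygon bar \<times> 'r polygon bar) list \<Rightarrow> bool" where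
  "splits x L \<longleftrightarrow> set L \<subseteq> polygon_algebra \<times> polygon_algebra \<and>
    (\<forall>u v. Poly_Mapping.lookup x (u @ v) = (\<Sum>(y, z)\<leftarrow>L. Poly_Mapping.lookup y u * Poly_Mapping.lookup z v))"

text \<open>By \<open>shuf_append\<close> the tensor decompositions of two factors multiply
  entrywise to one of their product, and all entries stay in the algebra.\<close>

lemma splits_shuffle:
  assumes "splits x L" "splits y M" "x \<in> polygon_algebra" "y \<in> polygon_algebra"
  shows "splits (shuffle x y) (concat (map (\<lambda>(a, b). map (\<lambda>(a', b'). (shuffle a a', shuffle b b')) M) L))"
proof -
  let ?l = "\<lambda>x. Poly_Mapping.lookup x"
  let ?N = "concat (map (\<lambda>(a, b). map (\<lambda>(a', b'). (shuffle a a', shuffle b b')) M) L)"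
  have L: "set L \<subseteq> polygon_algebra \<times> polygon_algebra" "set M \<subseteq> polygon_algebra \<times> polygon_algebra"
    using assms by (auto simp: splits_def)
  have "?l (shuffle x y) (u @ v) = (\<Sum>(a, b)\<leftarrow>?N. ?l a u * ?l b v)" for u v
  proof -
    have "?l (shuffle x y) (u @ v) = shuf (?l x) (?l y) (u @ v)"
      using assms(3,4) by (simp add: lookup_shuffle flat_generated)
    also have "\<dots> = (\<Sum>(a, b)\<leftarrow>map (map_prod ?l ?l) L. \<Sum>(a', b')\<leftarrow>map (map_prod ?l ?l) M. shuf a a' u * shuf b b' v)"
      by (rule shuf_append) (use assms(1,2) in \<open>simp_all add: splits_def split_def comp_def\<close>)
    also have "\<dots> = (\<Sum>(a, b)\<leftarrow>L. \<Sum>(a', b')\<leftarrow>M. ?l (shuffle a a') u * ?l (shuffle b b') v)"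
      unfolding map_map comp_def split_def fst_map_prod snd_map_prod
    proof (intro arg_cong[of _ _ sum_list] map_cong refl)
      fix p q assume "p \<in> set L" "q \<in> set M"
      then have "p \<in> polygon_algebra \<times> polygon_algebra" "q \<in> polygon_algebra \<times> polygon_algebra" using L by blast+
      then have "flat (fst p)" "flat (snd p)" "flat (fst q)" "flat (snd q)" by (simp_all add: mem_Times_iff flat_generated)
      then show "shuf (?l (fst p)) (?l (fst q)) u * shuf (?l (snd p)) (?l (snd q)) v =
        ?l (shuffle (fst p) (fst q)) u * ?l (shuffle (snd p) (snd q)) v"
        by (simp add: lookup_shuffle)
    qed
    also have "\<dots> = (\<Sum>(a, b)\<leftarrow>?N. ?l a u * ?l b v)"
      by (induction L) (auto simp: split_def comp_def)
    finally show ?thesis .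
  qed
  moreover have "set ?N \<subseteq> polygon_algebra \<times> polygon_algebra"
    using L by (auto intro!: generated_subalgebra.mult)
  ultimately show ?thesis unfolding splits_def by blast
qed

lemma splits_polygon_bar: "\<exists>L. splits (polygon_bar p) L"
proof -
  obtain As where As: "set As = admissible_dissections p" "distinct As"
    using finite_distinct_list[OF finite_admissible_dissections] by blast
  let ?L = "(bar_one, polygon_bar p) #
    map (\<lambda>A. (pm_scale (dissection_sgn p A) (polygon_bar (region_polygon p A Root)), shuffle_nonroot p A)) As"
  have "splits (polygon_bar p) ?L"
    unfolding splits_def
  proof (intro conjI allI)
    show "set ?L \<subseteq> polygon_algebra \<times> polygon_algebra"
      by (auto intro: generated_subalgebra.intros shuffle_nonroot_generated)
    fix u v
    show "Poly_Mapping.lookup (polygon_bar p) (u @ v) =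
      (\<Sum>(y, z)\<leftarrow>?L. Poly_Mapping.lookup y u * Poly_Mapping.lookup z v)"
      using bar_coeff_append[of p u v] As
      by (simp add: bar_coeff_def lookup_bar_one comp_def sum_list_distinct_conv_sum_set coproduct_term_def lookup_shuffle_nonroot)
  qed
  then show ?thesis by blast
qed

lemma splits_generated: "x \<in> polygon_algebra \<Longrightarrow> \<exists>L. splits x L"
proof (induction rule: generated_subalgebra.induct)
  case (gen x)
  then show ?case using splits_polygon_bar by blast
next
  case one
  have "splits bar_one [(bar_one, bar_one)]"
    by (auto simp: splits_def lookup_bar_one intro: generated_subalgebra.one)
  then show ?case by blast
next
  case (add x y)
  then obtain L M where "splits x L" "splits y M" by blast
  then have "splits (x + y) (L @ M)" by (simp add: splits_def Poly_Mapping.lookup_add)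
  then show ?case by blast
next
  case (scale x c)
  then obtain L where L: "splits x L" by blast
  then have "splits (pm_scale c x) (map (map_prod (pm_scale c) id) L)"
    by (auto simp: splits_def split_def comp_def mult.assoc sum_list_const_mult intro: generated_subalgebra.scale)
  then show ?case by blast
next
  case (mult x y)
  then show ?case using splits_shuffle by blast
qed

lemma coproduct_generated:
  assumes "x \<in> polygon_algebra"
  shows "coproduct x \<in> pm.span {y \<otimes> z | y z. y \<in> polygon_algebra \<and> z \<in> polygon_algebra}"
proof -
  obtain L where L: "splits x L" using splits_generated[OF assms] by blast
  have "Poly_Mapping.lookup (\<Sum>(y, z)\<leftarrow>L. y \<otimes> z) (u, v) =
    (\<Sum>(y, z)\<leftarrow>L. Poly_Mapping.lookup y u * Poly_Mapping.lookup z v)" for u v and L :: "('a polygon bar \<times> 'a polygon bar) list"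
    by (induction L) (auto simp: Poly_Mapping.lookup_add lookup_tensor)
  then have "coproduct x = (\<Sum>(y, z)\<leftarrow>L. y \<otimes> z)"
    using L by (intro poly_mapping_eqI) (auto simp: splits_def lookup_coproduct)
  moreover have "set L \<subseteq> polygon_algebra \<times> polygon_algebra" using L by (simp add: splits_def)
  then have "(\<Sum>(y, z)\<leftarrow>L. y \<otimes> z) \<in> pm.span {y \<otimes> z | y z. y \<in> polygon_algebra \<and> z \<in> polygon_algebra}"
    by (induction L) (auto intro!: pm.span_zero pm.span_add intro: pm.span_base)
  ultimately show ?thesis by simp
qed

text \<open>By the coproduct formula, the antipode of \<open>polygon_bar p\<close> is determined recursively by the antipodes
  for the polygons cut out as root regions, which have smaller weight.\<close>

lemma antipode_polygon_bar: "antipode (polygon_bar p) \<in> polygon_algebra"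
proof (induction "weight p" arbitrary: p rule: less_induct)
  case less
  let ?l = Poly_Mapping.lookup and ?adm = "admissible_dissections p" and ?R = "\<lambda>A. region_polygon p A Root"
  let ?rest = "\<Sum>A\<in>?adm - {{}}. pm_scale (dissection_sgn p A) (shuffle (antipode (polygon_bar (?R A))) (shuffle_nonroot p A))"
  have flat_S: "flat (antipode x)" if "flat x" for x :: "'a polygon bar"
    using that unfolding flat_iff lookup_antipode[OF that] signed_rev_def by auto
  have empty: "{} \<in> ?adm" by (simp add: admissible_iff dissections_eq)
  have "antipode (polygon_bar (?R A)) \<in> polygon_algebra" if "A \<in> ?adm - {{}}" for A
  proof (rule less)
    have "card A \<noteq> 0" using that finite_admissible by (auto simp: card_eq_0_iff)
    then show "weight (?R A) < weight p" using weight_root_polygon[of A p] weight_pos[of p] that by auto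
  qed
  then have rest: "?rest \<in> polygon_algebra"
    by (auto intro!: sum_generated generated_subalgebra.scale generated_subalgebra.mult shuffle_nonroot_generated)
  \<comment> \<open>The index \<open>None\<close> stands for the summand 1 tensor B(\<pi>) of the
    coproduct, and \<open>Some A\<close> for the admissible dissection \<open>A\<close>.\<close>
  let ?g = "\<lambda>i. case i of None \<Rightarrow> shuf_unit | Some A \<Rightarrow> (\<lambda>u. dissection_sgn p A * bar_coeff (?R A) u)"
  let ?h = "\<lambda>i. case i of None \<Rightarrow> bar_coeff p | Some A \<Rightarrow> shuf_prod.F (behind_coeff p A) A"
  let ?I = "insert None (Some ` ?adm)"
  have "bar_coeff p (u @ v) = (\<Sum>i\<in>?I. ?g i u * ?h i v)" for u v
    unfolding bar_coeff_append[of p u v] by (simp add: sum.reindex coproduct_term_def shuf_unit_def mult.assoc)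
  then have "(\<Sum>i\<in>?I. shuf (signed_rev (?g i)) (?h i) w) = of_bool (w = []) * bar_coeff p []" for w
    by (rule convolution_signed_rev)
  \<comment> \<open>The convolution with the antipode vanishes also at the empty word, because the
    counit is zero on bar elements.\<close>
  then have "(\<Sum>i\<in>?I. shuf (signed_rev (?g i)) (?h i) w) = 0" for w
    by (simp only: bar_coeff_Nil mult_zero_right)
  moreover have "signed_rev shuf_unit = (shuf_unit :: 'a polygon word \<Rightarrow> rat)"
    by (auto simp: signed_rev_def shuf_unit_def)
  moreover have "shuf (signed_rev (\<lambda>u. dissection_sgn p A * bar_coeff (?R A) u)) h w =
    dissection_sgn p A * shuf (signed_rev (bar_coeff (?R A))) h w" for A h w
    unfolding shuf_cmult_left[symmetric] by (simp add: signed_rev_def[abs_def] mult.left_commute)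
  ultimately have e1: "bar_coeff p w + (\<Sum>A\<in>?adm. dissection_sgn p A *
    shuf (signed_rev (bar_coeff (?R A))) (shuf_prod.F (behind_coeff p A) A) w) = 0" for w
    by (simp add: sum.reindex shuf_unit_left)
  \<comment> \<open>The dissection without arrows contributes the antipode of the bar element of
    \<open>p\<close> itself, for which the identity is then solved.\<close>
  have e2: "dissection_sgn p {} * shuf (signed_rev (bar_coeff (?R {}))) (shuf_prod.F (behind_coeff p {}) {}) w =
      signed_rev (bar_coeff p) w" for w
    by (simp add: dissection_sgn_def region_polygon_empty)
  have eq: "bar_coeff p w + (signed_rev (bar_coeff p) w + (\<Sum>A\<in>?adm - {{}}. dissection_sgn p A *
    shuf (signed_rev (bar_coeff (?R A))) (shuf_prod.F (behind_coeff p A) A) w)) = 0" for w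
    using e1[of w] unfolding sum.remove[OF finite_admissible_dissections empty] e2 .
  have S: "antipode (polygon_bar p) = pm_scale (- 1) (polygon_bar p + ?rest)"
  proof (rule poly_mapping_eqI)
    fix w
    have "?l ?rest w = (\<Sum>A\<in>?adm - {{}}. dissection_sgn p A *
      shuf (signed_rev (bar_coeff (?R A))) (shuf_prod.F (behind_coeff p A) A) w)"
      by (simp add: Poly_Mapping.lookup_sum lookup_shuffle flat_S flat_polygon_bar lookup_shuffle_nonroot
          lookup_antipode bar_coeff_def)
    then show "?l (antipode (polygon_bar p)) w = ?l (pm_scale (- 1) (polygon_bar p + ?rest)) w"
      using eq[of w]
      by (simp add: Poly_Mapping.lookup_minus Poly_Mapping.lookup_uminus lookup_antipode[OF flat_polygon_bar] bar_coeff_def; linarith)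
  qed
  show ?case
    unfolding S by (intro generated_subalgebra.scale generated_subalgebra.add generated_subalgebra.gen rest) simp
qed

lemma antipode_generated: "x \<in> polygon_algebra \<Longrightarrow> antipode x \<in> polygon_algebra"
proof (induction rule: generated_subalgebra.induct)
  case (gen x)
  then show ?case using antipode_polygon_bar by blast
next
  case one
  have "antipode bar_one = (bar_one :: 'a polygon bar)"
    by (rule poly_mapping_eqI) (simp add: lookup_antipode flat_bar_one signed_rev_def lookup_bar_one)
  then show ?case by (simp add: generated_subalgebra.one)
next
  case (add x y)
  have "flat x" "flat y" "flat (x + y)" using add.hyps by (auto intro: flat_generated generated_subalgebra.add)
  then have "antipode (x + y) = antipode x + antipode y"
    by (intro poly_mapping_eqI) (simp add: lookup_antipode signed_rev_def Poly_Mapping.lookup_add distrib_left)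
  then show ?case using add.IH by (simp add: generated_subalgebra.add)
next
  case (scale x c)
  have "flat x" "flat (pm_scale c x)" using scale.hyps by (auto intro: flat_generated generated_subalgebra.scale)
  then have "antipode (pm_scale c x) = pm_scale c (antipode x)"
    by (intro poly_mapping_eqI) (simp add: lookup_antipode signed_rev_def mult.left_commute)
  then show ?case using scale.IH by (simp add: generated_subalgebra.scale)
next
  case (mult x y)
  have "flat x" "flat y" "flat (antipode x)" "flat (antipode y)"
    using mult.hyps mult.IH by (auto intro: flat_generated)
  then have "antipode (shuffle x y) = shuffle (antipode x) (antipode y)"
    by (intro poly_mapping_eqI) (simp add: lookup_antipode lookup_shuffle flat_shuffle signed_rev_shuf)
  then show ?case using mult.IH by (simp add: generated_subalgebra.mult)
qed

theorem hopf_subalgebra_polygon_algebra: "hopf_subalgebra polygon_algebra"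
proof -
  have "pm.subspace polygon_algebra"
    by (rule pm.subspaceI) (auto intro: zero_generated generated_subalgebra.add generated_subalgebra.scale)
  then show ?thesis
    unfolding hopf_subalgebra_def
    using coproduct_generated antipode_generated
    by (auto intro: generated_subalgebra.one generated_subalgebra.mult)
qed

theorem theorem7p1:
  shows "(\<forall>\<pi> :: 'r polygon.
            coproduct (polygon_bar \<pi>) =
              bar_one \<otimes> polygon_bar \<pi> +
              (\<Sum>A\<in>admissible_dissections \<pi>.
                 pm_scale (dissection_sgn \<pi> A)
                   (polygon_bar (region_polygon \<pi> A Root) \<otimes> shuffle_nonroot \<pi> A)))
         \<and> hopf_subalgebra (generated_subalgebra (range (polygon_bar :: 'r polygon \<Rightarrow> 'r polygon bar)))"
  using coproduct_polygon_bar hopf_subalgebra_polygon_algebra by blast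

end
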